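(* Let $\mathcal{M}$ be a Riemannian manifold modeled on a Hilbert space, let $S\subset\mathcal{M}$, and let $f:\mathcal{M}\to\mathbb{R}\cup\{\infty\}$ be a proper function. Suppose $\Omega:=\operatorname{argmin}_Sf$ is the set of weak sharp minima for the problem $\min_Sf$ with modulus $\alpha>0$. Then: 1. If $p\in\Omega$ and $f$ is Fréchet decomposable on $S$ at the point $p$, then $$\alpha\,\mathbb{B}_{T_p^*\mathcal{M}}\cap\hat N^{\mathcal{M}}_\Omega(p)\subset\hat\partial_{\mathcal{M}}f(p)+\hat N^{\mathcal{M}}_S(p).$$ 2. If $p\in\Omega$, $f$ is Lipschitzian around $p$ and $S$ is closed, then $$\alpha\,\mathbb{B}_{T_p^*\mathcal{M}}\cap\hat N^{\mathcal{M}}_\Omega(p)\subset\partial_{\mathcal{M}}f(p)+N^{\mathcal{M}}_S(p).$$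
   Context: A Riemannian manifold $\mathcal{M}$ here is a $C^\infty$ manifold modeled on a (possibly infinite-dimensional) real Hilbert space, with a smooth Riemannian metric $g$ such that for each $p$ the norm $\|x\|_p=g_p(x,x)^{1/2}$ on $T_p\mathcal{M}$ is equivalent to the model norm. $T_p^*\mathcal{M}$ carries the dual norm, with closed unit ball $\mathbb{B}_{T_p^*\mathcal{M}}$. $d$ is the Riemannian distance, $\operatorname{dist}(u;\Omega):=\inf_{q\in\Omega}d(u,q)$. A function is proper if it is finite somewhere; it is Lipschitzian around $p$ if it is Lipschitz (with respect to $d$, for some constant) on a neighborhood of $p$. $\exp_p$ is the exponential map restricted to a sufficiently small neighborhood of $0$ in $T_p\mathcal{M}$, on which it is a diffeomorphism onto a neighborhood of $p$. Weak sharp minima: $\Omega=\operatorname{argmin}_Sf$ is the set of (global) weak sharp minima for $\min_Sf$ with modulus $\alpha>0$ if $f(u)\ge f(p)+\alpha\operatorname{dist}(u;\Omega)$ for all $p\in\Omega$ and $u\in S$. For a Banach space $E$ and $h$ defined near $x\in E$ with values in $\mathbb{R}\cup\{\infty\}$, $h(x)<\infty$: the Fréchet subdifferential is $\hat\partial h(x)=\{x^*\in E^*:\liminf_{u\to x}\frac{h(u)-h(x)-\langle x^*,u-x\rangle}{\|u-x\|}\ge0\}$, and the limiting subdifferential $\partial h(x)$ is the set of $x^*\in E^*$ for which there are $x_i\to x$ with $h(x_i)\to h(x)$ and $x_i^*\in\hat\partial h(x_i)$ with $\lim_i x_i^*=x^*$. For $A\subset E$ and $x\in\operatorname{cl}A$: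 the Fréchet normal cone is $\hat N_A(x)=\{x^*\in E^*:\limsup_{u\to x,\,u\in A}\frac{\langle x^*,u-x\rangle}{\|u-x\|}\le0\}$, and the limiting normal cone $N_A(x)$ is the set of limits of sequences $x_i^*\in\hat N_A(x_i)$ with $x_i\in A$, $x_i\to x$. On $\mathcal{M}$: for $f$ finite at $p$, $\hat\partial_{\mathcal{M}}f(p):=\hat\partial(f\circ\exp_p)(0)$ and $\partial_{\mathcal{M}}f(p):=\partial(f\circ\exp_p)(0)$. For $A\subset\mathcal{M}$, $p\in\operatorname{cl}A$: $\hat N^{\mathcal{M}}_A(p):=\hat N_{\exp_p^{-1}A_*}(0)$ and $N^{\mathcal{M}}_A(p):=N_{\exp_p^{-1}A_*}(0)$, where $A_*$ is the intersection of $A$ with a small neighborhood of $p$ on which $\exp_p^{-1}$ is defined. Fréchet decomposability: with $\delta_S$ the indicator function ($0$ on $S$, $\infty$ off $S$), $f$ (finite at $p\in S$) is Fréchet decomposable at $p$ on $S$ if $\hat\partial_{\mathcal{M}}(f+\delta_S)(p)\subset\hat\partial_{\mathcal{M}}f(p)+\hat N^{\mathcal{M}}_S(p)$.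
   Formalization: In the limiting subdifferential and limiting normal cone, limits of functionals are weak* sequential limits, not norm limits; with norm limits part 2 fails in infinite dimensions (f(x)=inf_n(x_n+1/n), S={0} in ℓ²). *)

theory Defs
  imports "HOL-Analysis.Analysis" "HOL-Library.Function_Algebras" "HOL-Library.Set_Algebras"
begin

instantiation "fun" :: (type, real_vector) real_vector
begin

definition scaleR_fun :: "real \<Rightarrow> ('a \<Rightarrow> 'b) \<Rightarrow> 'a \<Rightarrow> 'b"
  where "scaleR_fun r f = (\<lambda>x. r *\<^sub>R f x)"

instance
  by standard
    (simp_all add: scaleR_fun_def fun_eq_iff scaleR_add_left scaleR_add_right)

end


section \<open>Smooth maps between open subsets of Banach spaces\<close>

definition bounded_multilinear :: "nat \<Rightarrow> ('a::real_normed_vector list \<Rightarrow> 'b::real_normed_vector) \<Rightarrow> bool"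
  where "bounded_multilinear k T \<longleftrightarrow>
    (\<forall>vs i. length vs = k \<and> i < k \<longrightarrow> linear (\<lambda>v. T (vs[i := v]))) \<and>
    (\<exists>C. \<forall>vs. length vs = k \<longrightarrow> norm (T vs) \<le> C * prod_list (map norm vs))"

text \<open>\<open>D k x [v1, \<dots>, vk]\<close> is the \<open>k\<close>-th derivative of \<open>f\<close> at \<open>x\<close>, as a bounded
  \<open>k\<close>-linear map.  The last clause says that \<open>D (Suc k)\<close> is the Frechet derivative of \<open>D k\<close> with
  respect to the operator norm on \<open>k\<close>-linear maps.\<close>

definition smooth_on :: "'a::real_normed_vector set \<Rightarrow> ('a \<Rightarrow> 'b::real_normed_vector) \<Rightarrow> bool"
  where "smooth_on U f \<longleftrightarrow> open U \<and>
    (\<exists>D :: nat \<Rightarrow> 'a \<Rightarrow> 'a list \<Rightarrow> 'b.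
      (\<forall>x\<in>U. D 0 x [] = f x) \<and>
      (\<forall>k. \<forall>x\<in>U. bounded_multilinear k (D k x)) \<and>
      (\<forall>k. \<forall>x\<in>U. \<forall>\<epsilon>>0. \<exists>\<delta>>0. \<forall>y\<in>U. norm (y - x) < \<delta> \<longrightarrow>
         (\<forall>vs. length vs = k \<and> (\<forall>v\<in>set vs. norm v \<le> 1) \<longrightarrow>
            norm (D k y vs - D k x vs - D (Suc k) x ((y - x) # vs)) \<le> \<epsilon> * norm (y - x))))"


section \<open>Manifolds and tangent spaces\<close>

text \<open>A chart is a pair of its domain and its coordinate map; the values of the coordinate map
  outside the domain are irrelevant.\<close>

type_synonym ('m, 'a) chart = "'m set \<times> ('m \<Rightarrow> 'a)"

abbreviation chart_inv :: "('m, 'a) chart \<Rightarrow> 'a \<Rightarrow> 'm"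
  where "chart_inv c \<equiv> inv_into (fst c) (snd c)"

definition transition :: "('m, 'a) chart \<Rightarrow> ('m, 'a) chart \<Rightarrow> 'a \<Rightarrow> 'a"
  where "transition c c' = snd c' \<circ> chart_inv c"

definition smooth_atlas :: "('m::t2_space, 'a::{real_inner, banach}) chart set \<Rightarrow> bool"
  where "smooth_atlas A \<longleftrightarrow>
    (\<Union>c\<in>A. fst c) = UNIV \<and>
    (\<forall>c\<in>A. open (fst c) \<and> open (snd c ` fst c) \<and>
       homeomorphism (fst c) (snd c ` fst c) (snd c) (chart_inv c)) \<and>
    (\<forall>c\<in>A. \<forall>c'\<in>A. smooth_on (snd c ` (fst c \<inter> fst c')) (transition c c'))"

definition charts_at :: "('m, 'a) chart set \<Rightarrow> 'm \<Rightarrow> ('m, 'a) chart set"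
  where "charts_at A p = {c \<in> A. p \<in> fst c}"

text \<open>A tangent vector at \<open>p\<close> is the family of its representatives in all charts at \<open>p\<close>,
  related by the derivatives of the transition maps (and extended by \<open>0\<close>).\<close>

type_synonym ('m, 'a) tvec = "('m, 'a) chart \<Rightarrow> 'a"

definition tangent_space ::
    "('m, 'a::real_normed_vector) chart set \<Rightarrow> 'm \<Rightarrow> ('m, 'a) tvec set"
  where "tangent_space A p = {v.
    (\<forall>c\<in>charts_at A p. \<forall>c'\<in>charts_at A p.
       v c' = frechet_derivative (transition c c') (at (snd c p)) (v c)) \<and>
    (\<forall>c. c \<notin> charts_at A p \<longrightarrow> v c = 0)}"

text \<open>The tangent vector at \<open>p\<close> represented by \<open>a\<close> in the chart \<open>c\<close>.\<close>

definition tangent_vec ::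
    "('m, 'a::real_normed_vector) chart set \<Rightarrow> ('m, 'a) chart \<Rightarrow> 'm \<Rightarrow> 'a \<Rightarrow> ('m, 'a) tvec"
  where "tangent_vec A c p a = (\<lambda>c'. if c' \<in> charts_at A p
    then frechet_derivative (transition c c') (at (snd c p)) a else 0)"

definition velocity ::
    "('m, 'a::real_normed_vector) chart set \<Rightarrow> real set \<Rightarrow> (real \<Rightarrow> 'm) \<Rightarrow> real \<Rightarrow> ('m, 'a) tvec"
  where "velocity A I \<gamma> t = (\<lambda>c. if c \<in> charts_at A (\<gamma> t)
    then vector_derivative (snd c \<circ> \<gamma>) (at t within I) else 0)"


section \<open>Riemannian metrics\<close>

type_synonym ('m, 'a) metric = "'m \<Rightarrow> ('m, 'a) tvec \<Rightarrow> ('m, 'a) tvec \<Rightarrow> real"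

definition tnorm :: "('m, 'a) metric \<Rightarrow> 'm \<Rightarrow> ('m, 'a) tvec \<Rightarrow> real"
  where "tnorm g p v = sqrt (g p v v)"

definition metric_coord ::
    "('m, 'a::real_normed_vector) chart set \<Rightarrow> ('m, 'a) metric \<Rightarrow> ('m, 'a) chart
      \<Rightarrow> 'a \<Rightarrow> 'a \<Rightarrow>\<^sub>L 'a \<Rightarrow>\<^sub>L real"
  where "metric_coord A g c x = (let p = chart_inv c x in
    Blinfun (\<lambda>a. Blinfun (\<lambda>b. g p (tangent_vec A c p a) (tangent_vec A c p b))))"

definition riemannian_metric ::
    "('m, 'a::real_normed_vector) chart set \<Rightarrow> ('m, 'a) metric \<Rightarrow> bool"
  where "riemannian_metric A g \<longleftrightarrow>
    (\<forall>p. \<forall>u\<in>tangent_space A p. \<forall>v\<in>tangent_space A p. \<forall>w\<in>tangent_space A p. \<forall>r.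
       g p u v = g p v u \<and>
       g p (u + v) w = g p u w + g p v w \<and>
       g p (r *\<^sub>R u) v = r * g p u v \<and>
       (u \<noteq> 0 \<longrightarrow> 0 < g p u u)) \<and>
    (\<forall>p. \<forall>c\<in>charts_at A p. \<exists>m>0. \<exists>M>0. \<forall>v\<in>tangent_space A p.
       m * norm (v c) \<le> tnorm g p v \<and> tnorm g p v \<le> M * norm (v c)) \<and>
    (\<forall>c\<in>A. smooth_on (snd c ` fst c) (metric_coord A g c))"

locale riemannian_manifold =
  fixes A :: "('m::t2_space, 'a::{real_inner, banach}) chart set"
    and g :: "('m, 'a) metric"
  assumes smooth_atlas: "smooth_atlas A"
    and riemannian_metric: "riemannian_metric A g"


section \<open>Riemannian distance\<close>

text \<open>\<open>K\<close> contains the break points; the derivatives at the ends of each piece are one-sided.\<close>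

definition piecewise_C1_curve ::
    "('m::topological_space, 'a::real_normed_vector) chart set \<Rightarrow> (real \<Rightarrow> 'm) \<Rightarrow> bool"
  where "piecewise_C1_curve A \<gamma> \<longleftrightarrow> continuous_on {0..1} \<gamma> \<and>
    (\<exists>K. finite K \<and>
      (\<forall>c\<in>A. \<forall>s t. 0 \<le> s \<and> s < t \<and> t \<le> 1 \<and> {s<..<t} \<inter> K = {} \<and> \<gamma> ` {s..t} \<subseteq> fst c \<longrightarrow>
        (\<exists>D. continuous_on {s..t} D \<and>
          (\<forall>r\<in>{s..t}. ((snd c \<circ> \<gamma>) has_vector_derivative D r) (at r within {s..t})))))"

definition curve_length ::
    "('m, 'a::real_normed_vector) chart set \<Rightarrow> ('m, 'a) metric \<Rightarrow> (real \<Rightarrow> 'm) \<Rightarrow> real"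
  where "curve_length A g \<gamma> = integral {0..1} (\<lambda>t. tnorm g (\<gamma> t) (velocity A {0..1} \<gamma> t))"

text \<open>The distance between different components is \<open>\<infinity>\<close>.\<close>

definition riem_dist ::
    "('m::topological_space, 'a::real_normed_vector) chart set \<Rightarrow> ('m, 'a) metric \<Rightarrow> 'm \<Rightarrow> 'm \<Rightarrow> ereal"
  where "riem_dist A g p q =
    (INF \<gamma>\<in>{\<gamma>. piecewise_C1_curve A \<gamma> \<and> \<gamma> 0 = p \<and> \<gamma> 1 = q}. ereal (curve_length A g \<gamma>))"

definition set_dist ::
    "('m::topological_space, 'a::real_normed_vector) chart set \<Rightarrow> ('m, 'a) metric \<Rightarrow> 'm \<Rightarrow> 'm set \<Rightarrow> ereal"
  where "set_dist A g u \<Omega> = (INF q\<in>\<Omega>. riem_dist A g u q)"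


section \<open>Geodesics and the exponential map\<close>

text \<open>Christoffel symbols of the first kind of the Levi-Civita connection:
  \<open>\<Gamma>(u, v; w) = (\<partial>\<^sub>u g(v, w) + \<partial>\<^sub>v g(u, w) - \<partial>\<^sub>w g(u, v)) / 2\<close> with constant \<open>u\<close>, \<open>v\<close>, \<open>w\<close>.\<close>

definition christoffel ::
    "('m, 'a::real_normed_vector) chart set \<Rightarrow> ('m, 'a) metric \<Rightarrow> ('m, 'a) chart
      \<Rightarrow> 'a \<Rightarrow> 'a \<Rightarrow> 'a \<Rightarrow> 'a \<Rightarrow> real"
  where "christoffel A g c x u v w =
    (let dG = frechet_derivative (metric_coord A g c) (at x)
     in (dG u v w + dG v u w - dG w u v) / 2)"

text \<open>The geodesic equation with its free index lowered by the metric.\<close>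

definition geodesic_on ::
    "('m::topological_space, 'a::real_normed_vector) chart set \<Rightarrow> ('m, 'a) metric
      \<Rightarrow> real set \<Rightarrow> (real \<Rightarrow> 'm) \<Rightarrow> bool"
  where "geodesic_on A g I \<gamma> \<longleftrightarrow> continuous_on I \<gamma> \<and>
    (\<forall>c\<in>A. \<exists>x' x''. \<forall>t\<in>I. \<gamma> t \<in> fst c \<longrightarrow>
       ((snd c \<circ> \<gamma>) has_vector_derivative x' t) (at t within I) \<and>
       (x' has_vector_derivative x'' t) (at t within I) \<and>
       (\<forall>w. metric_coord A g c (snd c (\<gamma> t)) (x'' t) w
            + christoffel A g c (snd c (\<gamma> t)) (x' t) (x' t) w = 0))"

definition geodesic_from ::
    "('m::topological_space, 'a::real_normed_vector) chart set \<Rightarrow> ('m, 'a) metric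
      \<Rightarrow> 'm \<Rightarrow> ('m, 'a) tvec \<Rightarrow> (real \<Rightarrow> 'm) \<Rightarrow> bool"
  where "geodesic_from A g p v \<gamma> \<longleftrightarrow>
    geodesic_on A g {0..1} \<gamma> \<and> \<gamma> 0 = p \<and> velocity A {0..1} \<gamma> 0 = v"

text \<open>Unspecified where the geodesic with initial velocity \<open>v\<close> does not exist up to time 1.\<close>

definition exp_map ::
    "('m::topological_space, 'a::real_normed_vector) chart set \<Rightarrow> ('m, 'a) metric
      \<Rightarrow> 'm \<Rightarrow> ('m, 'a) tvec \<Rightarrow> 'm"
  where "exp_map A g p v = (THE q. \<exists>\<gamma>. geodesic_from A g p v \<gamma> \<and> \<gamma> 1 = q)"

text \<open>The neighborhoods of \<open>0\<close> to which the exponential map is restricted: star-shaped, contained in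
  the domain of \<open>exp_map A g p\<close>, and mapped diffeomorphically onto a neighborhood of \<open>p\<close>.  For
  star-shaped \<open>W\<close>, lying in the domain of \<open>exp\<^sub>p\<close> means that for \<open>v \<in> W\<close> the curve
  \<open>\<lambda>t. exp\<^sub>p (t v)\<close> is the geodesic starting at \<open>p\<close> with velocity \<open>v\<close>.\<close>

definition normal_nbhd ::
    "('m::topological_space, 'a::real_normed_vector) chart set \<Rightarrow> ('m, 'a) metric
      \<Rightarrow> 'm \<Rightarrow> ('m, 'a) tvec set \<Rightarrow> bool"
  where "normal_nbhd A g p W \<longleftrightarrow> (let e = exp_map A g p in
    W \<subseteq> tangent_space A p \<and> 0 \<in> W \<and>
    (\<forall>v\<in>W. \<exists>\<epsilon>>0. \<forall>u\<in>tangent_space A p. tnorm g p (u - v) < \<epsilon> \<longrightarrow> u \<in> W) \<and>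
    (\<forall>v\<in>W. (\<forall>t\<in>{0..1}. t *\<^sub>R v \<in> W) \<and> geodesic_from A g p v (\<lambda>t. e (t *\<^sub>R v))) \<and>
    inj_on e W \<and> open (e ` W) \<and>
    (\<forall>c\<in>charts_at A p. \<forall>c'\<in>A.
       smooth_on ((\<lambda>v. v c) ` {v\<in>W. e v \<in> fst c'}) (\<lambda>a. snd c' (e (tangent_vec A c p a))) \<and>
       smooth_on (snd c' ` (fst c' \<inter> e ` W)) (\<lambda>x. inv_into W e (chart_inv c' x) c)))"


section \<open>Subdifferentials and normal cones in Banach spaces\<close>

text \<open>The Banach space is a linear subspace \<open>V\<close> with a norm \<open>N\<close>; functionals are extended by \<open>0\<close>
  off \<open>V\<close>.\<close>

definition dual :: "'v::real_vector set \<Rightarrow> ('v \<Rightarrow> real) \<Rightarrow> ('v \<Rightarrow> real) set"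
  where "dual V N = {\<phi>.
    (\<forall>u\<in>V. \<forall>v\<in>V. \<phi> (u + v) = \<phi> u + \<phi> v) \<and> (\<forall>r. \<forall>v\<in>V. \<phi> (r *\<^sub>R v) = r * \<phi> v) \<and>
    (\<exists>C. \<forall>v\<in>V. \<bar>\<phi> v\<bar> \<le> C * N v) \<and> (\<forall>v. v \<notin> V \<longrightarrow> \<phi> v = 0)}"

definition dual_norm :: "'v::real_vector set \<Rightarrow> ('v \<Rightarrow> real) \<Rightarrow> ('v \<Rightarrow> real) \<Rightarrow> real"
  where "dual_norm V N \<phi> = (SUP v\<in>{v\<in>V. N v \<le> 1}. \<bar>\<phi> v\<bar>)"

definition dual_ball :: "'v::real_vector set \<Rightarrow> ('v \<Rightarrow> real) \<Rightarrow> ('v \<Rightarrow> real) set"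
  where "dual_ball V N = {\<phi> \<in> dual V N. dual_norm V N \<phi> \<le> 1}"

text \<open>The filter of punctured neighborhoods of \<open>x\<close> in the norm \<open>N\<close>, intersected with \<open>A\<close>.\<close>

definition nearby :: "'v::real_vector set \<Rightarrow> ('v \<Rightarrow> real) \<Rightarrow> 'v \<Rightarrow> 'v filter"
  where "nearby A N x = (INF r\<in>{0<..}. principal {u\<in>A. u \<noteq> x \<and> N (u - x) < r})"

text \<open>Functions are given on an open set \<open>W\<close> of \<open>V\<close>; their values off \<open>W\<close> are irrelevant.\<close>

definition frechet_subdiff ::
    "'v::real_vector set \<Rightarrow> ('v \<Rightarrow> real) \<Rightarrow> 'v set \<Rightarrow> ('v \<Rightarrow> ereal) \<Rightarrow> 'v \<Rightarrow> ('v \<Rightarrow> real) set"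
  where "frechet_subdiff V N W h x = {\<phi> \<in> dual V N. \<bar>h x\<bar> \<noteq> \<infinity> \<and>
    0 \<le> Liminf (nearby W N x) (\<lambda>u. (h u - h x - ereal (\<phi> (u - x))) / ereal (N (u - x)))}"

text \<open>As usual for limiting subdifferentials and limiting normal cones in infinite dimensions,
  limits of sequences of functionals are weak* limits.  (For norm limits the limiting subdifferential
  of a Lipschitz function can be empty, e.g. for \<open>x \<mapsto> inf\<^sub>n (x\<^sub>n + 1/n)\<close> at \<open>0\<close> in \<open>\<ell>\<^sup>2\<close>.)\<close>

definition limiting_subdiff ::
    "'v::real_vector set \<Rightarrow> ('v \<Rightarrow> real) \<Rightarrow> 'v set \<Rightarrow> ('v \<Rightarrow> ereal) \<Rightarrow> 'v \<Rightarrow> ('v \<Rightarrow> real) set"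
  where "limiting_subdiff V N W h x = {\<phi> \<in> dual V N. \<bar>h x\<bar> \<noteq> \<infinity> \<and>
    (\<exists>xs \<phi>s. (\<forall>i::nat. xs i \<in> W \<and> \<phi>s i \<in> frechet_subdiff V N W h (xs i)) \<and>
      (\<lambda>i. N (xs i - x)) \<longlonglongrightarrow> 0 \<and> (\<lambda>i. h (xs i)) \<longlonglongrightarrow> h x \<and>
      (\<forall>v\<in>V. (\<lambda>i. \<phi>s i v) \<longlonglongrightarrow> \<phi> v))}"

definition frechet_normal ::
    "'v::real_vector set \<Rightarrow> ('v \<Rightarrow> real) \<Rightarrow> 'v set \<Rightarrow> 'v \<Rightarrow> ('v \<Rightarrow> real) set"
  where "frechet_normal V N A x = {\<phi> \<in> dual V N.
    Limsup (nearby A N x) (\<lambda>u. ereal (\<phi> (u - x) / N (u - x))) \<le> 0}"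

definition limiting_normal ::
    "'v::real_vector set \<Rightarrow> ('v \<Rightarrow> real) \<Rightarrow> 'v set \<Rightarrow> 'v \<Rightarrow> ('v \<Rightarrow> real) set"
  where "limiting_normal V N A x = {\<phi> \<in> dual V N.
    (\<exists>xs \<phi>s. (\<forall>i::nat. xs i \<in> A \<and> \<phi>s i \<in> frechet_normal V N A (xs i)) \<and>
      (\<lambda>i. N (xs i - x)) \<longlonglongrightarrow> 0 \<and> (\<forall>v\<in>V. (\<lambda>i. \<phi>s i v) \<longlonglongrightarrow> \<phi> v))}"


section \<open>Subdifferentials and normal cones on manifolds\<close>

text \<open>The neighborhood \<open>W\<close> only serves to restrict \<open>exp_map A g p\<close>: all four notions depend on the
  germ at \<open>0\<close>, so that any other normal neighborhood yields the same functionals.\<close>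

definition mf_frechet_subdiff ::
    "('m::topological_space, 'a::real_normed_vector) chart set \<Rightarrow> ('m, 'a) metric
      \<Rightarrow> ('m \<Rightarrow> ereal) \<Rightarrow> 'm \<Rightarrow> (('m, 'a) tvec \<Rightarrow> real) set"
  where "mf_frechet_subdiff A g f p = {\<phi>. \<exists>W. normal_nbhd A g p W \<and>
    \<phi> \<in> frechet_subdiff (tangent_space A p) (tnorm g p) W (f \<circ> exp_map A g p) 0}"

definition mf_limiting_subdiff ::
    "('m::topological_space, 'a::real_normed_vector) chart set \<Rightarrow> ('m, 'a) metric
      \<Rightarrow> ('m \<Rightarrow> ereal) \<Rightarrow> 'm \<Rightarrow> (('m, 'a) tvec \<Rightarrow> real) set"
  where "mf_limiting_subdiff A g f p = {\<phi>. \<exists>W. normal_nbhd A g p W \<and>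
    \<phi> \<in> limiting_subdiff (tangent_space A p) (tnorm g p) W (f \<circ> exp_map A g p) 0}"

definition mf_frechet_normal ::
    "('m::topological_space, 'a::real_normed_vector) chart set \<Rightarrow> ('m, 'a) metric
      \<Rightarrow> 'm set \<Rightarrow> 'm \<Rightarrow> (('m, 'a) tvec \<Rightarrow> real) set"
  where "mf_frechet_normal A g S p = {\<phi>. \<exists>W. normal_nbhd A g p W \<and>
    \<phi> \<in> frechet_normal (tangent_space A p) (tnorm g p) {v\<in>W. exp_map A g p v \<in> S} 0}"

definition mf_limiting_normal ::
    "('m::topological_space, 'a::real_normed_vector) chart set \<Rightarrow> ('m, 'a) metric
      \<Rightarrow> 'm set \<Rightarrow> 'm \<Rightarrow> (('m, 'a) tvec \<Rightarrow> real) set"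
  where "mf_limiting_normal A g S p = {\<phi>. \<exists>W. normal_nbhd A g p W \<and>
    \<phi> \<in> limiting_normal (tangent_space A p) (tnorm g p) {v\<in>W. exp_map A g p v \<in> S} 0}"

definition cotangent_ball ::
    "('m, 'a::real_normed_vector) chart set \<Rightarrow> ('m, 'a) metric \<Rightarrow> 'm \<Rightarrow> (('m, 'a) tvec \<Rightarrow> real) set"
  where "cotangent_ball A g p = dual_ball (tangent_space A p) (tnorm g p)"

definition indicator_ext :: "'m set \<Rightarrow> 'm \<Rightarrow> ereal"
  where "indicator_ext S u = (if u \<in> S then 0 else \<infinity>)"

definition frechet_decomposable ::
    "('m::topological_space, 'a::real_normed_vector) chart set \<Rightarrow> ('m, 'a) metric
      \<Rightarrow> 'm set \<Rightarrow> ('m \<Rightarrow> ereal) \<Rightarrow> 'm \<Rightarrow> bool"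
  where "frechet_decomposable A g S f p \<longleftrightarrow> p \<in> S \<and> \<bar>f p\<bar> \<noteq> \<infinity> \<and>
    mf_frechet_subdiff A g (\<lambda>u. f u + indicator_ext S u) p
      \<subseteq> mf_frechet_subdiff A g f p + mf_frechet_normal A g S p"


section \<open>Weak sharp minima\<close>

definition proper_fun :: "('m \<Rightarrow> ereal) \<Rightarrow> bool"
  where "proper_fun f \<longleftrightarrow> (\<forall>u. f u \<noteq> - \<infinity>) \<and> (\<exists>u. f u \<noteq> \<infinity>)"

definition argmin_set :: "'m set \<Rightarrow> ('m \<Rightarrow> ereal) \<Rightarrow> 'm set"
  where "argmin_set S f = {p\<in>S. \<forall>u\<in>S. f p \<le> f u}"

definition weak_sharp_minima ::
    "('m::topological_space, 'a::real_normed_vector) chart set \<Rightarrow> ('m, 'a) metric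
      \<Rightarrow> 'm set \<Rightarrow> ('m \<Rightarrow> ereal) \<Rightarrow> 'm set \<Rightarrow> real \<Rightarrow> bool"
  where "weak_sharp_minima A g S f \<Omega> \<alpha> \<longleftrightarrow> \<Omega> = argmin_set S f \<and> 0 < \<alpha> \<and>
    (\<forall>p\<in>\<Omega>. \<forall>u\<in>S. f p + ereal \<alpha> * set_dist A g u \<Omega> \<le> f u)"

definition lipschitz_around ::
    "('m::topological_space, 'a::real_normed_vector) chart set \<Rightarrow> ('m, 'a) metric
      \<Rightarrow> ('m \<Rightarrow> ereal) \<Rightarrow> 'm \<Rightarrow> bool"
  where "lipschitz_around A g f p \<longleftrightarrow> (\<exists>U L. open U \<and> p \<in> U \<and> 0 < L \<and>
    (\<forall>x\<in>U. \<bar>f x\<bar> \<noteq> \<infinity>) \<and>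
    (\<forall>x\<in>U. \<forall>y\<in>U. \<bar>f x - f y\<bar> \<le> ereal L * riem_dist A g x y))"

end

theory Submission
  imports Defs "HOL-Library.Diagonal_Subsequence"
begin

text \<open>In normal coordinates at \<open>p\<close> the Riemannian distance agrees to first order with the norm of
  \<open>T\<^sub>p M\<close>.  For \<open>\<phi>\<close> of norm at most \<open>\<alpha>\<close> that is Frechet normal to \<open>\<Omega>\<close> this gives
  \<open>\<phi>(v) \<le> \<alpha> dist(exp\<^sub>p v; \<Omega>) + o(|v|)\<close>, and weak sharpness turns \<open>\<phi>\<close> into a Frechet subgradient
  of \<open>f + \<delta>\<^sub>S\<close> at \<open>p\<close>.  Frechet decomposability then yields the first inclusion.  The second one is the
  limiting sum rule for a Lipschitz function and a closed set in a Hilbert space: a smooth variational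
  principle produces approximate decompositions at nearby points, and bounded sequences of
  subgradients have weakly convergent subsequences.\<close>

text \<open>The modulus \<alpha> has to survive exactly, so the distance is needed up to a factor
  tending to 1, not just up to equivalence. Two facts give this: the metric is continuous in a
  chart, and the exponential map has derivative the identity at 0, because the geodesic with
  parameter v starts with velocity v. The distance is an infimum over curves that may have no
  minimizer, and without compactness curves are hard to confine to a chart; the estimate is
  therefore proved for each single curve and then passed to the infimum. All analysis takes place in
  the model Hilbert space. A chart at the base point identifies it with the tangent space; the two
  norms are only equivalent, but Frechet conditions do not see the difference. The subgradients and
  normals found at nearby points satisfy inequalities with quadratic error, stronger than the
  Frechet ones. The Lipschitz constant bounds these subgradients uniformly, and this bound is what
  permits the passage to a weak limit.\<close>

section \<open>Smooth maps as continuously differentiable maps\<close>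

text \<open>Frechet differentiability is the clause of \<open>smooth_on\<close> for
  \<open>k = 0\<close>. Continuity of the derivative comes from the clause for \<open>k = 1\<close>
  with error 1: it bounds \<open>f' y - f' x\<close> by
  \<open>(1 + \<bar>C\<bar>) * norm (y - x)\<close>, where \<open>C\<close> bounds the second
  derivative at \<open>x\<close>.\<close>

lemma smooth_onE:
  fixes f :: "'a::real_normed_vector \<Rightarrow> 'b::real_normed_vector"
  assumes "smooth_on U f"
  obtains f' :: "'a \<Rightarrow> 'a \<Rightarrow>\<^sub>L 'b" where "open U" "continuous_on U f'"
    "\<And>x. x \<in> U \<Longrightarrow> (f has_derivative blinfun_apply (f' x)) (at x)"
proof -
  obtain D :: "nat \<Rightarrow> 'a \<Rightarrow> 'a list \<Rightarrow> 'b" where U: "open U"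
    and D0: "\<And>x. x \<in> U \<Longrightarrow> D 0 x [] = f x"
    and ml: "\<And>k x. x \<in> U \<Longrightarrow> bounded_multilinear k (D k x)"
    and der: "\<And>k x \<epsilon>. x \<in> U \<Longrightarrow> \<epsilon> > 0 \<Longrightarrow> \<exists>\<delta>>0. \<forall>y\<in>U. norm (y - x) < \<delta> \<longrightarrow>
         (\<forall>vs. length vs = k \<and> (\<forall>v\<in>set vs. norm v \<le> 1) \<longrightarrow>
            norm (D k y vs - D k x vs - D (Suc k) x ((y - x) # vs)) \<le> \<epsilon> * norm (y - x))"
    using assms unfolding smooth_on_def by metis
  have bl: "bounded_linear (\<lambda>v. D 1 x [v])" if x: "x \<in> U" for x
  proof -
    obtain C where C: "\<And>vs. length vs = 1 \<Longrightarrow> norm (D 1 x vs) \<le> C * prod_list (map norm vs)"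
      using ml[OF x, of 1] unfolding bounded_multilinear_def by blast
    have "linear (\<lambda>v. D 1 x ([0][0 := v]))"
      using ml[OF x, of 1] unfolding bounded_multilinear_def
      by (metis length_Cons less_numeral_extra(1) list.size(3) One_nat_def)
    then have "linear (\<lambda>v. D 1 x [v])" by simp
    moreover have "norm (D 1 x [v]) \<le> norm v * C" for v
      using C[of "[v]"] by (simp add: mult.commute)
    ultimately show ?thesis
      unfolding linear_conv_bounded_linear[symmetric] bounded_linear_def bounded_linear_axioms_def by blast
  qed
  define f' where "f' x = Blinfun (\<lambda>v. D 1 x [v])" for x
  have f': "blinfun_apply (f' x) v = D 1 x [v]" if "x \<in> U" for x v
    unfolding f'_def using bounded_linear_Blinfun_apply[OF bl[OF that]] by simp
  have "(f has_derivative blinfun_apply (f' x)) (at x)" if x: "x \<in> U" for x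
    unfolding has_derivative_at_alt
  proof (intro conjI allI impI)
    show "bounded_linear (blinfun_apply (f' x))" by (rule blinfun.bounded_linear_right)
    fix e :: real assume "e > 0"
    then obtain d where d: "d > 0" "\<And>y. y \<in> U \<Longrightarrow> norm (y - x) < d \<Longrightarrow>
        norm (D 0 y [] - D 0 x [] - D 1 x [y - x]) \<le> e * norm (y - x)"
      using der[OF x, of e 0] by auto
    obtain r where r: "r > 0" "ball x r \<subseteq> U"
      using U x openE by blast
    show "\<exists>d>0. \<forall>y. norm (y - x) < d \<longrightarrow>
        norm (f y - f x - blinfun_apply (f' x) (y - x)) \<le> e * norm (y - x)"
    proof (intro exI[of _ "min d r"] conjI allI impI)
      fix y assume y: "norm (y - x) < min d r"
      then have "y \<in> U" using r by (auto simp: dist_norm norm_minus_commute subset_iff)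
      then show "norm (f y - f x - blinfun_apply (f' x) (y - x)) \<le> e * norm (y - x)"
        using d(2)[of y] y x D0 f' by auto
    qed (use d r in auto)
  qed
  moreover have "continuous_on U f'"
    unfolding continuous_on_iff
  proof (intro ballI allI impI)
    fix x :: 'a and e :: real assume x: "x \<in> U" and e: "e > 0"
    obtain d where d: "d > 0" "\<And>y v. y \<in> U \<Longrightarrow> norm (y - x) < d \<Longrightarrow> norm v \<le> 1 \<Longrightarrow>
        norm (D 1 y [v] - D 1 x [v] - D 2 x [y - x, v]) \<le> 1 * norm (y - x)"
    proof -
      obtain d where "d > 0" and *: "\<forall>y\<in>U. norm (y - x) < d \<longrightarrow>
         (\<forall>vs. length vs = 1 \<and> (\<forall>v\<in>set vs. norm v \<le> 1) \<longrightarrow>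
            norm (D 1 y vs - D 1 x vs - D (Suc 1) x ((y - x) # vs)) \<le> 1 * norm (y - x))"
        using der[OF x, of 1 1] by auto
      show ?thesis
      proof (rule that[OF \<open>d > 0\<close>])
        fix y v assume "y \<in> U" "norm (y - x) < d" "norm (v::'a) \<le> 1"
        then show "norm (D 1 y [v] - D 1 x [v] - D 2 x [y - x, v]) \<le> 1 * norm (y - x)"
          using *[rule_format, of y "[v]"] by (simp add: numeral_2_eq_2)
      qed
    qed
    obtain C where C: "\<And>vs. length vs = 2 \<Longrightarrow> norm (D 2 x vs) \<le> C * prod_list (map norm vs)"
      using ml[OF x, of 2] unfolding bounded_multilinear_def by blast
    define B where "B = 1 + \<bar>C\<bar>"
    have B: "B > 0" by (simp add: B_def)
    have bnd: "norm (f' y - f' x) \<le> B * norm (y - x)" if y: "y \<in> U" "norm (y - x) < d" for y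
    proof (rule norm_blinfun_bound)
      show "0 \<le> B * norm (y - x)" using B by simp
      fix v :: 'a
      show "norm (blinfun_apply (f' y - f' x) v) \<le> B * norm (y - x) * norm v"
      \<comment> \<open>The clause speaks only of vectors of norm at most 1, hence the passage to
        the unit vector \<open>u\<close>.\<close>
      proof (cases "v = 0")
        case False
        define u where "u = v /\<^sub>R norm v"
        have u: "norm u = 1" "v = norm v *\<^sub>R u" using False by (auto simp: u_def)
        have "norm (D 2 x [y - x, u]) \<le> C * norm (y - x)"
          using C[of "[y - x, u]"] u by simp
        also have "\<dots> \<le> \<bar>C\<bar> * norm (y - x)" by (intro mult_right_mono) auto
        finally have "norm (D 1 y [u] - D 1 x [u]) \<le> B * norm (y - x)"
          using d(2)[OF y, of u] u norm_triangle_ineq2[of "D 1 y [u] - D 1 x [u]" "D 2 x [y - x, u]"]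
          unfolding B_def by (simp add: algebra_simps)
        then have "norm (blinfun_apply (f' y - f' x) u) \<le> B * norm (y - x)"
          using f' x y by (simp add: blinfun.diff_left)
        moreover have "norm (blinfun_apply (f' y - f' x) v) =
            norm v * norm (blinfun_apply (f' y - f' x) u)"
          by (subst u(2)) (simp add: blinfun.scaleR_right)
        ultimately show ?thesis by (simp add: mult.commute mult_left_mono)
      qed auto
    qed
    show "\<exists>d>0. \<forall>y\<in>U. dist y x < d \<longrightarrow> dist (f' y) (f' x) < e"
    proof (intro exI[of _ "min d (e / B)"] conjI ballI impI)
      fix y assume "y \<in> U" "dist y x < min d (e / B)"
      then have "norm (f' y - f' x) \<le> B * norm (y - x)" "B * norm (y - x) < e"
        using bnd B by (auto simp: dist_norm field_simps)
      then show "dist (f' y) (f' x) < e" by (simp add: dist_norm)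
    qed (use d e B in auto)
  qed
  ultimately show ?thesis using that U by blast
qed

lemma smooth_on_imp_continuous_on:
  assumes "smooth_on U f" shows "continuous_on U f"
  using smooth_onE[OF assms] by (metis continuous_at_imp_continuous_on has_derivative_continuous)

section \<open>The limiting sum rule in Hilbert space\<close>

text \<open>Closed bounded sets of a Hilbert space need not be compact, so minima may not be
  attained. Almost minimizers replace them in the variational principle and in the near-projection
  onto a subspace.\<close>

lemma approx_minimizer:
  fixes f :: "'b \<Rightarrow> real"
  assumes "S \<noteq> {}" "\<And>x. x \<in> S \<Longrightarrow> m \<le> f x" "\<epsilon> > 0"
  obtains x where "x \<in> S" "\<And>y. y \<in> S \<Longrightarrow> f x \<le> f y + \<epsilon>"
proof -
  have bdd: "bdd_below (f ` S)" using assms(2) by (auto simp: bdd_below_def)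
  have "Inf (f ` S) < Inf (f ` S) + \<epsilon>" using assms by simp
  then obtain x where x: "x \<in> S" "f x < Inf (f ` S) + \<epsilon>"
    using cInf_less_iff[of "f ` S"] assms(1) bdd by (auto simp del: less_add_same_cancel1)
  have "f x \<le> f y + \<epsilon>" if "y \<in> S" for y
    using cInf_lower[OF _ bdd, of "f y"] that x by auto
  with x that show ?thesis by blast
qed

text \<open>The Borwein--Preiss principle.  Each step penalizes the distance to an almost minimizer; in a
  Hilbert space the resulting series of quadratic penalties is affine up to second order at the
  minimizer.\<close>

lemma smooth_variational_principle:
  fixes g :: "'b::{real_inner, banach} \<Rightarrow> real"
  assumes X: "closed X" "X \<noteq> {}" and R: "\<And>x. x \<in> X \<Longrightarrow> norm x \<le> R"
    and g: "continuous_on X g" and m: "\<And>x. x \<in> X \<Longrightarrow> m \<le> g x" and \<delta>: "\<delta> > 0"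
  obtains z w where "z \<in> X" "norm w \<le> \<delta>"
    "\<And>x. x \<in> X \<Longrightarrow> g z \<le> g x + w \<bullet> (x - z) + \<delta> * (norm (x - z))\<^sup>2"
proof -
  have R0: "R \<ge> 0" using X(2) R norm_ge_zero order_trans by blast
  \<comment> \<open>The total weight of the penalties. Points of \<open>X\<close> lie within 2R of
    each other, so the gradients of the penalties sum to at most 4 R \<mu> \<le> \<delta>, and their
    curvatures to \<mu> \<le> \<delta>.\<close>
  define \<mu> where "\<mu> = \<delta> / (1 + 4 * R)"
  have \<mu>: "\<mu> > 0" "\<mu> \<le> \<delta>" "4 * R * \<mu> \<le> \<delta>" using R0 \<delta> by (auto simp: \<mu>_def field_simps)
  define a where "a n = \<mu> * (1/2) ^ Suc n" for n
  have a: "a n > 0" for n using \<mu> by (simp add: a_def)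
  have asum: "a sums \<mu>"
    using sums_mult[OF power_half_series, of \<mu>] by (simp add: a_def[abs_def])
  \<comment> \<open>Chosen so that each \<open>y\<close> in \<open>S (Suc n)\<close> satisfies
    \<open>a n * (norm (y - xs n))\<^sup>2 \<le> \<epsilon> n\<close> and hence lies within 2^-n of
    \<open>xs n\<close>.\<close>
  define \<epsilon> where "\<epsilon> n = a n * ((1/2) ^ n)\<^sup>2" for n
  have \<epsilon>: "\<epsilon> n > 0" for n using a by (simp add: \<epsilon>_def)
  \<comment> \<open>A state consists of the penalized function \<open>G\<close>, the set
    \<open>S\<close> of surviving points and an almost minimizer \<open>x\<close> of
    \<open>G\<close> on \<open>S\<close>. The relation \<open>Q\<close> adds the next penalty and
    keeps the points whose new value is at most \<open>G x\<close>.\<close>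
  define P where "P n s \<longleftrightarrow> (case s of (G, S, x) \<Rightarrow> (n = 0 \<longrightarrow> G = g \<and> S = X) \<and>
      closed S \<and> S \<subseteq> X \<and> continuous_on X G \<and> (\<forall>y\<in>X. m \<le> G y) \<and> x \<in> S \<and>
      (\<forall>y\<in>S. G x \<le> G y + \<epsilon> n))" for n :: nat and s :: "('b \<Rightarrow> real) \<times> 'b set \<times> 'b"
  define Q where "Q n s t \<longleftrightarrow> (case s of (G, S, x) \<Rightarrow> case t of (G', S', x') \<Rightarrow>
      G' = (\<lambda>y. G y + a n * (norm (y - x))\<^sup>2) \<and> S' = {y\<in>S. G' y \<le> G x})"
    for n :: nat and s t :: "('b \<Rightarrow> real) \<times> 'b set \<times> 'b"
  have "\<exists>s. P 0 s"
  proof -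
    obtain x where "x \<in> X" "\<And>y. y \<in> X \<Longrightarrow> g x \<le> g y + \<epsilon> 0"
      using approx_minimizer[OF X(2) m \<epsilon>[of 0]] by metis
    then show ?thesis using X g m by (intro exI[of _ "(g, X, x)"]) (auto simp: P_def)
  qed
  moreover have "\<exists>t. P (Suc n) t \<and> Q n s t" if s: "P n s" for n s
  proof -
    obtain G S x where sGSx: "s = (G, S, x)" by (cases s)
    define G' where "G' = (\<lambda>y. G y + a n * (norm (y - x))\<^sup>2)"
    define S' where "S' = {y\<in>S. G' y \<le> G x}"
    have H: "closed S" "S \<subseteq> X" "continuous_on X G" "\<forall>y\<in>X. m \<le> G y" "x \<in> S"
      using s sGSx by (auto simp: P_def)
    have cG: "continuous_on X G'" unfolding G'_def by (intro continuous_intros H)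
    then have "closed S'" unfolding S'_def
      by (intro continuous_on_closed_Collect_le continuous_on_subset[OF _ H(2)] continuous_intros H)
    moreover have "x \<in> S'" using H by (simp add: S'_def G'_def)
    moreover have mG: "\<forall>y\<in>X. m \<le> G' y" using H a[of n] unfolding G'_def
      by (auto intro: add_increasing2)
    moreover obtain x' where "x' \<in> S'" "\<And>y. y \<in> S' \<Longrightarrow> G' x' \<le> G' y + \<epsilon> (Suc n)"
    proof (rule approx_minimizer[of S' m G', OF _ _ \<epsilon>[of "Suc n"]])
      show "S' \<noteq> {}" using \<open>x \<in> S'\<close> by blast
      show "m \<le> G' y" if "y \<in> S'" for y using that mG H(2) by (auto simp: S'_def)
    qed blast
    ultimately show ?thesis
      using H cG by (intro exI[of _ "(G', S', x')"]) (auto simp: P_def Q_def sGSx G'_def S'_def)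
  qed
  ultimately obtain F where F: "\<And>n. P n (F n)" "\<And>n. Q n (F n) (F (Suc n))"
    using dependent_nat_choice[of P Q] by blast
  define G S xs where "G n = fst (F n)" and "S n = fst (snd (F n))" and "xs n = snd (snd (F n))" for n
  have F_eq: "F n = (G n, S n, xs n)" for n by (simp add: G_def S_def xs_def)
  have S0: "G 0 = g" "S 0 = X" using F(1)[of 0] F_eq by (auto simp: P_def)
  have S: "closed (S n)" "S n \<subseteq> X" "xs n \<in> S n" "\<And>y. y \<in> S n \<Longrightarrow> G n (xs n) \<le> G n y + \<epsilon> n" for n
    using F(1)[of n] by (auto simp: P_def F_eq)
  have GS: "G (Suc n) y = G n y + a n * (norm (y - xs n))\<^sup>2" for n y
    using F(2)[of n] by (simp add: Q_def F_eq)
  have SS: "S (Suc n) = {y\<in>S n. G (Suc n) y \<le> G n (xs n)}" for n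
    using F(2)[of n] by (simp add: Q_def F_eq)
  have G_sum: "G n y = g y + (\<Sum>i<n. a i * (norm (y - xs i))\<^sup>2)" for n y
    by (induction n) (auto simp: S0 GS)
  have G_mono: "G k y \<le> G n y" if "k \<le> n" for k n y
    using that by (induction rule: dec_induct) (auto simp: GS a less_imp_le intro: add_increasing2)
  have S_anti: "S n \<subseteq> S k" if "k \<le> n" for k n
    using that by (induction rule: dec_induct) (auto simp: SS)
  have dist_S: "norm (y - xs n) \<le> (1/2) ^ n" if "y \<in> S (Suc n)" for y n
  proof -
    have "a n * (norm (y - xs n))\<^sup>2 \<le> a n * ((1/2) ^ n)\<^sup>2"
      using that S(4)[of y n] by (auto simp: SS GS \<epsilon>_def)
    then have "(norm (y - xs n))\<^sup>2 \<le> ((1/2) ^ n)\<^sup>2" using a[of n] mult_le_cancel_left_pos by blast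
    then show ?thesis by (rule power2_le_imp_le) simp
  qed
  have small: "\<exists>n. \<forall>y\<in>S n. \<forall>y'\<in>S n. dist y y' < e" if "e > 0" for e
  proof -
    obtain n where n: "(1/2::real) ^ n < e / 2" using real_arch_pow_inv[of "e / 2" "1 / 2 :: real"] \<open>e > 0\<close> by auto
    have "dist y y' < e" if "y \<in> S (Suc n)" "y' \<in> S (Suc n)" for y y'
      using dist_S[OF that(1)] dist_S[OF that(2)] n dist_triangle_half_l[of y "xs n" e y']
      by (auto simp: dist_norm)
    then show ?thesis by blast
  qed
  obtain z where z: "\<And>n. z \<in> S n"
    using decreasing_closed_nest[of S] S S_anti small by blast
  have val: "G (Suc k) z \<le> G n (xs n)" if "n \<le> k" for k n
  proof -
    have "G k (xs k) \<le> G n (xs n)" using that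
    proof (induction rule: dec_induct)
      case (step i)
      then show ?case using S(3)[of "Suc i"] by (auto simp: SS)
    qed simp
    then show ?thesis using z[of "Suc k"] by (auto simp: SS)
  qed
  \<comment> \<open>A point in every \<open>S n\<close> must be \<open>z\<close>, as the diameters
    shrink. Any other point drops out at some stage \<open>n\<close>; from then on its penalized
    value exceeds \<open>G n (xs n)\<close>, which bounds the later values at
    \<open>z\<close>.\<close>
  have ev: "eventually (\<lambda>k. G k z \<le> G k x) sequentially" if x: "x \<in> X" for x
  proof (cases "\<forall>n. x \<in> S n")
    case True
    then have "x = z" using small z by (metis less_irrefl zero_less_dist_iff)
    then show ?thesis by simp
  next
    case False
    then obtain n where "x \<notin> S n" by blast
    then obtain n where "x \<in> S n" "x \<notin> S (Suc n)"
      using S0(2) x by (induction n) auto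
    then have n: "G (Suc n) x > G n (xs n)" by (auto simp: SS)
    have "G k z \<le> G k x" if "k \<ge> Suc n" for k
    proof -
      obtain k' where k': "k = Suc k'" using \<open>k \<ge> Suc n\<close> by (cases k) auto
      then show ?thesis using val[of n k'] n G_mono[OF \<open>k \<ge> Suc n\<close>, of x] \<open>k \<ge> Suc n\<close> by simp
    qed
    then show ?thesis unfolding eventually_sequentially by blast
  qed
  \<comment> \<open>The gradient at \<open>z\<close> of the i-th penalty.\<close>
  define b where "b i = (2 * a i) *\<^sub>R (z - xs i)" for i
  have nb: "norm (b i) \<le> 4 * R * a i" for i
  proof -
    have "norm (z - xs i) \<le> 2 * R"
      using norm_triangle_ineq4[of z "xs i"] R[of z] R[of "xs i"] subsetD[OF S(2) S(3)[of i]]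
        subsetD[OF S(2) z[of i]] by simp
    then show ?thesis using a[of i] by (simp add: b_def mult_left_mono mult.commute)
  qed
  have asum': "(\<lambda>i. 4 * R * a i) sums (4 * R * \<mu>)" using sums_mult[OF asum] .
  have bs: "summable b"
    using summable_comparison_test[of b "\<lambda>i. 4 * R * a i"] nb sums_summable[OF asum'] by blast
  have "norm (suminf b) \<le> 4 * R * \<mu>"
    using norm_suminf_le[OF nb sums_summable[OF asum']] sums_unique[OF asum'] by simp
  then have w: "norm (suminf b) \<le> \<delta>" using \<mu> by simp
  have "g z \<le> g x + suminf b \<bullet> (x - z) + \<delta> * (norm (x - z))\<^sup>2" if x: "x \<in> X" for x
  proof -
    \<comment> \<open>This is exact in an inner product space: each penalty changes from
      \<open>z\<close> to \<open>x\<close> by a linear term and a multiple of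
      \<open>(norm (x - z))\<^sup>2\<close>, with no remainder.\<close>
    have id: "(norm (x - xs i))\<^sup>2 = (norm (z - xs i))\<^sup>2 + (norm (x - z))\<^sup>2 + 2 * ((z - xs i) \<bullet> (x - z))" for i
      unfolding power2_norm_eq_inner by (simp add: inner_diff_left inner_diff_right inner_commute)
    have G_eq: "G k x - G k z = g x - g z + (\<Sum>i<k. b i) \<bullet> (x - z) + (\<Sum>i<k. a i) * (norm (x - z))\<^sup>2" for k
    proof -
      have "a i * (norm (x - xs i))\<^sup>2 =
          a i * (norm (z - xs i))\<^sup>2 + b i \<bullet> (x - z) + a i * (norm (x - z))\<^sup>2" for i
        unfolding id b_def inner_scaleR_left by (simp only: distrib_left mult.assoc mult.left_commute)
      then show ?thesis
        unfolding G_sum by (simp add: inner_sum_left sum.distrib sum_distrib_right)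
    qed
    have "(\<lambda>k. g x - g z + (\<Sum>i<k. b i) \<bullet> (x - z) + (\<Sum>i<k. a i) * (norm (x - z))\<^sup>2)
        \<longlonglongrightarrow> g x - g z + suminf b \<bullet> (x - z) + \<mu> * (norm (x - z))\<^sup>2"
      using asum summable_LIMSEQ[OF bs] unfolding sums_def by (intro tendsto_intros)
    moreover have "eventually (\<lambda>k. 0 \<le> g x - g z + (\<Sum>i<k. b i) \<bullet> (x - z) + (\<Sum>i<k. a i) * (norm (x - z))\<^sup>2) sequentially"
      using ev[OF x] by eventually_elim (simp add: G_eq[symmetric])
    ultimately have "0 \<le> g x - g z + suminf b \<bullet> (x - z) + \<mu> * (norm (x - z))\<^sup>2"
      using tendsto_lowerbound trivial_limit_sequentially by blast
    moreover have "\<mu> * (norm (x - z))\<^sup>2 \<le> \<delta> * (norm (x - z))\<^sup>2" using \<mu> by (intro mult_right_mono) auto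
    ultimately show ?thesis by linarith
  qed
  moreover have "z \<in> X" using z[of 0] S0 by simp
  ultimately show ?thesis using that w by blast
qed

section \<open>Weak sequential compactness of bounded sets\<close>

text \<open>The space need not be separable, so the diagonal subsequence is extracted only for
  pairings with the \<open>v k\<close> themselves. The set \<open>Y\<close> of all \<open>y\<close>
  with convergent pairings contains the \<open>v k\<close> and is a subspace. An arbitrary
  \<open>y\<close> is split into an almost nearest point \<open>z\<close> of \<open>Y\<close> and a
  rest that is almost orthogonal to \<open>Y\<close>, hence to all \<open>v k\<close>
  uniformly.\<close>

lemma bounded_imp_inner_convergent_subsequence:
  fixes v :: "nat \<Rightarrow> 'a::real_inner"
  assumes L: "\<And>n. norm (v n) \<le> L"
  obtains r :: "nat \<Rightarrow> nat" where "strict_mono r" "\<And>y. convergent (\<lambda>n. v (r n) \<bullet> y)"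
proof -
  interpret subseqs "\<lambda>k s. convergent (\<lambda>n. v (s n) \<bullet> v k)"
  proof
    fix k and s :: "nat \<Rightarrow> nat"
    have "bounded (range (\<lambda>n. v (s n) \<bullet> v k))"
    proof (rule boundedI, clarify)
      fix n show "norm (v (s n) \<bullet> v k) \<le> L * L"
        using Cauchy_Schwarz_ineq2[of "v (s n)" "v k"] L[of "s n"] L[of k]
        by (metis mult_mono norm_ge_zero order_trans real_norm_def)
    qed
    then obtain l r where "strict_mono (r :: nat \<Rightarrow> nat)" "((\<lambda>n. v (s n) \<bullet> v k) \<circ> r) \<longlonglongrightarrow> l"
      using bounded_imp_convergent_subsequence by blast
    then show "\<exists>r'. strict_mono r' \<and> convergent (\<lambda>n. v ((s \<circ> r') n) \<bullet> v k)"
      by (auto simp: convergent_def o_def)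
  qed
  define r where "r = diagseq"
  define Y where "Y = {y. convergent (\<lambda>n. v (r n) \<bullet> y)}"
  have vY: "v k \<in> Y" for k
  proof -
    have "convergent (\<lambda>n. v ((diagseq \<circ> ((+) (Suc k))) n) \<bullet> v k)"
    proof (rule diagseq_holds)
      fix r s :: "nat \<Rightarrow> nat" and k
      assume "strict_mono r" "convergent (\<lambda>n. v (s n) \<bullet> v k)"
      then show "convergent (\<lambda>n. v ((s \<circ> r) n) \<bullet> v k)"
        using convergent_subseq_convergent[of "\<lambda>n. v (s n) \<bullet> v k" r] by (simp add: o_def)
    qed
    then have "convergent (\<lambda>n. v (r (n + Suc k)) \<bullet> v k)" by (simp add: r_def add.commute)
    then show ?thesis
      unfolding Y_def using convergent_ignore_initial_segment[of "\<lambda>n. v (r n) \<bullet> v k" "Suc k"] by simp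
  qed
  have Ysub: "y + t *\<^sub>R h \<in> Y" if "y \<in> Y" "h \<in> Y" for y h t
    using that unfolding Y_def
    by (simp add: inner_add_right convergent_add convergent_mult convergent_const)
  have L0: "L \<ge> 0" using L[of 0] norm_ge_zero order_trans by blast
  have "convergent (\<lambda>n. v (r n) \<bullet> y)" for y
  proof (rule Cauchy_convergent, rule metric_CauchyI)
    fix e :: real assume e: "e > 0"
    \<comment> \<open>The rest pairs with each \<open>v k\<close> to at most
      \<open>\<eta> * L\<close>, so it changes differences of two pairings by less than
      \<open>e / 2\<close>. The denominator has \<open>L + 1\<close> because \<open>L\<close> may be
      0.\<close>
    define \<eta> where "\<eta> = e / (4 * (L + 1))"
    have \<eta>: "\<eta> > 0" "2 * (\<eta> * L) < e / 2" using e L0 by (auto simp: \<eta>_def field_simps)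
    obtain z where z: "z \<in> Y" "\<And>x. x \<in> Y \<Longrightarrow> (norm (y - z))\<^sup>2 \<le> (norm (y - x))\<^sup>2 + \<eta>\<^sup>2"
      using approx_minimizer[of Y 0 "\<lambda>x. (norm (y - x))\<^sup>2" "\<eta>\<^sup>2"] vY[of 0] \<eta> by auto
    have near: "(y - z) \<bullet> h \<le> \<eta> * norm h" if h: "h \<in> Y" for h
    proof (cases "h = 0")
      case False
      \<comment> \<open>A step of length \<eta> along \<open>h\<close> stays in \<open>Y\<close> and
        so cannot lower the squared distance to \<open>y\<close> by more than the slack
        \<open>\<eta>\<^sup>2\<close>.\<close>
      define t where "t = \<eta> / norm h"
      have t: "t > 0" "t * norm h = \<eta>" using \<eta> False by (auto simp: t_def)
      have eq: "(norm (y - (z + t *\<^sub>R h)))\<^sup>2 = (norm (y - z))\<^sup>2 - 2 * t * ((y - z) \<bullet> h) + (t * norm h)\<^sup>2"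
        unfolding power_mult_distrib power2_norm_eq_inner
        by (simp add: algebra_simps power2_eq_square inner_commute inner_diff_left inner_diff_right inner_add_left inner_add_right)
      have "(norm (y - z))\<^sup>2 \<le> (norm (y - z))\<^sup>2 - 2 * t * ((y - z) \<bullet> h) + \<eta>\<^sup>2 + \<eta>\<^sup>2"
        using z(2)[OF Ysub[OF z(1) h, of t]] unfolding eq t(2) .
      then have "t * ((y - z) \<bullet> h) \<le> \<eta> * \<eta>" by (simp add: power2_eq_square)
      then have "t * ((y - z) \<bullet> h) \<le> t * (\<eta> * norm h)"
        by (metis mult.assoc mult.commute t(2))
      then show ?thesis using t by simp
    qed simp
    have "Cauchy (\<lambda>n. v (r n) \<bullet> z)" using z(1) unfolding Y_def by (simp add: convergent_Cauchy)
    then obtain N where N: "\<And>m n. m \<ge> N \<Longrightarrow> n \<ge> N \<Longrightarrow> dist (v (r m) \<bullet> z) (v (r n) \<bullet> z) < e / 2"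
      using e by (meson half_gt_zero metric_CauchyD)
    have d: "\<bar>(y - z) \<bullet> v k\<bar> \<le> \<eta> * L" for k
    proof -
      have "- v k \<in> Y" using Ysub[OF vY vY, of k "-2" k] by (simp add: scaleR_2)
      then show ?thesis using near[OF vY[of k]] near[of "- v k"] L[of k] \<eta>
        by (smt (verit) inner_minus_right mult_left_mono norm_minus_cancel)
    qed
    have "dist (v (r m) \<bullet> y) (v (r n) \<bullet> y) < e" if "m \<ge> N" "n \<ge> N" for m n
    proof -
      have s: "v (r k) \<bullet> y = v (r k) \<bullet> z + (y - z) \<bullet> v (r k)" for k
        by (simp add: inner_diff_left inner_commute)
      show ?thesis unfolding s using N[OF that] d[of "r m"] d[of "r n"] \<eta>
        unfolding dist_real_def by linarith
    qed
    then show "\<exists>N. \<forall>m\<ge>N. \<forall>n\<ge>N. dist (v (r m) \<bullet> y) (v (r n) \<bullet> y) < e" by blast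
  qed
  with that subseq_diagseq show ?thesis unfolding r_def by blast
qed

text \<open>Decoupling: \<open>F x - \<phi> x + k |x - y|\<^sup>2 + (2 \<epsilon> / s) |y|\<^sup>2\<close> is minimized over \<open>y \<in> C\<close>.  The last term
  beats the error \<open>\<epsilon> |y|\<close> near the boundary of the ball of radius \<open>s\<close>, so that almost minimizers
  are interior.\<close>

lemma fuzzy_sum_rule_indicator:
  fixes F :: "'a::{real_inner, banach} \<Rightarrow> real"
  assumes \<phi>: "bounded_linear \<phi>" and \<rho>: "\<rho> > 0" and L: "L-lipschitz_on (cball 0 \<rho>) F"
    and C: "closed (C \<inter> cball 0 \<rho>)" "0 \<in> C"
    and fr: "\<And>\<epsilon>. \<epsilon> > 0 \<Longrightarrow> \<exists>r>0. \<forall>y\<in>C. norm y < r \<longrightarrow> F 0 + \<phi> y - \<epsilon> * norm y \<le> F y"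
    and \<eta>: "\<eta> > 0"
  obtains x y v w K r where "norm x < \<eta>" "norm y < \<eta>" "y \<in> C" "norm w < \<eta>" "r > 0"
    "\<And>u. norm (u - x) < r \<Longrightarrow> F x + (\<phi> (u - x) - v \<bullet> (u - x)) - K * (norm (u - x))\<^sup>2 \<le> F u"
    "\<And>u. u \<in> C \<Longrightarrow> norm (u - y) < r \<Longrightarrow> (v + w) \<bullet> (u - y) \<le> K * (norm (u - y))\<^sup>2"
proof -
  interpret \<phi>: bounded_linear \<phi> by fact
  obtain B where B: "B \<ge> 0" "\<And>h. \<bar>\<phi> h\<bar> \<le> B * norm h"
    using \<phi>.nonneg_bounded by (auto simp: mult.commute)
  \<comment> \<open>Of the bound \<eta> on the final perturbation \<open>w'\<close>, the components
    \<open>w1\<close> and \<open>w2\<close> take at most one eighth each, and the gradient of the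
    quadratic term in \<open>y\<close> takes less than \<open>4 * \<epsilon>\<close>, one
    half.\<close>
  define \<epsilon> where "\<epsilon> = \<eta> / 8"
  have \<epsilon>: "\<epsilon> > 0" using \<eta> by (simp add: \<epsilon>_def)
  obtain r0 where r0: "r0 > 0" "\<And>y. y \<in> C \<Longrightarrow> norm y < r0 \<Longrightarrow> F 0 + \<phi> y - \<epsilon> * norm y \<le> F y"
    using fr[OF \<epsilon>] by blast
  define s where "s = min \<rho> (min \<eta> r0) / 2"
  have s: "s > 0" "s < \<rho>" "s < \<eta>" "s < r0" using \<rho> \<eta> r0 by (auto simp: s_def min_def)
  have L0: "L \<ge> 0" using L by (rule lipschitz_on_nonneg)
  \<comment> \<open>\<open>L + B\<close> is a Lipschitz constant of \<open>F - \<phi>\<close>; the 1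
    makes it positive.\<close>
  define L' where "L' = L + B + 1"
  have L': "L' > 0" using L0 B by (simp add: L'_def)
  \<comment> \<open>The budget for each of two errors when the minimal value is compared with the
    value \<open>F 0\<close> at the origin; together they amount to
    \<open>\<epsilon> * s / 4\<close>.\<close>
  define \<tau> where "\<tau> = \<epsilon> * s / 8"
  have \<tau>: "\<tau> > 0" using \<epsilon> s by (simp add: \<tau>_def)
  \<comment> \<open>The first summand lets half of \<open>k * t\<^sup>2\<close> together with \<tau>
    absorb \<open>L' * t\<close>. The second excludes \<open>t \<ge> s / 4\<close>, which would
    force \<open>k * s \<le> 40 * \<epsilon>\<close>.\<close>
  define k where "k = L'\<^sup>2 / (2 * \<tau>) + 41 * \<epsilon> / s"
  have k: "k > 0" using \<epsilon> s \<tau> by (simp add: k_def add_nonneg_pos)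
  have kL: "L'\<^sup>2 \<le> 2 * \<tau> * k" using \<epsilon> s \<tau> by (simp add: k_def field_simps)
  have ks: "41 * \<epsilon> \<le> k * s" using \<epsilon> s \<tau> by (simp add: k_def field_simps)
  define g where "g z = F (fst z) - \<phi> (fst z) + k * (norm (fst z - snd z))\<^sup>2 + (2 * \<epsilon> / s) * (norm (snd z))\<^sup>2"
    for z :: "'a \<times> 'a"
  define X where "X = cball (0::'a) s \<times> ((C \<inter> cball 0 \<rho>) \<inter> cball 0 s)"
  \<comment> \<open>Elements of \<open>X\<close> have norm at most \<open>2 * s\<close>, so the
    perturbation costs at most \<tau> when \<open>z\<close> is compared with 0.\<close>
  define \<delta> where "\<delta> = min (\<eta> / 8) (\<tau> / (2 * s + (2 * s)\<^sup>2))"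
  have \<delta>: "\<delta> > 0" "\<delta> \<le> \<eta> / 8" "\<delta> * (2 * s + (2 * s)\<^sup>2) \<le> \<tau>"
  proof -
    have p: "2 * s + (2 * s)\<^sup>2 > 0" using s by (intro add_pos_nonneg) auto
    show "\<delta> > 0" using p \<tau> \<eta> by (simp add: \<delta>_def)
    show "\<delta> \<le> \<eta> / 8" unfolding \<delta>_def by (rule min.cobounded1)
    have "\<delta> \<le> \<tau> / (2 * s + (2 * s)\<^sup>2)" by (simp add: \<delta>_def)
    then show "\<delta> * (2 * s + (2 * s)\<^sup>2) \<le> \<tau>" using p by (simp add: pos_le_divide_eq)
  qed
  have FL: "\<bar>F x - F y\<bar> \<le> L * norm (x - y)" if "norm x \<le> \<rho>" "norm y \<le> \<rho>" for x y
    using lipschitz_onD[OF L, of x y] that by (simp add: dist_norm)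
  have FL': "F y - \<phi> y - L' * norm (x - y) \<le> F x - \<phi> x" if "norm x \<le> \<rho>" "norm y \<le> \<rho>" for x y
    using FL[OF that] B(2)[of "x - y"] norm_ge_zero[of "x - y"] unfolding L'_def \<phi>.diff distrib_right by linarith
  have "closed X" unfolding X_def by (intro closed_Times closed_Int C closed_cball)
  moreover have X0: "0 \<in> X" using C s \<rho> by (simp add: X_def zero_prod_def)
  moreover have XR: "norm z \<le> 2 * s" if "z \<in> X" for z
    using that norm_Pair_le[of "fst z" "snd z"] by (auto simp: X_def)
  moreover have "continuous_on X g"
  proof -
    have "continuous_on (fst ` X) F"
      by (rule continuous_on_subset[OF lipschitz_on_continuous_on[OF L]]) (use s in \<open>auto simp: X_def\<close>)
    then have "continuous_on X (\<lambda>z. F (fst z))"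
      by (rule continuous_on_compose2) (auto intro: continuous_intros)
    moreover have "continuous_on X (\<lambda>z. \<phi> (fst z))"
      by (intro \<phi>.continuous_on continuous_intros)
    ultimately show ?thesis unfolding g_def by (intro continuous_intros)
  qed
  moreover have "F 0 - L' * s \<le> g z" if "z \<in> X" for z
  proof -
    have "norm (fst z) \<le> s" using that by (auto simp: X_def)
    then have "F 0 - L' * norm (fst z) \<le> F (fst z) - \<phi> (fst z)" "L' * norm (fst z) \<le> L' * s"
      using FL'[of "fst z" 0] s L' by auto
    moreover have "0 \<le> k * (norm (fst z - snd z))\<^sup>2" "0 \<le> (2 * \<epsilon> / s) * (norm (snd z))\<^sup>2"
      using k \<epsilon> s by auto
    ultimately show ?thesis unfolding g_def by linarith
  qed
  ultimately obtain z w where z: "z \<in> X" and w: "norm w \<le> \<delta>"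
    and min: "\<And>u. u \<in> X \<Longrightarrow> g z \<le> g u + w \<bullet> (u - z) + \<delta> * (norm (u - z))\<^sup>2"
    using smooth_variational_principle[of X "2 * s" g "F 0 - L' * s" \<delta>] \<delta>(1) by blast
  obtain x y where zxy: "z = (x, y)" by (cases z)
  obtain w1 w2 where ww: "w = (w1, w2)" by (cases w)
  have w12: "norm w1 \<le> \<delta>" "norm w2 \<le> \<delta>"
    using norm_fst_le[of w1 w2] norm_snd_le[of w2 w1] w ww by auto
  have xy: "norm x \<le> s" "y \<in> C" "norm y \<le> s" using z by (auto simp: X_def zxy)
  define t where "t = norm (x - y)"
  have t0: "t \<ge> 0" by (simp add: t_def)
  have "g z \<le> F 0 + \<tau>"
  proof -
    have "w \<bullet> (0 - z) \<le> \<delta> * (2 * s)"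
      using Cauchy_Schwarz_ineq2[of w "0 - z"] mult_mono[OF w XR[OF z]] \<delta> by auto
    moreover have "\<delta> * (norm (0 - z))\<^sup>2 \<le> \<delta> * (2 * s)\<^sup>2"
      using XR[OF z] \<delta> by (intro mult_left_mono power_mono) auto
    moreover have "g 0 = F 0" by (simp add: g_def \<phi>.zero)
    ultimately show ?thesis using min[OF X0] \<delta>(3) by (simp add: algebra_simps)
  qed
  moreover have "F y - \<phi> y - L' * t \<le> F x - \<phi> x"
    using FL'[of x y] xy s by (simp add: t_def)
  moreover have "F 0 + \<phi> y - \<epsilon> * norm y \<le> F y" using r0(2)[of y] xy s by simp
  moreover have "g z = F x - \<phi> x + k * t\<^sup>2 + (2 * \<epsilon> / s) * (norm y)\<^sup>2" by (simp add: g_def zxy t_def)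
  ultimately have "(2 * \<epsilon> / s) * (norm y)\<^sup>2 - \<epsilon> * norm y + k * t\<^sup>2 \<le> \<tau> + L' * t" by linarith
  moreover have "L' * t \<le> k * t\<^sup>2 / 2 + \<tau>"
  proof -
    have "0 \<le> (k * t - L')\<^sup>2" by simp
    then have "2 * k * (L' * t) \<le> (k * t)\<^sup>2 + L'\<^sup>2" by (simp add: power2_diff algebra_simps)
    also have "\<dots> \<le> (k * t)\<^sup>2 + 2 * \<tau> * k" using kL by simp
    also have "\<dots> = 2 * k * (k * t\<^sup>2 / 2 + \<tau>)" by (simp add: algebra_simps power2_eq_square)
    finally show ?thesis using k by simp
  qed
  ultimately have main: "(2 * \<epsilon> / s) * (norm y)\<^sup>2 - \<epsilon> * norm y + k * t\<^sup>2 / 2 \<le> \<epsilon> * s / 4"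
    by (simp add: \<tau>_def)
  \<comment> \<open>For \<open>norm y \<ge> 3 / 4 * s\<close> the terms in \<open>norm y\<close> are
    at least \<open>3 * \<epsilon> * s / 8\<close>, more than the allowed
    \<open>\<epsilon> * s / 4\<close>.\<close>
  have y34: "norm y < 3 / 4 * s"
  proof (rule ccontr)
    assume "\<not> norm y < 3 / 4 * s"
    then have "(3 / 4 * s) * (s / 2) \<le> norm y * (2 * norm y - s)" using s by (intro mult_mono) auto
    then have "\<epsilon> / s * ((3 / 4 * s) * (s / 2)) \<le> \<epsilon> / s * (norm y * (2 * norm y - s))"
      using \<epsilon> s by (intro mult_left_mono) auto
    also have "\<dots> = (2 * \<epsilon> / s) * (norm y)\<^sup>2 - \<epsilon> * norm y" using s by (simp add: field_simps power2_eq_square)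
    also have "\<dots> \<le> \<epsilon> * s / 4" using main k zero_le_power2[of t] by (smt (verit) divide_nonneg_pos mult_nonneg_nonneg)
    finally show False using \<epsilon> s by (simp add: field_simps)
  qed
  have t4: "t < s / 4"
  proof (rule ccontr)
    assume "\<not> t < s / 4"
    then have "(s / 4)\<^sup>2 \<le> t\<^sup>2" using s by (intro power_mono) auto
    then have "k * (s / 4)\<^sup>2 / 2 \<le> k * t\<^sup>2 / 2" using k by simp
    moreover have "0 \<le> (2 * \<epsilon> / s) * (norm y)\<^sup>2" using \<epsilon> s by simp
    moreover have "\<epsilon> * norm y \<le> \<epsilon> * s" using \<epsilon> xy by simp
    ultimately have "k * (s / 4)\<^sup>2 / 2 \<le> \<epsilon> * s / 4 + \<epsilon> * s" using main by linarith
    then have "s * (k * s) \<le> s * (40 * \<epsilon>)" by (simp add: power2_eq_square field_simps)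
    then show False using ks s \<epsilon> by simp
  qed
  have xs: "norm x < s" using norm_triangle_ineq[of "x - y" y] y34 t4 by (simp add: t_def)
  have ys: "norm y < s" using y34 s by simp
  define r where "r = min (s - norm x) (s - norm y)"
  \<comment> \<open>The coupling term has opposite partial gradients in its two variables. So the
    same \<open>v\<close> is subtracted from \<phi> at \<open>x\<close> and, up to the small
    \<open>w'\<close>, is normal to \<open>C\<close> at \<open>y\<close>.\<close>
  define v where "v = (2 * k) *\<^sub>R (x - y) + w1"
  define w' where "w' = - w1 - (4 * \<epsilon> / s) *\<^sub>R y - w2"
  define K where "K = k + 2 * \<epsilon> / s + \<delta>"
  have K: "k + \<delta> \<le> K" using \<epsilon> s by (simp add: K_def)
  show ?thesis
  proof (rule that)
    show "norm x < \<eta>" "norm y < \<eta>" "y \<in> C" using xs ys s xy by auto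
    show "r > 0" using xs ys by (simp add: r_def)
    have "norm ((4 * \<epsilon> / s) *\<^sub>R y) = 4 * \<epsilon> * (norm y / s)" using \<epsilon> s by simp
    also have "\<dots> < 4 * \<epsilon> * 1" using \<epsilon> s ys by (intro mult_strict_left_mono) auto
    finally have "norm ((4 * \<epsilon> / s) *\<^sub>R y) < 4 * \<epsilon>" by simp
    then show "norm w' < \<eta>"
      using w12 \<delta>(2) norm_triangle_ineq4[of "- w1 - (4 * \<epsilon> / s) *\<^sub>R y" w2]
        norm_triangle_ineq4[of "- w1" "(4 * \<epsilon> / s) *\<^sub>R y"] \<epsilon>_def \<eta>
      unfolding w'_def norm_minus_cancel by linarith
  next
    fix u assume u: "norm (u - x) < r"
    then have "norm u \<le> s" using norm_triangle_ineq[of "u - x" x] by (simp add: r_def)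
    then have "(u, y) \<in> X" using xy s by (simp add: X_def)
    from min[OF this] have "F x - \<phi> x + k * (norm (x - y))\<^sup>2
        \<le> F u - \<phi> u + k * (norm (u - y))\<^sup>2 + w1 \<bullet> (u - x) + \<delta> * (norm (u - x))\<^sup>2"
      by (simp add: g_def zxy ww norm_Pair)
    moreover have "(norm (u - y))\<^sup>2 = (norm (x - y))\<^sup>2 + (norm (u - x))\<^sup>2 + 2 * ((x - y) \<bullet> (u - x))"
      unfolding power2_norm_eq_inner by (simp add: inner_diff_left inner_diff_right inner_commute)
    ultimately have "F x + (\<phi> (u - x) - v \<bullet> (u - x)) - (k + \<delta>) * (norm (u - x))\<^sup>2 \<le> F u"
      by (simp add: v_def \<phi>.diff inner_add_left algebra_simps)
    moreover have "(k + \<delta>) * (norm (u - x))\<^sup>2 \<le> K * (norm (u - x))\<^sup>2"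
      using K by (intro mult_right_mono) auto
    ultimately show "F x + (\<phi> (u - x) - v \<bullet> (u - x)) - K * (norm (u - x))\<^sup>2 \<le> F u" by linarith
  next
    fix u assume u: "u \<in> C" "norm (u - y) < r"
    then have "norm u \<le> s" using norm_triangle_ineq[of "u - y" y] by (simp add: r_def)
    then have "(x, u) \<in> X" using xy s u by (simp add: X_def)
    from min[OF this] have "k * (norm (x - y))\<^sup>2 + (2 * \<epsilon> / s) * (norm y)\<^sup>2
        \<le> k * (norm (x - u))\<^sup>2 + (2 * \<epsilon> / s) * (norm u)\<^sup>2 + w2 \<bullet> (u - y) + \<delta> * (norm (u - y))\<^sup>2"
      by (simp add: g_def zxy ww norm_Pair)
    moreover have "(norm (x - u))\<^sup>2 = (norm (x - y))\<^sup>2 + (norm (u - y))\<^sup>2 - 2 * ((x - y) \<bullet> (u - y))"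
      unfolding power2_norm_eq_inner by (simp add: inner_diff_left inner_diff_right inner_commute)
    moreover have "(norm u)\<^sup>2 = (norm y)\<^sup>2 + (norm (u - y))\<^sup>2 + 2 * (y \<bullet> (u - y))"
      unfolding power2_norm_eq_inner by (simp add: inner_diff_left inner_diff_right inner_commute)
    ultimately have "2 * k * ((x - y) \<bullet> (u - y)) - 2 * (2 * \<epsilon> / s) * (y \<bullet> (u - y)) - w2 \<bullet> (u - y)
        \<le> K * (norm (u - y))\<^sup>2"
      unfolding K_def by (simp only: distrib_left distrib_right right_diff_distrib)
    then show "(v + w') \<bullet> (u - y) \<le> K * (norm (u - y))\<^sup>2"
      by (simp add: v_def w'_def inner_add_left inner_diff_left inner_minus_left)
  qed
qed

text \<open>Fuzzy decompositions are taken with \<eta> tending to 0. A uniform bound makes the limit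
  possible: \<phi> minus the functional of \<open>v\<close> is a subgradient of a function with
  Lipschitz constant \<open>L\<close>, and \<open>B\<close> bounds \<phi>, so
  \<open>norm v \<le> L + B\<close>. A weakly convergent subsequence of the \<open>v\<close> gives
  \<psi>, and the normals \<open>v + w\<close> share its limit because \<open>w\<close> tends to
  0.\<close>

lemma limiting_sum_rule_indicator:
  fixes F :: "'a::{real_inner, banach} \<Rightarrow> real"
  assumes \<phi>: "bounded_linear \<phi>" and \<rho>: "\<rho> > 0" and L: "L-lipschitz_on (cball 0 \<rho>) F"
    and C: "closed (C \<inter> cball 0 \<rho>)" "0 \<in> C"
    and fr: "\<And>\<epsilon>. \<epsilon> > 0 \<Longrightarrow> \<exists>r>0. \<forall>y\<in>C. norm y < r \<longrightarrow> F 0 + \<phi> y - \<epsilon> * norm y \<le> F y"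
  obtains \<psi> xs ys vs ws where "bounded_linear \<psi>" "xs \<longlonglongrightarrow> 0" "ys \<longlonglongrightarrow> 0"
    "\<And>h. (\<lambda>n. vs n \<bullet> h) \<longlonglongrightarrow> \<psi> h" "\<And>h. (\<lambda>n. ws n \<bullet> h) \<longlonglongrightarrow> \<psi> h"
    "\<And>n. norm (xs n) < \<rho>" "\<And>n. ys n \<in> C" "\<And>n. norm (ys n) < \<rho>"
    "\<And>n. \<exists>r>0. \<exists>K. \<forall>u. norm (u - xs n) < r \<longrightarrow>
       F (xs n) + (\<phi> (u - xs n) - vs n \<bullet> (u - xs n)) - K * (norm (u - xs n))\<^sup>2 \<le> F u"
    "\<And>n. \<exists>r>0. \<exists>K. \<forall>u\<in>C. norm (u - ys n) < r \<longrightarrow> ws n \<bullet> (u - ys n) \<le> K * (norm (u - ys n))\<^sup>2"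
proof -
  interpret \<phi>: bounded_linear \<phi> by fact
  define \<eta> where "\<eta> n = min \<rho> (1 / real (Suc n))" for n
  have \<eta>: "\<eta> n > 0" for n using \<rho> by (simp add: \<eta>_def)
  have \<eta>_lim: "\<eta> \<longlonglongrightarrow> 0"
    using tendsto_min[OF tendsto_const LIMSEQ_Suc[OF lim_1_over_n], of \<rho>] \<rho>
    by (simp add: \<eta>_def[abs_def] min_def)
  define P where "P n x y v w \<longleftrightarrow> norm x < \<eta> n \<and> norm y < \<eta> n \<and> y \<in> C \<and> norm w < \<eta> n \<and>
     (\<exists>r>0. \<exists>K. \<forall>u. norm (u - x) < r \<longrightarrow>
       F x + (\<phi> (u - x) - v \<bullet> (u - x)) - K * (norm (u - x))\<^sup>2 \<le> F u) \<and>
     (\<exists>r>0. \<exists>K. \<forall>u\<in>C. norm (u - y) < r \<longrightarrow> (v + w) \<bullet> (u - y) \<le> K * (norm (u - y))\<^sup>2)" for n x y v w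
  have "\<exists>x y v w. P n x y v w" for n
    unfolding P_def by (rule fuzzy_sum_rule_indicator[OF \<phi> \<rho> L C fr \<eta>[of n]]) blast+
  then obtain x y v w where P: "\<And>n. P n (x n) (y n) (v n) (w n)" by metis
  obtain B where B: "B \<ge> 0" "\<And>h. \<bar>\<phi> h\<bar> \<le> B * norm h"
    using \<phi>.nonneg_bounded by (auto simp: mult.commute)
  have vb: "norm (v n) \<le> L + B" for n
  proof -
    define V where "V = v n"
    obtain r K where r: "r > 0" and rK: "\<And>u. norm (u - x n) < r \<Longrightarrow>
       F (x n) + (\<phi> (u - x n) - V \<bullet> (u - x n)) - K * (norm (u - x n))\<^sup>2 \<le> F u"
      using P[of n] unfolding P_def V_def by blast
    have xn: "norm (x n) < \<rho>" using P[of n] by (simp add: P_def \<eta>_def)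
    \<comment> \<open>For \<open>t < r'\<close> the point \<open>x n - t *\<^sub>R V\<close> is
      within reach of the subgradient inequality and in the ball of radius \<rho>; the summand 1
      covers \<open>V = 0\<close>.\<close>
    define r' where "r' = min r (\<rho> - norm (x n)) / (1 + norm V)"
    have pos: "1 + norm V > 0" by (simp add: add_pos_nonneg)
    have r': "r' > 0" using r xn pos by (simp add: r'_def)
    have "(norm V)\<^sup>2 - B * norm V - L * norm V \<le> \<bar>K\<bar> * t * (norm V)\<^sup>2" if t: "t \<in> {0<..<r'}" for t
    proof -
      have "t * (1 + norm V) < min r (\<rho> - norm (x n))"
        using t pos by (simp add: r'_def pos_less_divide_eq)
      then have tv: "t * norm V < r" "norm (x n) + t * norm V < \<rho>" using t by (auto simp: algebra_simps)
      \<comment> \<open>Moving against \<open>V\<close> turns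
        \<open>- (V \<bullet> (u - x n))\<close> into \<open>t * (norm V)\<^sup>2\<close>, while
        \<open>F\<close> rises by at most \<open>L * t * norm V\<close>. Dividing by
        \<open>t\<close> and letting \<open>t\<close> tend to 0 gives the bound on
        \<open>norm V\<close>.\<close>
      define u where "u = x n - t *\<^sub>R V"
      have u: "u - x n = - (t *\<^sub>R V)" by (simp add: u_def)
      have nu: "norm (u - x n) = t * norm V" using t by (simp add: u)
      have "norm u \<le> \<rho>" using norm_triangle_ineq[of "u - x n" "x n"] nu tv by simp
      then have "\<bar>F u - F (x n)\<bar> \<le> L * (t * norm V)"
        using lipschitz_onD[OF L, of u "x n"] xn nu by (simp add: dist_norm)
      then have "\<phi> (u - x n) - V \<bullet> (u - x n) - K * (norm (u - x n))\<^sup>2 \<le> L * (t * norm V)"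
        using rK[of u] nu tv by linarith
      moreover have "V \<bullet> (u - x n) = - (t * (norm V)\<^sup>2)" by (simp add: u power2_norm_eq_inner)
      moreover have "- (B * (t * norm V)) \<le> \<phi> (u - x n)" using B(2)[of "u - x n"] nu by auto
      moreover have "K * (norm (u - x n))\<^sup>2 \<le> \<bar>K\<bar> * (t * norm V)\<^sup>2"
        unfolding nu by (intro mult_right_mono) auto
      ultimately have "t * (norm V)\<^sup>2 - B * (t * norm V) - L * (t * norm V) \<le> \<bar>K\<bar> * (t * norm V)\<^sup>2" by linarith
      then have "t * ((norm V)\<^sup>2 - B * norm V - L * norm V) \<le> t * (\<bar>K\<bar> * t * (norm V)\<^sup>2)"
        by (simp add: algebra_simps power2_eq_square)
      then show ?thesis using t by simp
    qed
    then have "eventually (\<lambda>t. (norm V)\<^sup>2 - B * norm V - L * norm V \<le> \<bar>K\<bar> * t * (norm V)\<^sup>2) (at_right 0)"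
      using r' by (auto simp: eventually_at_right_field)
    moreover have "((\<lambda>t. \<bar>K\<bar> * t * (norm V)\<^sup>2) \<longlongrightarrow> \<bar>K\<bar> * 0 * (norm V)\<^sup>2) (at_right 0)"
      by (intro tendsto_intros)
    ultimately have "(norm V)\<^sup>2 - B * norm V - L * norm V \<le> 0"
      using tendsto_lowerbound[of _ _ "at_right (0::real)"] by fastforce
    then have "norm V * norm V \<le> norm V * (L + B)" by (simp add: algebra_simps power2_eq_square)
    then show ?thesis
      using B lipschitz_on_nonneg[OF L] unfolding V_def[symmetric]
      by (cases "V = 0") auto
  qed
  then obtain q :: "nat \<Rightarrow> nat" where q: "strict_mono q" and conv: "\<And>h. convergent (\<lambda>n. v (q n) \<bullet> h)"
    using bounded_imp_inner_convergent_subsequence by blast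
  define \<psi> where "\<psi> h = lim (\<lambda>n. v (q n) \<bullet> h)" for h
  have lim: "(\<lambda>n. v (q n) \<bullet> h) \<longlonglongrightarrow> \<psi> h" for h
    using conv unfolding \<psi>_def by (simp add: convergent_LIMSEQ_iff)
  have \<eta>q: "(\<lambda>n. \<eta> (q n)) \<longlonglongrightarrow> 0" using LIMSEQ_subseq_LIMSEQ[OF \<eta>_lim q] by (simp add: o_def)
  show ?thesis
  proof (rule that[of \<psi> "x \<circ> q" "y \<circ> q" "v \<circ> q" "\<lambda>n. v (q n) + w (q n)"])
    show "bounded_linear \<psi>"
    proof (rule bounded_linear_intro)
      fix a b :: 'a and t :: real
      show "\<psi> (a + b) = \<psi> a + \<psi> b"
        using LIMSEQ_unique[OF lim[of "a + b"]] tendsto_add[OF lim[of a] lim[of b]] by (simp add: inner_add_right)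
      show "\<psi> (t *\<^sub>R a) = t *\<^sub>R \<psi> a"
        using LIMSEQ_unique[OF lim[of "t *\<^sub>R a"]] tendsto_mult_left[OF lim[of a], of t] by simp
      have "\<bar>v (q n) \<bullet> a\<bar> \<le> (L + B) * norm a" for n
        using Cauchy_Schwarz_ineq2[of "v (q n)" a] vb[of "q n"]
        by (meson mult_right_mono norm_ge_zero order_trans)
      then show "norm (\<psi> a) \<le> norm a * (L + B)"
        using tendsto_upperbound[OF tendsto_rabs[OF lim[of a]], of "(L + B) * norm a"]
        by (simp add: mult.commute)
    qed
    show "(x \<circ> q) \<longlonglongrightarrow> 0" "(y \<circ> q) \<longlonglongrightarrow> 0"
      by (rule tendsto_norm_zero_cancel, rule tendsto_sandwich[OF _ _ tendsto_const \<eta>q];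
          use P in \<open>auto simp: P_def less_imp_le\<close>)+
    show "(\<lambda>n. (v \<circ> q) n \<bullet> h) \<longlonglongrightarrow> \<psi> h" for h using lim by simp
    have "(\<lambda>n. w (q n)) \<longlonglongrightarrow> 0"
      by (rule tendsto_norm_zero_cancel, rule tendsto_sandwich[OF _ _ tendsto_const \<eta>q];
          use P in \<open>auto simp: P_def less_imp_le\<close>)
    then have "(\<lambda>n. w (q n) \<bullet> h) \<longlonglongrightarrow> 0" for h
      using tendsto_inner[OF _ tendsto_const, of "\<lambda>n. w (q n)" 0 sequentially h] by simp
    from tendsto_add[OF lim this] show "(\<lambda>n. (v (q n) + w (q n)) \<bullet> h) \<longlonglongrightarrow> \<psi> h" for h
      by (simp add: inner_add_left)
  qed (use P in \<open>auto simp: P_def \<eta>_def\<close>)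
qed

section \<open>Tangent spaces and the metric in charts\<close>

context riemannian_manifold
begin

lemma charts_cover: obtains c where "c \<in> charts_at A p"
  using smooth_atlas unfolding smooth_atlas_def charts_at_def by blast

lemma charts_atD: "c \<in> charts_at A p \<Longrightarrow> c \<in> A" "c \<in> charts_at A p \<Longrightarrow> p \<in> fst c"
  by (simp_all add: charts_at_def)

lemma
  assumes "c \<in> A"
  shows open_chart_dom: "open (fst c)"
    and open_chart_image: "open (snd c ` fst c)"
    and homeomorphism_chart: "homeomorphism (fst c) (snd c ` fst c) (snd c) (chart_inv c)"
    and smooth_on_transition: "c' \<in> A \<Longrightarrow> smooth_on (snd c ` (fst c \<inter> fst c')) (transition c c')"
  using smooth_atlas assms unfolding smooth_atlas_def by blast+

lemma continuous_on_chart: "c \<in> A \<Longrightarrow> continuous_on (fst c) (snd c)"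
  and continuous_on_chart_inv: "c \<in> A \<Longrightarrow> continuous_on (snd c ` fst c) (chart_inv c)"
  and chart_inv_chart: "c \<in> A \<Longrightarrow> q \<in> fst c \<Longrightarrow> chart_inv c (snd c q) = q"
  and chart_chart_inv: "x \<in> snd c ` fst c \<Longrightarrow> snd c (chart_inv c x) = x"
  and chart_inv_in: "x \<in> snd c ` fst c \<Longrightarrow> chart_inv c x \<in> fst c"
  using homeomorphism_chart[of c] by (auto simp: homeomorphism_def f_inv_into_f inv_into_into)

lemma transition_chart:
  "c \<in> A \<Longrightarrow> q \<in> fst c \<Longrightarrow> transition c c' (snd c q) = snd c' q"
  by (simp add: transition_def chart_inv_chart)

lemma open_chart_overlap: "c \<in> A \<Longrightarrow> c' \<in> A \<Longrightarrow> open (snd c ` (fst c \<inter> fst c'))"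
  using smooth_on_transition unfolding smooth_on_def by blast

lemma transition_has_derivative:
  assumes "c \<in> charts_at A p" "c' \<in> charts_at A p"
  shows "(transition c c' has_derivative frechet_derivative (transition c c') (at (snd c p)))
    (at (snd c p))"
proof -
  have "snd c p \<in> snd c ` (fst c \<inter> fst c')" using assms charts_atD by blast
  then have "transition c c' differentiable at (snd c p)"
    using smooth_onE[OF smooth_on_transition] charts_atD assms differentiableI by metis
  then show ?thesis by (simp add: frechet_derivative_works)
qed

lemma bounded_linear_transition_derivative:
  "c \<in> charts_at A p \<Longrightarrow> c' \<in> charts_at A p \<Longrightarrow>
    bounded_linear (frechet_derivative (transition c c') (at (snd c p)))"
  using transition_has_derivative has_derivative_bounded_linear by blast

text \<open>The chain rule for a composite of transition maps. This cocycle identity is what makes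
  the family \<open>tangent_vec A c p a\<close> compatible in all pairs of charts.\<close>

lemma transition_derivative_compose:
  assumes "c \<in> charts_at A p" "c' \<in> charts_at A p" "c'' \<in> charts_at A p"
  shows "frechet_derivative (transition c' c'') (at (snd c' p))
      (frechet_derivative (transition c c') (at (snd c p)) a) =
    frechet_derivative (transition c c'') (at (snd c p)) a"
proof -
  let ?D = "\<lambda>c c'. frechet_derivative (transition c c') (at (snd c p))"
  have cA: "c \<in> A" "c' \<in> A" "p \<in> fst c" "p \<in> fst c'" using assms charts_atD by auto
  have "(transition c' c'' has_derivative ?D c' c'') (at (transition c c' (snd c p)))"
    using transition_has_derivative[OF assms(2,3)] cA by (simp add: transition_chart)
  from diff_chain_at[OF transition_has_derivative[OF assms(1,2)] this]
  have "(transition c' c'' \<circ> transition c c' has_derivative ?D c' c'' \<circ> ?D c c') (at (snd c p))" .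
  moreover have "open (snd c ` (fst c \<inter> fst c'))" "snd c p \<in> snd c ` (fst c \<inter> fst c')"
    using open_chart_overlap cA by auto
  moreover have "(transition c' c'' \<circ> transition c c') x = transition c c'' x"
    if "x \<in> snd c ` (fst c \<inter> fst c')" for x
    using that cA by (auto simp: transition_chart)
  ultimately have "(transition c c'' has_derivative ?D c' c'' \<circ> ?D c c') (at (snd c p))"
    by (rule has_derivative_transform_within_open)
  from has_derivative_unique[OF this transition_has_derivative[OF assms(1,3)]]
  show ?thesis by (auto simp: fun_eq_iff)
qed

lemma transition_derivative_self:
  assumes "c \<in> charts_at A p"
  shows "frechet_derivative (transition c c) (at (snd c p)) a = a"
proof -
  have cA: "c \<in> A" "p \<in> fst c" using assms charts_atD by auto
  have "((\<lambda>x. x) has_derivative frechet_derivative (transition c c) (at (snd c p))) (at (snd c p))"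
    by (rule has_derivative_transform_within_open[OF transition_has_derivative[OF assms assms]
          open_chart_image[OF cA(1)]]) (use cA in \<open>auto simp: transition_chart\<close>)
  from has_derivative_unique[OF this has_derivative_ident] show ?thesis by (simp add: fun_eq_iff)
qed

lemma tangent_vec_in: "c \<in> charts_at A p \<Longrightarrow> tangent_vec A c p a \<in> tangent_space A p"
  unfolding tangent_space_def tangent_vec_def by (auto simp: transition_derivative_compose)

lemma tangent_vec_apply: "c \<in> charts_at A p \<Longrightarrow> tangent_vec A c p a c = a"
  by (simp add: tangent_vec_def transition_derivative_self)

text \<open>Together with \<open>tangent_vec_in\<close> and \<open>tangent_vec_apply\<close> this
  makes \<open>tangent_vec A c p\<close> a bijection from the model space onto the tangent space,
  along which the linear structure is transported.\<close>

lemma tangent_vec_coord: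
  assumes "c \<in> charts_at A p" "v \<in> tangent_space A p"
  shows "tangent_vec A c p (v c) = v"
proof
  fix c'
  have "v c' = frechet_derivative (transition c c') (at (snd c p)) (v c)" if "c' \<in> charts_at A p"
    using assms that unfolding tangent_space_def by blast
  moreover have "v c' = 0" if "c' \<notin> charts_at A p"
    using assms that unfolding tangent_space_def by blast
  ultimately show "tangent_vec A c p (v c) c' = v c'"
    unfolding tangent_vec_def by presburger
qed

lemma
  assumes c: "c \<in> charts_at A p"
  shows tangent_vec_add: "tangent_vec A c p (a + b) = tangent_vec A c p a + tangent_vec A c p b"
    and tangent_vec_scaleR: "tangent_vec A c p (t *\<^sub>R a) = t *\<^sub>R tangent_vec A c p a"
    and tangent_vec_diff: "tangent_vec A c p (a - b) = tangent_vec A c p a - tangent_vec A c p b"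
    and tangent_vec_zero: "tangent_vec A c p 0 = 0"
proof -
  have D: "bounded_linear (frechet_derivative (transition c c') (at (snd c p)))"
    if "c' \<in> charts_at A p" for c'
    using bounded_linear_transition_derivative[OF c that] .
  show "tangent_vec A c p (a + b) = tangent_vec A c p a + tangent_vec A c p b"
    by (rule ext) (simp add: tangent_vec_def linear_simps(1)[OF D])
  show "tangent_vec A c p (t *\<^sub>R a) = t *\<^sub>R tangent_vec A c p a"
    by (rule ext) (simp add: tangent_vec_def linear_simps(5)[OF D] scaleR_fun_def)
  show "tangent_vec A c p (a - b) = tangent_vec A c p a - tangent_vec A c p b"
    by (rule ext) (simp add: tangent_vec_def linear_simps(2)[OF D])
  show "tangent_vec A c p 0 = 0"
    by (rule ext) (simp add: tangent_vec_def linear_simps(3)[OF D])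
qed

lemma
  assumes "u \<in> tangent_space A p" "v \<in> tangent_space A p"
  shows tangent_space_add: "u + v \<in> tangent_space A p"
    and tangent_space_scaleR: "t *\<^sub>R u \<in> tangent_space A p"
    and tangent_space_diff: "u - v \<in> tangent_space A p"
proof -
  obtain c where c: "c \<in> charts_at A p" by (rule charts_cover)
  note T = tangent_vec_in[OF c]
  show "u + v \<in> tangent_space A p"
    using T[of "u c + v c"] unfolding tangent_vec_add[OF c] assms[THEN tangent_vec_coord[OF c]] .
  show "t *\<^sub>R u \<in> tangent_space A p"
    using T[of "t *\<^sub>R u c"] unfolding tangent_vec_scaleR[OF c] assms[THEN tangent_vec_coord[OF c]] .
  show "u - v \<in> tangent_space A p"
    using T[of "u c - v c"] unfolding tangent_vec_diff[OF c] assms[THEN tangent_vec_coord[OF c]] .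
qed

lemma
  assumes "u \<in> tangent_space A p" "v \<in> tangent_space A p" "w \<in> tangent_space A p"
  shows metric_sym: "g p u v = g p v u"
    and metric_add: "g p (u + v) w = g p u w + g p v w"
    and metric_scaleR: "g p (t *\<^sub>R u) v = t * g p u v"
    and metric_pos: "u \<noteq> 0 \<Longrightarrow> 0 < g p u u"
proof -
  have "\<forall>u\<in>tangent_space A p. \<forall>v\<in>tangent_space A p. \<forall>w\<in>tangent_space A p. \<forall>r.
       g p u v = g p v u \<and> g p (u + v) w = g p u w + g p v w \<and> g p (r *\<^sub>R u) v = r * g p u v \<and>
       (u \<noteq> 0 \<longrightarrow> 0 < g p u u)"
    using riemannian_metric unfolding riemannian_metric_def by (elim conjE) (erule spec)
  note * = this[rule_format, OF assms]
  show "g p u v = g p v u" "g p (u + v) w = g p u w + g p v w" "g p (t *\<^sub>R u) v = t * g p u v"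
    "u \<noteq> 0 \<Longrightarrow> 0 < g p u u"
    using * by simp_all
qed

lemma tnorm_equivalent:
  assumes "c \<in> charts_at A p"
  obtains m M where "m > 0" "M > 0"
    "\<And>v. v \<in> tangent_space A p \<Longrightarrow> m * norm (v c) \<le> tnorm g p v"
    "\<And>v. v \<in> tangent_space A p \<Longrightarrow> tnorm g p v \<le> M * norm (v c)"
proof -
  have "\<forall>p. \<forall>c\<in>charts_at A p. \<exists>m>0. \<exists>M>0. \<forall>v\<in>tangent_space A p.
       m * norm (v c) \<le> tnorm g p v \<and> tnorm g p v \<le> M * norm (v c)"
    using riemannian_metric unfolding riemannian_metric_def by (elim conjE)
  from this[rule_format, OF assms] show ?thesis using that by blast
qed

lemma metric_zero_left: "u \<in> tangent_space A p \<Longrightarrow> g p 0 u = 0"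
  using metric_scaleR[of u p u u 0] unfolding scaleR_zero_left mult_zero_left .

lemma metric_nonneg:
  assumes u: "u \<in> tangent_space A p"
  shows "0 \<le> g p u u"
proof (cases "u = 0")
  case True
  then show ?thesis using metric_zero_left[OF u] by (metis order_refl)
next
  case False
  then show ?thesis using metric_pos[OF u u u] by linarith
qed

text \<open>\<open>g p\<close> is an inner product on a subset of a function space and not on a
  type, so the inequality is derived from nonnegativity of \<open>g p\<close> at
  \<open>u + t *\<^sub>R v\<close>, with the \<open>t\<close> that minimizes this quadratic
  polynomial.\<close>

lemma metric_Cauchy_Schwarz:
  assumes u: "u \<in> tangent_space A p" and v: "v \<in> tangent_space A p"
  shows "\<bar>g p u v\<bar> \<le> tnorm g p u * tnorm g p v"
proof (cases "v = 0")
  case True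
  have "g p u v = 0" unfolding metric_sym[OF u v v] unfolding True by (rule metric_zero_left[OF u])
  then show ?thesis using metric_nonneg[OF u] metric_nonneg[OF v] by (simp add: tnorm_def)
next
  case False
  define b t where "b = g p v v" and "t = - (g p u v / g p v v)"
  have b: "b > 0" using metric_pos[OF v v v False] by (simp add: b_def)
  have tv: "t *\<^sub>R v \<in> tangent_space A p" using tangent_space_scaleR v by blast
  have s: "u + t *\<^sub>R v \<in> tangent_space A p" using tangent_space_add[OF u tv] .
  have tu: "g p (t *\<^sub>R v) u = t * g p u v"
    using metric_scaleR[OF v u u, of t] metric_sym[OF u v v] by simp
  have tt: "g p (t *\<^sub>R v) (t *\<^sub>R v) = t * (t * b)"
    unfolding metric_scaleR[OF v tv tv] metric_sym[OF v tv tv] metric_scaleR[OF v v v] b_def ..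
  have "0 \<le> g p (u + t *\<^sub>R v) (u + t *\<^sub>R v)" by (rule metric_nonneg[OF s])
  also have "\<dots> = g p u (u + t *\<^sub>R v) + g p (t *\<^sub>R v) (u + t *\<^sub>R v)"
    by (rule metric_add[OF u tv s])
  also have "\<dots> = (g p u u + t * g p u v) + (t * g p u v + t * (t * b))"
    unfolding metric_sym[OF u s s] metric_add[OF u tv u] metric_sym[OF tv s s] metric_add[OF u tv tv]
      metric_sym[OF u tv tv] tu tt ..
  also have "\<dots> = g p u u - (g p u v)\<^sup>2 / b"
    using b by (simp add: t_def b_def[symmetric] field_simps power2_eq_square)
  finally have "(g p u v)\<^sup>2 \<le> g p u u * b" using b by (simp add: field_simps)
  then have "sqrt ((g p u v)\<^sup>2) \<le> sqrt (g p u u * b)" by (rule real_sqrt_le_mono)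
  then show ?thesis by (simp add: tnorm_def b_def real_sqrt_mult)
qed

text \<open>\<open>metric_coord\<close> consists of two nested \<open>Blinfun\<close>, which return
  the intended map only for bounded linear arguments. Both levels are bounded by Cauchy-Schwarz and
  the upper half of the norm equivalence.\<close>

lemma metric_coord_apply:
  assumes "c \<in> charts_at A p"
  shows "metric_coord A g c (snd c p) a b = g p (tangent_vec A c p a) (tangent_vec A c p b)"
proof -
  let ?T = "tangent_vec A c p"
  note T = tangent_vec_in[OF assms]
  have cp: "chart_inv c (snd c p) = p" using charts_atD[OF assms] by (rule chart_inv_chart)
  obtain m M where M: "m > 0" "M > 0" "\<And>v. v \<in> tangent_space A p \<Longrightarrow> m * norm (v c) \<le> tnorm g p v"
    "\<And>v. v \<in> tangent_space A p \<Longrightarrow> tnorm g p v \<le> M * norm (v c)"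
    using tnorm_equivalent[OF assms] by blast
  have nT: "tnorm g p (?T a) \<le> M * norm a" for a
    using M(4)[OF T, of a] by (simp add: tangent_vec_apply[OF assms])
  have n0: "0 \<le> tnorm g p (?T a)" for a using metric_nonneg[OF T] by (simp add: tnorm_def)
  have bnd: "\<bar>g p (?T a) (?T b)\<bar> \<le> (M * M * norm a) * norm b" for a b
    using order_trans[OF metric_Cauchy_Schwarz[OF T T] mult_mono[OF nT nT]] n0 M
    by (simp add: algebra_simps)
  have bl: "bounded_linear (\<lambda>b. g p (?T a) (?T b))" for a
  proof (rule bounded_linear_intro[of _ "M * M * norm a"])
    fix x y :: 'a and r :: real
    show "g p (?T a) (?T (x + y)) = g p (?T a) (?T x) + g p (?T a) (?T y)"
      using metric_sym[OF T T T, of a "x + y"] metric_add[OF T T T, of x y a] metric_sym[OF T T T, of a x]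
        metric_sym[OF T T T, of a y] by (simp add: tangent_vec_add[OF assms])
    show "g p (?T a) (?T (r *\<^sub>R x)) = r *\<^sub>R g p (?T a) (?T x)"
      using metric_sym[OF T T T, of a "r *\<^sub>R x"] metric_scaleR[OF T T T, of r x a] metric_sym[OF T T T, of a x]
      by (simp add: tangent_vec_scaleR[OF assms])
    show "norm (g p (?T a) (?T x)) \<le> norm x * (M * M * norm a)"
      using bnd[of a x] by (simp add: algebra_simps)
  qed
  have 1: "blinfun_apply (Blinfun (\<lambda>b. g p (?T a) (?T b))) b = g p (?T a) (?T b)" for a b
    using bounded_linear_Blinfun_apply[OF bl] by simp
  have "bounded_linear (\<lambda>a. Blinfun (\<lambda>b. g p (?T a) (?T b)))"
  proof (rule bounded_linear_intro[of _ "M * M"])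
    fix x y :: 'a and r :: real
    show "Blinfun (\<lambda>b. g p (?T (x + y)) (?T b)) =
        Blinfun (\<lambda>b. g p (?T x) (?T b)) + Blinfun (\<lambda>b. g p (?T y) (?T b))"
      by (rule blinfun_eqI, unfold blinfun.add_left 1)
        (simp add: tangent_vec_add[OF assms] metric_add[OF T T T])
    show "Blinfun (\<lambda>b. g p (?T (r *\<^sub>R x)) (?T b)) = r *\<^sub>R Blinfun (\<lambda>b. g p (?T x) (?T b))"
      by (rule blinfun_eqI, unfold blinfun.scaleR_left 1)
        (simp add: tangent_vec_scaleR[OF assms] metric_scaleR[OF T T T])
    show "norm (Blinfun (\<lambda>b. g p (?T x) (?T b))) \<le> norm x * (M * M)"
      by (rule norm_blinfun_bound) (use M bnd[of x] in \<open>auto simp: 1 mult_ac\<close>)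
  qed
  from bounded_linear_Blinfun_apply[OF this] show ?thesis
    by (simp add: metric_coord_def cp Let_def 1)
qed

lemma tnorm_coord:
  assumes "c \<in> charts_at A p" "v \<in> tangent_space A p"
  shows "tnorm g p v = sqrt (metric_coord A g c (snd c p) (v c) (v c))"
  using assms by (simp add: metric_coord_apply tangent_vec_coord tnorm_def)

lemma metric_coord_nonneg:
  assumes "c \<in> charts_at A p"
  shows "0 \<le> metric_coord A g c (snd c p) a a"
  using assms by (simp add: metric_coord_apply metric_nonneg tangent_vec_in)

lemma continuous_on_metric_coord:
  assumes "c \<in> A"
  shows "continuous_on (snd c ` fst c) (metric_coord A g c)"
proof (rule smooth_on_imp_continuous_on)
  have "\<forall>c\<in>A. smooth_on (snd c ` fst c) (metric_coord A g c)"
    using riemannian_metric unfolding riemannian_metric_def by (elim conjE)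
  then show "smooth_on (snd c ` fst c) (metric_coord A g c)" using assms by (rule bspec)
qed

abbreviation speed :: "(real \<Rightarrow> 'm) \<Rightarrow> real \<Rightarrow> real"
  where "speed \<gamma> t \<equiv> tnorm g (\<gamma> t) (velocity A {0..1} \<gamma> t)"

section \<open>Velocities in charts\<close>

lemma curve_near_in_chart:
  assumes cont: "continuous_on {0..1} \<gamma>" and c: "c \<in> A" and x: "x \<in> {0..1::real}" "\<gamma> x \<in> fst c"
  obtains e where "e > 0" "\<And>r. r \<in> {0..1} \<Longrightarrow> dist r x < e \<Longrightarrow> \<gamma> r \<in> fst c"
proof -
  obtain T where T: "open T" "{0..1} \<inter> \<gamma> -` fst c = {0..1} \<inter> T"
    using continuous_openin_preimage_gen[OF cont open_chart_dom[OF c]] unfolding openin_open by blast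
  have "x \<in> T" using T(2) x by blast
  then obtain e where e: "e > 0" "ball x e \<subseteq> T" using T(1) openE by blast
  show ?thesis
  proof (rule that[OF e(1)])
    fix r assume "r \<in> {0..1::real}" "dist r x < e"
    then have "r \<in> {0..1} \<inter> T" using e by (auto simp: dist_commute)
    then show "\<gamma> r \<in> fst c" unfolding T(2)[symmetric] by blast
  qed
qed

text \<open>\<open>velocity\<close> differentiates in each chart separately. Near \<open>r\<close>
  the curve stays in \<open>c\<close>, so the other derivatives come from \<open>D\<close> by the
  chain rule through the transition maps, and the family is the tangent vector represented by
  \<open>D\<close>.\<close>

lemma velocity_in_chart:
  assumes c: "c \<in> A" and r: "r \<in> {0..1}" and \<gamma>: "\<gamma> r \<in> fst c" "continuous_on {0..1} \<gamma>"
    and D: "((snd c \<circ> \<gamma>) has_vector_derivative D) (at r within {0..1})"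
  shows "velocity A {0..1} \<gamma> r \<in> tangent_space A (\<gamma> r)" "velocity A {0..1} \<gamma> r c = D"
proof -
  have cr: "c \<in> charts_at A (\<gamma> r)" using c \<gamma> by (simp add: charts_at_def)
  have vd: "vector_derivative f (at r within {0..1}) = d"
    if "(f has_vector_derivative d) (at r within {0..1})" for f :: "real \<Rightarrow> 'a" and d
    using vector_derivative_within_cbox[of 0 1 r f d] r that by simp
  have v: "velocity A {0..1} \<gamma> r c' = frechet_derivative (transition c c') (at (snd c (\<gamma> r))) D"
    if c': "c' \<in> charts_at A (\<gamma> r)" for c'
  proof -
    have "((transition c c' \<circ> (snd c \<circ> \<gamma>)) has_vector_derivative
        frechet_derivative (transition c c') (at (snd c (\<gamma> r))) D) (at r within {0..1})"
      by (rule vector_derivative_diff_chain_within[OF D])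
        (simp add: has_derivative_at_withinI transition_has_derivative[OF cr c'])
    moreover obtain e where e: "e > 0" "\<And>s. s \<in> {0..1} \<Longrightarrow> dist s r < e \<Longrightarrow> \<gamma> s \<in> fst c"
      using curve_near_in_chart[OF \<gamma>(2) c r \<gamma>(1)] by blast
    moreover have "(transition c c' \<circ> (snd c \<circ> \<gamma>)) s = (snd c' \<circ> \<gamma>) s" if "s \<in> {0..1}" "dist s r < e" for s
      using e(2)[OF that] c by (simp add: transition_chart)
    ultimately have "((snd c' \<circ> \<gamma>) has_vector_derivative
        frechet_derivative (transition c c') (at (snd c (\<gamma> r))) D) (at r within {0..1})"
      using has_vector_derivative_transform_within[OF _ e(1) r] by blast
    from vd[OF this] show ?thesis using c' unfolding velocity_def by presburger
  qed
  have "velocity A {0..1} \<gamma> r = tangent_vec A c (\<gamma> r) D"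
  proof
    fix c'
    show "velocity A {0..1} \<gamma> r c' = tangent_vec A c (\<gamma> r) D c'"
    proof (cases "c' \<in> charts_at A (\<gamma> r)")
      case True
      then show ?thesis unfolding v[OF True] tangent_vec_def by presburger
    next
      case False
      then show ?thesis unfolding velocity_def tangent_vec_def by presburger
    qed
  qed
  then show "velocity A {0..1} \<gamma> r \<in> tangent_space A (\<gamma> r)" "velocity A {0..1} \<gamma> r c = D"
    using tangent_vec_in[OF cr] tangent_vec_apply[OF cr] by simp_all
qed

section \<open>Lengths of curves\<close>

text \<open>Bisection replaces an explicit subdivision: a property that passes to unions of adjacent
  intervals holds on \<open>{s..t}\<close> once it holds on all short intervals around each point.
  In the applications \<open>B\<close> is the whole atlas or a single chart. Derivatives appear on
  open intervals only, as they may be one-sided at break points.\<close>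

lemma piecewise_C1_induct:
  assumes \<gamma>: "piecewise_C1_curve A \<gamma>" and st: "0 \<le> s" "s \<le> t" "t \<le> 1"
    and B: "B \<subseteq> A" "\<And>r. r \<in> {s..t} \<Longrightarrow> \<exists>c\<in>B. \<gamma> r \<in> fst c"
    and refl: "\<And>a. P a a"
    and trans: "\<And>a b c. s \<le> a \<Longrightarrow> a \<le> b \<Longrightarrow> b \<le> c \<Longrightarrow> c \<le> t \<Longrightarrow> P a b \<Longrightarrow> P b c \<Longrightarrow> P a c"
    and piece: "\<And>c a b D. c \<in> B \<Longrightarrow> s \<le> a \<Longrightarrow> a < b \<Longrightarrow> b \<le> t \<Longrightarrow> \<gamma> ` {a..b} \<subseteq> fst c \<Longrightarrow>
      continuous_on {a..b} D \<Longrightarrow>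
      (\<forall>r\<in>{a<..<b}. ((snd c \<circ> \<gamma>) has_vector_derivative D r) (at r)) \<Longrightarrow> P a b"
  shows "P s t"
proof -
  have cont: "continuous_on {0..1} \<gamma>" using \<gamma> unfolding piecewise_C1_curve_def by blast
  obtain K where K: "finite K" and KD: "\<forall>c\<in>A. \<forall>s t.
        0 \<le> s \<and> s < t \<and> t \<le> 1 \<and> {s<..<t} \<inter> K = {} \<and> \<gamma> ` {s..t} \<subseteq> fst c \<longrightarrow>
        (\<exists>D. continuous_on {s..t} D \<and>
          (\<forall>r\<in>{s..t}. ((snd c \<circ> \<gamma>) has_vector_derivative D r) (at r within {s..t})))"
    using \<gamma> unfolding piecewise_C1_curve_def by (elim conjE exE)
  have piece': "P a b" if c: "c \<in> B" and ab: "s \<le> a" "a \<le> b" "b \<le> t" "\<gamma> ` {a..b} \<subseteq> fst c"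
    "{a<..<b} \<inter> K = {}" for c a b
  proof (cases "a = b")
    case False
    then have "a < b" using ab by simp
    obtain D where D: "continuous_on {a..b} D"
      "\<And>r. r \<in> {a..b} \<Longrightarrow> ((snd c \<circ> \<gamma>) has_vector_derivative D r) (at r within {a..b})"
    proof -
      have "0 \<le> a \<and> a < b \<and> b \<le> 1 \<and> {a<..<b} \<inter> K = {} \<and> \<gamma> ` {a..b} \<subseteq> fst c"
        using ab st \<open>a < b\<close> by simp
      from KD[rule_format, OF subsetD[OF B(1) c] this] show ?thesis using that by blast
    qed
    show ?thesis
    proof (rule piece[OF c ab(1) \<open>a < b\<close> ab(3,4) D(1)], rule ballI)
      fix r assume r: "r \<in> {a<..<b}"
      then have "at r within {a..b} = at r" by (intro at_within_interior) simp
      then show "((snd c \<circ> \<gamma>) has_vector_derivative D r) (at r)" using D(2)[of r] r by simp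
    qed
  qed (simp add: refl)
  have "s \<le> s \<and> s \<le> t \<and> t \<le> t \<longrightarrow> P s t"
  proof (rule Bolzano[where P = "\<lambda>a b. s \<le> a \<and> a \<le> b \<and> b \<le> t \<longrightarrow> P a b"])
    show "s \<le> t" by fact
    show "s \<le> a \<and> a \<le> c \<and> c \<le> t \<longrightarrow> P a c"
      if "s \<le> a \<and> a \<le> b \<and> b \<le> t \<longrightarrow> P a b" "s \<le> b \<and> b \<le> c \<and> c \<le> t \<longrightarrow> P b c" "a \<le> b" "b \<le> c" for a b c
      using that trans[of a b c] by linarith
    fix x assume x: "s \<le> x" "x \<le> t"
    then obtain c where c: "c \<in> B" "\<gamma> x \<in> fst c" using B(2)[of x] by auto
    have cA: "c \<in> A" using c B by blast
    obtain e where e: "e > 0" "\<And>r. r \<in> {0..1} \<Longrightarrow> dist r x < e \<Longrightarrow> \<gamma> r \<in> fst c"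
      using curve_near_in_chart[OF cont cA, of x] x st c by auto
    obtain d where d: "d > 0" "\<And>y. y \<in> K \<Longrightarrow> y \<noteq> x \<Longrightarrow> d \<le> dist x y"
      using finite_set_avoid[OF K] by blast
    show "\<exists>d>0. \<forall>a b. a \<le> x \<and> x \<le> b \<and> b - a < d \<longrightarrow> s \<le> a \<and> a \<le> b \<and> b \<le> t \<longrightarrow> P a b"
    proof (intro exI[of _ "min d e"] conjI allI impI)
      fix a b assume 1: "a \<le> x \<and> x \<le> b \<and> b - a < min d e" and 2: "s \<le> a \<and> a \<le> b \<and> b \<le> t"
      have sub: "\<gamma> ` {a..b} \<subseteq> fst c" using 1 2 e(2) st by (auto simp: dist_real_def)
      have noK: "y \<notin> K" if "y \<in> {a<..<b}" "y \<noteq> x" for y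
        using d(2)[of y] that 1 by (auto simp: dist_real_def)
      \<comment> \<open>\<open>x\<close> is the only possible break point between \<open>a\<close>
        and \<open>b\<close>, so splitting there leaves two pieces without break points in the
        interior.\<close>
      have "P a x" using c(1) 1 2 sub noK by (intro piece'[of c]) auto
      moreover have "P x b" using c(1) 1 2 sub noK by (intro piece'[of c]) auto
      ultimately show "P a b" using trans[of a x b] 1 2 by blast
    qed (use d e in auto)
  qed
  then show ?thesis using st by simp
qed

text \<open>The coordinate formula for the speed may fail at the two end points, which can be break
  points; a finite set does not affect integrals.\<close>

lemma speed_piece:
  assumes \<gamma>: "piecewise_C1_curve A \<gamma>" and c: "c \<in> A" and ab: "0 \<le> a" "a < b" "b \<le> 1"
    and sub: "\<gamma> ` {a..b} \<subseteq> fst c" and D: "continuous_on {a..b} D"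
    "\<forall>r\<in>{a<..<b}. ((snd c \<circ> \<gamma>) has_vector_derivative D r) (at r)"
  shows "continuous_on {a..b} (\<lambda>r. sqrt (metric_coord A g c (snd c (\<gamma> r)) (D r) (D r)))"
    and "speed \<gamma> integrable_on {a..b}"
    and "integral {a..b} (speed \<gamma>) =
      integral {a..b} (\<lambda>r. sqrt (metric_coord A g c (snd c (\<gamma> r)) (D r) (D r)))"
proof -
  define \<sigma> where "\<sigma> = (\<lambda>r. sqrt (metric_coord A g c (snd c (\<gamma> r)) (D r) (D r)))"
  have cont: "continuous_on {0..1} \<gamma>" using \<gamma> unfolding piecewise_C1_curve_def by blast
  have "continuous_on {a..b} (\<lambda>r. snd c (\<gamma> r))"
    by (rule continuous_on_compose2[OF continuous_on_chart[OF c]])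
      (use cont ab sub in \<open>auto intro: continuous_on_subset\<close>)
  then have "continuous_on {a..b} (\<lambda>r. metric_coord A g c (snd c (\<gamma> r)))"
    by (rule continuous_on_compose2[OF continuous_on_metric_coord[OF c]]) (use sub in auto)
  then show "continuous_on {a..b} (\<lambda>r. sqrt (metric_coord A g c (snd c (\<gamma> r)) (D r) (D r)))"
    by (intro continuous_on_real_sqrt blinfun.continuous_on D(1))
  then have cs: "continuous_on {a..b} \<sigma>" by (simp only: \<sigma>_def)
  have eq: "speed \<gamma> r = \<sigma> r" if "r \<in> {a..b} - {a, b}" for r
  proof -
    have r: "r \<in> {a<..<b}" "r \<in> {0..1}" "\<gamma> r \<in> fst c" using that ab sub by auto
    note v = velocity_in_chart[OF c r(2,3) cont has_vector_derivative_at_within[OF bspec[OF D(2) r(1)]]]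
    have "c \<in> charts_at A (\<gamma> r)" using c r by (simp add: charts_at_def)
    from tnorm_coord[OF this v(1)] show ?thesis unfolding v(2) \<sigma>_def .
  qed
  show "speed \<gamma> integrable_on {a..b}"
    using integrable_spike_finite[of "{a, b}" "{a..b}" "speed \<gamma>" \<sigma>] eq integrable_continuous_real[OF cs] by auto
  have "integral {a..b} (speed \<gamma>) = integral {a..b} \<sigma>"
    by (rule integral_spike[of "{a, b}"]) (use eq in auto)
  then show "integral {a..b} (speed \<gamma>) =
      integral {a..b} (\<lambda>r. sqrt (metric_coord A g c (snd c (\<gamma> r)) (D r) (D r)))"
    by (simp only: \<sigma>_def)
qed

text \<open>\<open>integral\<close> returns 0 for a function that is not integrable, so
  \<open>curve_length\<close> has its intended meaning only through this fact.\<close>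

lemma speed_integrable:
  assumes \<gamma>: "piecewise_C1_curve A \<gamma>" and st: "0 \<le> s" "s \<le> t" "t \<le> 1"
  shows "speed \<gamma> integrable_on {s..t}"
proof (rule piecewise_C1_induct[OF \<gamma> st order_refl])
  fix r show "\<exists>c\<in>A. \<gamma> r \<in> fst c" using charts_cover[of "\<gamma> r"] charts_atD by metis
next
  fix c a b D
  assume *: "c \<in> A" "s \<le> a" "a < b" "b \<le> t" "\<gamma> ` {a..b} \<subseteq> fst c" "continuous_on {a..b} D"
    "\<forall>r\<in>{a<..<b}. ((snd c \<circ> \<gamma>) has_vector_derivative D r) (at r)"
  have ab: "0 \<le> a" "b \<le> 1" using * st by auto
  show "speed \<gamma> integrable_on {a..b}"
    by (rule speed_piece(2)[OF \<gamma> *(1) ab(1) *(3) ab(2) *(5-7)])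
next
  fix a b c
  assume "s \<le> a" "a \<le> b" "b \<le> c" "c \<le> t" "speed \<gamma> integrable_on {a..b}" "speed \<gamma> integrable_on {b..c}"
  then show "speed \<gamma> integrable_on {a..c}"
    using Henstock_Kurzweil_Integration.integrable_combine by blast
qed (use integrable_on_refl[of "speed \<gamma>"] in simp)

lemma integral_speed_combine:
  assumes "piecewise_C1_curve A \<gamma>" and "0 \<le> a" "a \<le> b" "b \<le> c" "c \<le> 1"
  shows "integral {a..b} (speed \<gamma>) + integral {b..c} (speed \<gamma>) = integral {a..c} (speed \<gamma>)"
  using assms by (intro Henstock_Kurzweil_Integration.integral_combine speed_integrable) auto

text \<open>The integrand need not be nonnegative pointwise: at a break point
  \<open>velocity\<close> may fail to be a tangent vector, and \<open>tnorm\<close> is unconstrained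
  there. The sign comes from the coordinate formula on each piece.\<close>

lemma integral_speed_nonneg:
  assumes \<gamma>: "piecewise_C1_curve A \<gamma>" and st: "0 \<le> s" "s \<le> t" "t \<le> 1"
  shows "0 \<le> integral {s..t} (speed \<gamma>)"
proof (rule piecewise_C1_induct[OF \<gamma> st order_refl])
  fix r show "\<exists>c\<in>A. \<gamma> r \<in> fst c" using charts_cover[of "\<gamma> r"] charts_atD by metis
next
  fix c a b D
  assume *: "c \<in> A" "s \<le> a" "a < b" "b \<le> t" "\<gamma> ` {a..b} \<subseteq> fst c" "continuous_on {a..b} D"
    "\<forall>r\<in>{a<..<b}. ((snd c \<circ> \<gamma>) has_vector_derivative D r) (at r)"
  have ab: "0 \<le> a" "b \<le> 1" using * st by auto
  note sp = speed_piece[OF \<gamma> *(1) ab(1) *(3) ab(2) *(5-7)]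
  show "0 \<le> integral {a..b} (speed \<gamma>)"
  proof (subst sp(3), rule integral_nonneg[OF integrable_continuous_real[OF sp(1)]])
    fix r assume "r \<in> {a..b}"
    then have "c \<in> charts_at A (\<gamma> r)" using * by (auto simp: charts_at_def)
    then show "0 \<le> sqrt (metric_coord A g c (snd c (\<gamma> r)) (D r) (D r))"
      by (simp add: metric_coord_nonneg)
  qed
next
  fix a b c
  assume "s \<le> a" "a \<le> b" "b \<le> c" "c \<le> t" "0 \<le> integral {a..b} (speed \<gamma>)" "0 \<le> integral {b..c} (speed \<gamma>)"
  then show "0 \<le> integral {a..c} (speed \<gamma>)" using integral_speed_combine[OF \<gamma>, of a b c] st by linarith
qed simp

text \<open>The fundamental theorem of calculus for \<phi> of the coordinates, whose derivative is
  at most \<open>k\<close> times the speed. The generality serves two ends: crude bounds on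
  coordinate displacements, and the sharp estimate with \<open>k\<close> close to the
  modulus.\<close>

lemma linear_le_integral_speed:
  assumes \<gamma>: "piecewise_C1_curve A \<gamma>" and st: "0 \<le> s" "s \<le> t" "t \<le> 1"
    and c: "c \<in> A" "\<gamma> ` {s..t} \<subseteq> fst c" and \<phi>: "bounded_linear \<phi>"
    and le: "\<And>r a. r \<in> {s..t} \<Longrightarrow> \<phi> a \<le> k * sqrt (metric_coord A g c (snd c (\<gamma> r)) a a)"
  shows "\<phi> (snd c (\<gamma> t) - snd c (\<gamma> s)) \<le> k * integral {s..t} (speed \<gamma>)"
proof (rule piecewise_C1_induct[OF \<gamma> st])
  interpret \<phi>: bounded_linear \<phi> by fact
  have cont: "continuous_on {0..1} \<gamma>" using \<gamma> unfolding piecewise_C1_curve_def by blast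
  show "{c} \<subseteq> A" using c by simp
  show "\<exists>c\<in>{c}. \<gamma> r \<in> fst c" if "r \<in> {s..t}" for r using c that by auto
  show "\<phi> (snd c (\<gamma> a) - snd c (\<gamma> a)) \<le> k * integral {a..a} (speed \<gamma>)" for a
    by (simp add: \<phi>.zero)
  fix c' a b D
  assume *: "c' \<in> {c}" "s \<le> a" "a < b" "b \<le> t" "\<gamma> ` {a..b} \<subseteq> fst c'" "continuous_on {a..b} D"
    and "\<forall>r\<in>{a<..<b}. ((snd c' \<circ> \<gamma>) has_vector_derivative D r) (at r)"
  then have D: "\<forall>r\<in>{a<..<b}. ((snd c \<circ> \<gamma>) has_vector_derivative D r) (at r)"
    and sub: "\<gamma> ` {a..b} \<subseteq> fst c" by auto
  have ab: "0 \<le> a" "b \<le> 1" using * st by auto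
  note sp = speed_piece[OF \<gamma> c(1) ab(1) *(3) ab(2) sub *(6) D]
  have "continuous_on {a..b} (\<lambda>r. snd c (\<gamma> r))"
    by (rule continuous_on_compose2[OF continuous_on_chart[OF c(1)]])
      (use cont ab sub in \<open>auto intro: continuous_on_subset\<close>)
  then have "continuous_on {a..b} (\<lambda>r. \<phi> (snd c (\<gamma> r)))" by (rule \<phi>.continuous_on)
  moreover have "((\<lambda>r. \<phi> (snd c (\<gamma> r))) has_vector_derivative \<phi> (D r)) (at r)" if "r \<in> {a<..<b}" for r
    using \<phi>.has_vector_derivative[OF bspec[OF D that]] by (simp add: o_def)
  ultimately have "((\<lambda>r. \<phi> (D r)) has_integral \<phi> (snd c (\<gamma> b)) - \<phi> (snd c (\<gamma> a))) {a..b}"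
    using *(3) by (intro fundamental_theorem_of_calculus_interior) auto
  then have "\<phi> (snd c (\<gamma> b)) - \<phi> (snd c (\<gamma> a)) = integral {a..b} (\<lambda>r. \<phi> (D r))"
    by (simp add: integral_unique)
  also have "\<dots> \<le> integral {a..b} (\<lambda>r. k * sqrt (metric_coord A g c (snd c (\<gamma> r)) (D r) (D r)))"
    by (intro integral_le integrable_continuous_real continuous_on_mult continuous_on_const sp(1)
        \<phi>.continuous_on *(6) le) (use * in auto)
  also have "\<dots> = k * integral {a..b} (speed \<gamma>)"
    by (subst sp(3)) (rule integral_mult_right)
  finally show "\<phi> (snd c (\<gamma> b) - snd c (\<gamma> a)) \<le> k * integral {a..b} (speed \<gamma>)" by (simp add: \<phi>.diff)
next
  interpret \<phi>: bounded_linear \<phi> by fact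
  fix a b d
  assume *: "s \<le> a" "a \<le> b" "b \<le> d" "d \<le> t"
    "\<phi> (snd c (\<gamma> b) - snd c (\<gamma> a)) \<le> k * integral {a..b} (speed \<gamma>)"
    "\<phi> (snd c (\<gamma> d) - snd c (\<gamma> b)) \<le> k * integral {b..d} (speed \<gamma>)"
  have "k * integral {a..b} (speed \<gamma>) + k * integral {b..d} (speed \<gamma>) = k * integral {a..d} (speed \<gamma>)"
    using integral_speed_combine[OF \<gamma>, of a b d] * st by (simp add: distrib_left[symmetric])
  then show "\<phi> (snd c (\<gamma> d) - snd c (\<gamma> a)) \<le> k * integral {a..d} (speed \<gamma>)"
    using * by (simp add: \<phi>.diff)
qed

text \<open>The functional estimate is tested with the inner product against the displacement
  \<open>e\<close> itself.\<close>

lemma norm_le_integral_speed: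
  assumes \<gamma>: "piecewise_C1_curve A \<gamma>" and st: "0 \<le> s" "s \<le> t" "t \<le> 1"
    and c: "c \<in> A" "\<gamma> ` {s..t} \<subseteq> fst c" and m: "m > 0"
    and le: "\<And>r a. r \<in> {s..t} \<Longrightarrow> m * norm a \<le> sqrt (metric_coord A g c (snd c (\<gamma> r)) a a)"
  shows "m * norm (snd c (\<gamma> t) - snd c (\<gamma> s)) \<le> integral {s..t} (speed \<gamma>)"
proof (cases "snd c (\<gamma> t) = snd c (\<gamma> s)")
  case True
  then show ?thesis using integral_speed_nonneg[OF \<gamma> st] by simp
next
  case False
  define e where "e = snd c (\<gamma> t) - snd c (\<gamma> s)"
  have e: "norm e > 0" using False by (simp add: e_def)
  have "e \<bullet> (snd c (\<gamma> t) - snd c (\<gamma> s)) \<le> norm e / m * integral {s..t} (speed \<gamma>)"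
  proof (rule linear_le_integral_speed[OF \<gamma> st c bounded_linear_inner_right])
    fix r a assume "r \<in> {s..t}"
    from mult_left_mono[OF le[OF this, of a], of "norm e / m"]
    have "norm e * norm a \<le> norm e / m * sqrt (metric_coord A g c (snd c (\<gamma> r)) a a)" using m by simp
    then show "e \<bullet> a \<le> norm e / m * sqrt (metric_coord A g c (snd c (\<gamma> r)) a a)"
      using norm_cauchy_schwarz[of e a] by linarith
  qed
  then have "norm e * (m * norm e) \<le> norm e * integral {s..t} (speed \<gamma>)"
    using m by (simp add: e_def[symmetric] power2_norm_eq_inner[symmetric] power2_eq_square field_simps)
  then show ?thesis using e unfolding e_def by simp
qed

text \<open>Closed balls are not compact, so that a curve might a priori leave the chart while staying in a
  closed coordinate ball.  Finite length makes the coordinates converge at the exit time, and the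
  Hausdorff property then shows that there is no exit.\<close>

lemma curve_stays_in_chart_ball:
  assumes \<gamma>: "piecewise_C1_curve A \<gamma>" and c: "c \<in> A" "\<gamma> 0 \<in> fst c" and m: "m > 0"
    and R: "ball x0 R \<subseteq> snd c ` fst c"
    and le: "\<And>x a. x \<in> ball x0 R \<Longrightarrow> m * norm a \<le> sqrt (metric_coord A g c x a a)"
    and len: "norm (snd c (\<gamma> 0) - x0) + curve_length A g \<gamma> / m < R" and \<tau>: "\<tau> \<in> {0..1}"
  shows "\<gamma> \<tau> \<in> fst c" "snd c (\<gamma> \<tau>) \<in> ball x0 R"
proof -
  have cont: "continuous_on {0..1} \<gamma>" using \<gamma> unfolding piecewise_C1_curve_def by blast
  have len_I: "curve_length A g \<gamma> = integral {0..1} (speed \<gamma>)" by (simp add: curve_length_def)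
  have l0: "0 \<le> curve_length A g \<gamma>" unfolding len_I by (rule integral_speed_nonneg[OF \<gamma>]) auto
  define V where "V = fst c \<inter> snd c -` ball x0 R"
  have "open V"
    unfolding V_def
    by (rule continuous_open_preimage[OF continuous_on_chart[OF c(1)] open_chart_dom[OF c(1)] open_ball])
  have "norm (snd c (\<gamma> 0) - x0) < R" using len l0 m by (smt (verit) divide_nonneg_pos)
  then have V0: "\<gamma> 0 \<in> V" using c by (auto simp: V_def dist_norm norm_minus_commute)
  have "\<gamma> \<tau> \<in> V"
  proof (rule ccontr)
    assume out: "\<gamma> \<tau> \<notin> V"
    define N where "N = {0..1} \<inter> \<gamma> -` (- V)"
    have "closed N" unfolding N_def
      by (rule continuous_closed_preimage[OF cont]) (use \<open>open V\<close> in auto)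
    moreover have "N \<noteq> {}" "bdd_below N" using out \<tau> by (auto simp: N_def)
    ultimately have TN: "Inf N \<in> N" using closed_contains_Inf by blast
    \<comment> \<open>The exit time: \<open>N\<close> is closed, so the infimum belongs to it, and
      the curve is outside \<open>V\<close> at \<open>T\<close> but inside before.\<close>
    define T where "T = Inf N"
    have T: "T \<in> {0..1}" "\<gamma> T \<notin> V" using TN by (auto simp: N_def T_def)
    have before: "\<gamma> r \<in> V" if "0 \<le> r" "r < T" for r
    proof (rule ccontr)
      assume "\<gamma> r \<notin> V"
      then have "r \<in> N" using that T by (simp add: N_def)
      then show False using cInf_lower[OF _ \<open>bdd_below N\<close>] that unfolding T_def by fastforce
    qed
    have T0: "T > 0" using T V0 by (cases "T = 0") auto
    define x where "x r = snd c (\<gamma> r)" for r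
    define I where "I r = integral {0..r} (speed \<gamma>)" for r
    have xI: "m * norm (x r - x s) \<le> I r - I s" if "0 \<le> s" "s \<le> r" "r < T" for s r
    proof -
      have "m * norm (x r - x s) \<le> integral {s..r} (speed \<gamma>)"
        unfolding x_def
      proof (rule norm_le_integral_speed[OF \<gamma> _ _ _ c(1) _ m])
        show "\<gamma> ` {s..r} \<subseteq> fst c" using before that by (auto simp: V_def)
        show "m * norm a \<le> sqrt (metric_coord A g c (snd c (\<gamma> u)) a a)" if "u \<in> {s..r}" for u a
          using before[of u] that \<open>0 \<le> s\<close> \<open>r < T\<close> by (intro le) (auto simp: V_def)
      qed (use that T in auto)
      also have "\<dots> = I r - I s"
        unfolding I_def using integral_speed_combine[OF \<gamma>, of 0 s r] that T by simp
      finally show ?thesis .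
    qed
    \<comment> \<open>The strict inequality \<open>R' < R\<close> keeps the limit of the coordinates
      in the open ball.\<close>
    define R' where "R' = norm (x 0 - x0) + curve_length A g \<gamma> / m"
    have R': "R' < R" using len by (simp add: R'_def x_def)
    have near: "norm (x r - x0) \<le> R'" if "0 \<le> r" "r < T" for r
    proof -
      have "I r \<le> curve_length A g \<gamma>"
        unfolding I_def len_I using integral_speed_combine[OF \<gamma>, of 0 r 1]
          integral_speed_nonneg[OF \<gamma>, of r 1] that T by simp
      moreover have "I 0 = 0" by (simp add: I_def)
      ultimately have "m * norm (x r - x 0) \<le> curve_length A g \<gamma>" using xI[of 0 r] that by simp
      then have "norm (x r - x 0) \<le> curve_length A g \<gamma> / m" using m by (simp add: field_simps)
      then show ?thesis using norm_triangle_ineq[of "x r - x 0" "x 0 - x0"] by (simp add: R'_def)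
    qed
    define rs where "rs n = T - T / real (Suc n)" for n
    have rs: "0 \<le> rs n" "rs n < T" for n using T0 by (auto simp: rs_def field_simps)
    have rs01: "rs n \<in> {0..1}" for n using rs[of n] T by auto
    have rs_lim: "rs \<longlonglongrightarrow> T"
    proof -
      have "(\<lambda>n. T - T * (1 / real (Suc n))) \<longlonglongrightarrow> T - T * 0"
        by (intro tendsto_intros LIMSEQ_Suc[OF lim_1_over_n])
      then show ?thesis by (simp add: rs_def[abs_def])
    qed
    \<comment> \<open>Arc length is continuous up to \<open>T\<close>, hence Cauchy along
      \<open>rs\<close>; \<open>xI'\<close> passes this on to the coordinates, and completeness of
      the model space provides the limit \<open>y\<close>.\<close>
    have "continuous_on {0..1} I"
      unfolding I_def[abs_def] by (rule indefinite_integral_continuous_1[OF speed_integrable[OF \<gamma>]]) auto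
    then have "(\<lambda>n. I (rs n)) \<longlonglongrightarrow> I T"
      by (rule continuous_on_tendsto_compose[OF _ rs_lim]) (use T rs01 in auto)
    then have CI: "Cauchy (\<lambda>n. I (rs n))" by (rule LIMSEQ_imp_Cauchy)
    have xI': "m * norm (x (rs k) - x (rs n)) \<le> \<bar>I (rs k) - I (rs n)\<bar>" for k n
      using xI[of "rs k" "rs n"] xI[of "rs n" "rs k"] rs[of n] rs[of k]
      by (cases "rs k \<le> rs n") (auto simp: norm_minus_commute)
    have "Cauchy (\<lambda>n. x (rs n))"
    proof (rule CauchyI)
      fix e :: real assume "e > 0"
      then obtain M where M: "\<And>k n. k \<ge> M \<Longrightarrow> n \<ge> M \<Longrightarrow> norm (I (rs k) - I (rs n)) < m * e"
        using CauchyD[OF CI, of "m * e"] m by auto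
      have "norm (x (rs k) - x (rs n)) < e" if "k \<ge> M" "n \<ge> M" for k n
      proof -
        have "m * norm (x (rs k) - x (rs n)) < m * e"
          using xI'[of k n] M[OF that] unfolding real_norm_def by (rule order.strict_trans1)
        then show ?thesis using m by simp
      qed
      then show "\<exists>M. \<forall>k\<ge>M. \<forall>n\<ge>M. norm (x (rs k) - x (rs n)) < e" by blast
    qed
    then obtain y where y: "(\<lambda>n. x (rs n)) \<longlonglongrightarrow> y" using Cauchy_convergent convergent_def by blast
    have "norm (y - x0) \<le> R'"
      by (rule tendsto_upperbound[OF tendsto_norm[OF tendsto_diff[OF y tendsto_const]]])
        (use near rs in auto)
    then have yb: "y \<in> ball x0 R" using R' by (simp add: dist_norm norm_minus_commute)
    then have yc: "y \<in> snd c ` fst c" using R by blast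
    have "(\<lambda>n. chart_inv c (x (rs n))) \<longlonglongrightarrow> chart_inv c y"
      by (rule continuous_on_tendsto_compose[OF continuous_on_chart_inv[OF c(1)] y yc])
        (use before rs in \<open>auto simp: x_def V_def\<close>)
    moreover have "chart_inv c (x (rs n)) = \<gamma> (rs n)" for n
      using before[OF rs] c(1) by (simp add: x_def V_def chart_inv_chart)
    moreover have "(\<lambda>n. \<gamma> (rs n)) \<longlonglongrightarrow> \<gamma> T"
      by (rule continuous_on_tendsto_compose[OF cont rs_lim T(1)])
        (use T rs01 in auto)
    ultimately have "\<gamma> T = chart_inv c y" using LIMSEQ_unique by simp
    then have "\<gamma> T \<in> V" using yb yc by (simp add: V_def chart_inv_in chart_chart_inv)
    then show False using T by blast
  qed
  then show "\<gamma> \<tau> \<in> fst c" "snd c (\<gamma> \<tau>) \<in> ball x0 R" by (auto simp: V_def)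
qed

section \<open>Comparison of the metric with norms in a chart\<close>

text \<open>The curve with straight coordinates from \<open>x\<close> to \<open>y\<close> competes
  in the infimum that defines the distance.\<close>

lemma riem_dist_le_segment:
  assumes c: "c \<in> A" and seg: "closed_segment x y \<subseteq> snd c ` fst c"
    and le: "\<And>z a. z \<in> closed_segment x y \<Longrightarrow> sqrt (metric_coord A g c z a a) \<le> M * norm a"
  shows "riem_dist A g (chart_inv c x) (chart_inv c y) \<le> ereal (M * norm (y - x))"
proof -
  define l where "l t = x + t *\<^sub>R (y - x)" for t
  define \<gamma> where "\<gamma> t = chart_inv c (l t)" for t
  have l_seg: "l t \<in> closed_segment x y" if "t \<in> {0..1}" for t
    using that unfolding l_def closed_segment_def by (auto simp: algebra_simps intro!: exI[of _ t])
  have l_img: "l t \<in> snd c ` fst c" if "t \<in> {0..1}" for t using l_seg[OF that] seg by blast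
  have \<gamma>_in: "\<gamma> t \<in> fst c" "snd c (\<gamma> t) = l t" if "t \<in> {0..1}" for t
    using l_img[OF that] by (simp_all add: \<gamma>_def chart_inv_in chart_chart_inv)
  have l_der: "(l has_vector_derivative (y - x)) (at t within S)" for t S
    unfolding l_def[abs_def] by (auto intro!: derivative_eq_intros)
  have l_cont: "continuous_on S l" for S unfolding l_def[abs_def] by (intro continuous_intros)
  have cont: "continuous_on {0..1} \<gamma>"
    unfolding \<gamma>_def[abs_def]
    by (rule continuous_on_compose2[OF continuous_on_chart_inv[OF c] l_cont]) (use l_img in auto)
  have pC1: "piecewise_C1_curve A \<gamma>"
    unfolding piecewise_C1_curve_def
  \<comment> \<open>There are no break points, but C1 pieces are required in every chart; the
    derivatives in \<open>c'\<close> come from the C1 transition map.\<close>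
  proof (intro conjI cont exI[of _ "{}"] ballI allI impI)
    fix c' s t assume c': "c' \<in> A"
      and "0 \<le> s \<and> s < t \<and> t \<le> 1 \<and> {s<..<t} \<inter> {} = {} \<and> \<gamma> ` {s..t} \<subseteq> fst c'"
    then have st: "0 \<le> s" "s < t" "t \<le> 1" "\<gamma> ` {s..t} \<subseteq> fst c'" by auto
    obtain f' where f': "continuous_on (snd c ` (fst c \<inter> fst c')) f'"
      "\<And>z. z \<in> snd c ` (fst c \<inter> fst c') \<Longrightarrow> (transition c c' has_derivative blinfun_apply (f' z)) (at z)"
      using smooth_onE[OF smooth_on_transition[OF c c']] by metis
    have mem: "l r \<in> snd c ` (fst c \<inter> fst c')" if "r \<in> {s..t}" for r
    proof -
      have "r \<in> {0..1}" "\<gamma> r \<in> fst c'" using st that by auto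
      then show ?thesis using \<gamma>_in[of r] by (metis IntI imageI)
    qed
    show "\<exists>D. continuous_on {s..t} D \<and>
        (\<forall>r\<in>{s..t}. ((snd c' \<circ> \<gamma>) has_vector_derivative D r) (at r within {s..t}))"
    proof (intro exI[of _ "\<lambda>r. blinfun_apply (f' (l r)) (y - x)"] conjI ballI)
      have "continuous_on {s..t} (\<lambda>r. f' (l r))"
        by (rule continuous_on_compose2[OF f'(1) l_cont]) (use mem in auto)
      then show "continuous_on {s..t} (\<lambda>r. blinfun_apply (f' (l r)) (y - x))"
        by (intro blinfun.continuous_on continuous_on_const)
    next
      fix r assume r: "r \<in> {s..t}"
      have "((transition c c' \<circ> l) has_vector_derivative blinfun_apply (f' (l r)) (y - x)) (at r within {s..t})"
        by (rule vector_derivative_diff_chain_within[OF l_der has_derivative_at_withinI[OF f'(2)[OF mem[OF r]]]])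
      then show "((snd c' \<circ> \<gamma>) has_vector_derivative blinfun_apply (f' (l r)) (y - x)) (at r within {s..t})"
        by (simp add: transition_def \<gamma>_def[abs_def] o_def)
    qed
  qed simp
  have sp: "speed \<gamma> r \<le> M * norm (y - x)" if r: "r \<in> {0..1}" for r
  proof -
    have "((snd c \<circ> \<gamma>) has_vector_derivative (y - x)) (at r within {0..1})"
      by (rule has_vector_derivative_transform[OF r _ l_der]) (use \<gamma>_in in auto)
    note v = velocity_in_chart[OF c r \<gamma>_in(1)[OF r] cont this]
    have "c \<in> charts_at A (\<gamma> r)" using c \<gamma>_in(1)[OF r] by (simp add: charts_at_def)
    from tnorm_coord[OF this v(1)] show ?thesis
      unfolding v(2) \<gamma>_in(2)[OF r] using le[OF l_seg[OF r]] by simp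
  qed
  have "curve_length A g \<gamma> \<le> integral {0..1} (\<lambda>_::real. M * norm (y - x))"
    unfolding curve_length_def
    by (rule integral_le[OF speed_integrable[OF pC1]]) (use sp in auto)
  then have "curve_length A g \<gamma> \<le> M * norm (y - x)" by simp
  moreover have "\<gamma> 0 = chart_inv c x" "\<gamma> 1 = chart_inv c y" by (simp_all add: \<gamma>_def l_def)
  ultimately show ?thesis
    unfolding riem_dist_def using pC1 by (intro INF_lower2[of \<gamma>]) auto
qed

text \<open>Rests on continuity of the metric tensor in operator norm. The bounds with
  \<open>m\<close> and \<open>M\<close> are crude; the one with \<theta>, which may be close to 1,
  compares lengths near \<open>p\<close> sharply with the norm at \<open>p\<close>.\<close>

lemma metric_coord_near:
  assumes c: "c \<in> charts_at A p" and \<theta>: "0 < \<theta>" "\<theta> < 1"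
  obtains R m M where "R > 0" "m > 0" "M > 0" "ball (snd c p) R \<subseteq> snd c ` fst c"
    "\<And>x a. x \<in> ball (snd c p) R \<Longrightarrow> m * norm a \<le> sqrt (metric_coord A g c x a a)"
    "\<And>x a. x \<in> ball (snd c p) R \<Longrightarrow> sqrt (metric_coord A g c x a a) \<le> M * norm a"
    "\<And>x a. x \<in> ball (snd c p) R \<Longrightarrow>
      \<theta> * sqrt (metric_coord A g c (snd c p) a a) \<le> sqrt (metric_coord A g c x a a)"
proof -
  let ?x0 = "snd c p" and ?G = "metric_coord A g c"
  have cA: "c \<in> A" "p \<in> fst c" using charts_atD[OF c] .
  obtain m0 M0 where m0: "m0 > 0" and *: "\<And>v. v \<in> tangent_space A p \<Longrightarrow> m0 * norm (v c) \<le> tnorm g p v"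
    using tnorm_equivalent[OF c] by metis
  have low0: "m0 * norm a \<le> sqrt (?G ?x0 a a)" for a
    using *[OF tangent_vec_in[OF c, of a]] tnorm_coord[OF c tangent_vec_in[OF c, of a]]
    by (simp add: tangent_vec_apply[OF c])
  \<comment> \<open>An error of \<open>\<epsilon> * (norm a)\<^sup>2\<close> is then at most the
    fraction \<open>1 - \<theta>\<^sup>2\<close> of \<open>?G ?x0 a a\<close>, because
    \<open>?G ?x0 a a\<close> is at least \<open>(m0 * norm a)\<^sup>2\<close>.\<close>
  define \<epsilon> where "\<epsilon> = (1 - \<theta>\<^sup>2) * m0\<^sup>2"
  have \<theta>2: "\<theta>\<^sup>2 < 1" using \<theta> by (simp add: power_less_one_iff)
  have \<epsilon>: "\<epsilon> > 0" using \<theta>2 m0 by (simp add: \<epsilon>_def)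
  have oi: "open (snd c ` fst c)" "?x0 \<in> snd c ` fst c" using open_chart_image cA by auto
  have "isCont ?G ?x0"
    using continuous_on_metric_coord[OF cA(1)] oi(2) unfolding continuous_on_eq_continuous_at[OF oi(1)]
    by (rule bspec)
  then obtain d where d: "d > 0" "\<And>x. dist x ?x0 < d \<Longrightarrow> dist (?G x) (?G ?x0) < \<epsilon>"
    using \<epsilon> unfolding continuous_at_eps_delta by (metis dist_commute)
  obtain e where e: "e > 0" "ball ?x0 e \<subseteq> snd c ` fst c" using oi openE by blast
  define R where "R = min d e"
  have diff: "\<bar>?G x a a - ?G ?x0 a a\<bar> \<le> \<epsilon> * (norm a)\<^sup>2" if "x \<in> ball ?x0 R" for x a
  proof -
    have "norm (?G x - ?G ?x0) \<le> \<epsilon>" using d(2)[of x] that by (auto simp: R_def dist_norm norm_minus_commute)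
    have "\<bar>?G x a a - ?G ?x0 a a\<bar> = norm (blinfun_apply (blinfun_apply (?G x - ?G ?x0) a) a)"
      by (simp add: blinfun.diff_left)
    also have "\<dots> \<le> norm (?G x - ?G ?x0) * norm a * norm a"
      by (meson mult_right_mono norm_blinfun norm_ge_zero order_trans)
    also have "\<dots> \<le> \<epsilon> * norm a * norm a" by (intro mult_right_mono \<open>norm (?G x - ?G ?x0) \<le> \<epsilon>\<close>) auto
    finally show ?thesis by (simp add: power2_eq_square)
  qed
  have sq: "(m0 * norm a)\<^sup>2 \<le> ?G ?x0 a a" for a
    using power_mono[OF low0[of a], of 2] m0 metric_coord_nonneg[OF c, of a] by simp
  have "\<theta>\<^sup>2 * ?G ?x0 a a \<le> ?G x a a" if "x \<in> ball ?x0 R" for x a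
  proof -
    have "\<epsilon> * (norm a)\<^sup>2 = (1 - \<theta>\<^sup>2) * (m0 * norm a)\<^sup>2" by (simp add: \<epsilon>_def power_mult_distrib)
    also have "\<dots> \<le> (1 - \<theta>\<^sup>2) * ?G ?x0 a a" using sq \<theta>2 by (intro mult_left_mono) auto
    finally show ?thesis using diff[OF that, of a] by (simp add: left_diff_distrib abs_le_iff)
  qed
  then have low: "\<theta> * sqrt (?G ?x0 a a) \<le> sqrt (?G x a a)" if "x \<in> ball ?x0 R" for x a
    using real_sqrt_le_mono[of "\<theta>\<^sup>2 * ?G ?x0 a a" "?G x a a"] that \<theta> by (simp add: real_sqrt_mult)
  define M where "M = sqrt (norm (?G ?x0) + \<epsilon>)"
  show ?thesis
  proof (rule that)
    show "R > 0" using d e by (simp add: R_def)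
    show "\<theta> * m0 > 0" using \<theta> m0 by simp
    show "M > 0" using \<epsilon> by (simp add: M_def add_nonneg_pos)
    show "ball ?x0 R \<subseteq> snd c ` fst c" using e by (auto simp: R_def)
    fix x a assume x: "x \<in> ball ?x0 R"
    show "\<theta> * sqrt (?G ?x0 a a) \<le> sqrt (?G x a a)" by (rule low[OF x])
    moreover have "\<theta> * (m0 * norm a) \<le> \<theta> * sqrt (?G ?x0 a a)"
      by (intro mult_left_mono low0) (use \<theta> in auto)
    ultimately show "\<theta> * m0 * norm a \<le> sqrt (?G x a a)" by (simp add: mult.assoc)
    have "?G ?x0 a a \<le> norm (?G ?x0) * norm a * norm a"
    proof -
      have "?G ?x0 a a \<le> norm (?G ?x0 a) * norm a" using norm_blinfun[of "?G ?x0 a" a] by simp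
      also have "\<dots> \<le> norm (?G ?x0) * norm a * norm a" by (intro mult_right_mono norm_blinfun) auto
      finally show ?thesis .
    qed
    then have "?G x a a \<le> (norm (?G ?x0) + \<epsilon>) * (norm a)\<^sup>2"
      using diff[OF x, of a] by (simp add: power2_eq_square algebra_simps abs_le_iff)
    then have "sqrt (?G x a a) \<le> sqrt ((norm (?G ?x0) + \<epsilon>) * (norm a)\<^sup>2)" by (rule real_sqrt_le_mono)
    then show "sqrt (?G x a a) \<le> M * norm a" by (simp add: M_def real_sqrt_mult)
  qed
qed

end

section \<open>Normal coordinates\<close>

text \<open>A fixed chart \<open>c\<close> at \<open>p\<close> identifies the model space with the
  tangent space by \<open>T\<close> and turns the exponential map into the map \<open>E\<close> on
  the open set \<open>U\<close> of the model space, where Hilbert space analysis applies.\<close>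

locale normal_coordinates = riemannian_manifold A g
  for A :: "('m::t2_space, 'a::{real_inner, banach}) chart set"
    and g :: "('m, 'a) metric" +
  fixes p :: 'm and W :: "('m, 'a) tvec set" and c :: "('m, 'a) chart"
  assumes normal_nbhd: "normal_nbhd A g p W"
    and chart_at: "c \<in> charts_at A p"
begin

abbreviation T :: "'a \<Rightarrow> ('m, 'a) tvec"
  where "T \<equiv> tangent_vec A c p"

abbreviation e :: "('m, 'a) tvec \<Rightarrow> 'm"
  where "e \<equiv> exp_map A g p"

definition E :: "'a \<Rightarrow> 'a"
  where "E a = snd c (e (T a))"

definition U :: "'a set"
  where "U = {a. T a \<in> W \<and> e (T a) \<in> fst c}"

lemma c_in: "c \<in> A" "p \<in> fst c"
  using charts_atD[OF chart_at] .

lemmas T_in = tangent_vec_in[OF chart_at]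
  and T_apply = tangent_vec_apply[OF chart_at]
  and T_coord = tangent_vec_coord[OF chart_at]

lemma
  shows normal_subset: "W \<subseteq> tangent_space A p"
    and zero_in_normal: "0 \<in> W"
    and normal_geodesic: "\<forall>v\<in>W. (\<forall>t\<in>{0..1}. t *\<^sub>R v \<in> W) \<and> geodesic_from A g p v (\<lambda>t. e (t *\<^sub>R v))"
    and inj_on_exp: "inj_on e W"
    and normal_smooth: "\<forall>c\<in>charts_at A p. \<forall>c'\<in>A.
       smooth_on ((\<lambda>v. v c) ` {v\<in>W. e v \<in> fst c'}) (\<lambda>a. snd c' (e (tangent_vec A c p a))) \<and>
       smooth_on (snd c' ` (fst c' \<inter> e ` W)) (\<lambda>x. inv_into W e (chart_inv c' x) c)"
proof -
  note N = normal_nbhd[unfolded normal_nbhd_def Let_def]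
  show "W \<subseteq> tangent_space A p" using N by (elim conjE)
  show "0 \<in> W" using N by (elim conjE)
  show "\<forall>v\<in>W. (\<forall>t\<in>{0..1}. t *\<^sub>R v \<in> W) \<and> geodesic_from A g p v (\<lambda>t. e (t *\<^sub>R v))"
    using N by (elim conjE)
  show "inj_on e W" using N by (elim conjE)
  show "\<forall>c\<in>charts_at A p. \<forall>c'\<in>A.
       smooth_on ((\<lambda>v. v c) ` {v\<in>W. e v \<in> fst c'}) (\<lambda>a. snd c' (e (tangent_vec A c p a))) \<and>
       smooth_on (snd c' ` (fst c' \<inter> e ` W)) (\<lambda>x. inv_into W e (chart_inv c' x) c)"
    using N by (elim conjE)
qed

lemma exp_zero: "e 0 = p"
proof -
  have "geodesic_from A g p 0 (\<lambda>t. e (t *\<^sub>R 0))" using normal_geodesic zero_in_normal by blast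
  then have "e (0 *\<^sub>R 0) = p" unfolding geodesic_from_def by blast
  then show ?thesis unfolding scaleR_zero_left .
qed

lemma T_zero: "T 0 = 0"
  by (rule tangent_vec_zero[OF chart_at])

lemma zero_in_U: "0 \<in> U"
  unfolding U_def mem_Collect_eq T_zero exp_zero using zero_in_normal c_in by (intro conjI)

lemma E_zero: "E 0 = snd c p"
  unfolding E_def T_zero exp_zero ..

lemma U_eq: "(\<lambda>v. v c) ` {v\<in>W. e v \<in> fst c} = U"
proof (intro set_eqI iffI)
  fix a assume "a \<in> (\<lambda>v. v c) ` {v\<in>W. e v \<in> fst c}"
  then obtain v where v: "v \<in> W" "e v \<in> fst c" "a = v c" by blast
  have "T a = v" unfolding v(3) by (rule T_coord) (use v normal_subset in blast)
  then show "a \<in> U" unfolding U_def mem_Collect_eq using v by metis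
next
  fix a assume "a \<in> U"
  then have a: "T a \<in> {v\<in>W. e v \<in> fst c}" unfolding U_def by blast
  show "a \<in> (\<lambda>v. v c) ` {v\<in>W. e v \<in> fst c}"
    by (rule image_eqI[OF _ a]) (rule T_apply[symmetric])
qed

lemma smooth_E: "smooth_on U E"
proof -
  have "smooth_on ((\<lambda>v. v c) ` {v\<in>W. e v \<in> fst c}) (\<lambda>a. snd c (e (T a)))"
    using normal_smooth chart_at c_in by blast
  then show ?thesis unfolding U_eq E_def[abs_def] .
qed

lemma open_U: "open U"
  using smooth_E by (simp add: smooth_on_def)

lemma chart_inv_E: "a \<in> U \<Longrightarrow> chart_inv c (E a) = e (T a)"
  unfolding E_def U_def using chart_inv_chart[OF c_in(1)] by blast

lemma E_in: "a \<in> U \<Longrightarrow> E a \<in> snd c ` fst c"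
  unfolding E_def U_def by blast

section \<open>The exponential map near zero\<close>

text \<open>The geodesic \<open>\<lambda>t. e (t *\<^sub>R v)\<close> has initial velocity
  \<open>v\<close>, so \<open>E\<close> has derivative the identity at 0. Continuity of the
  derivative and the mean value inequality for \<open>E x - x\<close> make this strict. Two free
  points are required because a curve to \<Omega> joins two points near 0.\<close>

lemma E_strict_derivative:
  assumes \<epsilon>: "\<epsilon> > 0"
  obtains r where "r > 0" "ball 0 r \<subseteq> U"
    "\<And>a b. norm a < r \<Longrightarrow> norm b < r \<Longrightarrow> norm (E a - E b - (a - b)) \<le> \<epsilon> * norm (a - b)"
proof -
  obtain E' where E': "continuous_on U E'" "\<And>x. x \<in> U \<Longrightarrow> (E has_derivative blinfun_apply (E' x)) (at x)"
    using smooth_onE[OF smooth_E] by metis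
  obtain r0 where r0: "r0 > 0" "ball 0 r0 \<subseteq> U" using open_U zero_in_U openE by blast
  have E'0: "blinfun_apply (E' 0) a = a" for a
  proof -
    \<comment> \<open>Scaling brings \<open>a\<close> into a ball contained in \<open>U\<close>;
      linearity of the derivative undoes it at the end.\<close>
    define s where "s = r0 / (2 * (norm a + 1))"
    have n1: "norm a + 1 > 0" using norm_ge_zero[of a] by linarith
    then have s: "s > 0" using r0 by (simp add: s_def)
    have "norm (s *\<^sub>R a) < r0"
    proof -
      have "norm (s *\<^sub>R a) = r0 / 2 * (norm a / (norm a + 1))" using r0 n1 by (simp add: s_def)
      also have "\<dots> \<le> r0 / 2 * 1" using r0 n1 by (intro mult_left_mono) (auto simp: divide_le_eq_1)
      finally show ?thesis using r0 by simp
    qed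
    then have "s *\<^sub>R a \<in> U" using r0 by auto
    then have v: "T (s *\<^sub>R a) \<in> W" by (simp add: U_def)
    let ?\<gamma> = "\<lambda>t. e (t *\<^sub>R T (s *\<^sub>R a))"
    have "geodesic_from A g p (T (s *\<^sub>R a)) ?\<gamma>" using normal_geodesic v by blast
    then have vel: "velocity A {0..1} ?\<gamma> 0 = T (s *\<^sub>R a)" and \<gamma>0: "?\<gamma> 0 = p"
      unfolding geodesic_from_def by blast+
    have "velocity A {0..1} ?\<gamma> 0 c = vector_derivative (snd c \<circ> ?\<gamma>) (at 0 within {0..1})"
      using chart_at unfolding velocity_def \<gamma>0 by simp
    then have 1: "vector_derivative (snd c \<circ> ?\<gamma>) (at 0 within {0..1}) = s *\<^sub>R a"
      unfolding vel T_apply by simp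
    have "snd c \<circ> ?\<gamma> = (\<lambda>t. E (t *\<^sub>R (s *\<^sub>R a)))"
      by (rule ext) (simp only: o_def E_def tangent_vec_scaleR[OF chart_at])
    moreover have "((\<lambda>t. E (t *\<^sub>R (s *\<^sub>R a))) has_vector_derivative blinfun_apply (E' 0) (s *\<^sub>R a)) (at 0 within {0..1})"
    proof -
      have "((\<lambda>t. t *\<^sub>R (s *\<^sub>R a)) has_vector_derivative s *\<^sub>R a) (at 0 within {0..1})"
        by (auto intro!: derivative_eq_intros)
      moreover have "(E has_derivative blinfun_apply (E' 0))
          (at (0 *\<^sub>R (s *\<^sub>R a)) within (\<lambda>t. t *\<^sub>R (s *\<^sub>R a)) ` {0..1})"
        using E'(2)[OF zero_in_U] by (simp add: has_derivative_at_withinI)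
      ultimately show ?thesis
        using vector_derivative_diff_chain_within[of "\<lambda>t. t *\<^sub>R (s *\<^sub>R a)" _ 0 "{0..1}" E] by (simp add: o_def)
    qed
    ultimately have "((snd c \<circ> ?\<gamma>) has_vector_derivative blinfun_apply (E' 0) (s *\<^sub>R a))
        (at 0 within cbox 0 1)" by (simp only: box_real)
    from vector_derivative_within_cbox[OF zero_less_one _ this] 1
    have "blinfun_apply (E' 0) (s *\<^sub>R a) = s *\<^sub>R a" by (simp only: box_real) simp
    then show ?thesis using s by (simp add: blinfun.scaleR_right)
  qed
  have "isCont E' 0" using E'(1) zero_in_U unfolding continuous_on_eq_continuous_at[OF open_U] by blast
  then obtain d where d: "d > 0" "\<And>x. dist x 0 < d \<Longrightarrow> dist (E' x) (E' 0) < \<epsilon>"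
    using \<epsilon> unfolding continuous_at_eps_delta by metis
  define r where "r = min d r0"
  show ?thesis
  proof (rule that)
    show "r > 0" "ball 0 r \<subseteq> U" using d r0 by (auto simp: r_def)
    fix a b :: 'a assume ab: "norm a < r" "norm b < r"
    have "norm ((E a - a) - (E b - b)) \<le> \<epsilon> * norm (a - b)"
    proof (rule differentiable_bound[of "ball 0 r" "\<lambda>x. E x - x" "\<lambda>x v. blinfun_apply (E' x) v - v"])
      fix x :: 'a assume x: "x \<in> ball 0 r"
      then have "x \<in> U" using r0 by (auto simp: r_def)
      then show "((\<lambda>x. E x - x) has_derivative (\<lambda>v. blinfun_apply (E' x) v - v)) (at x within ball 0 r)"
        by (intro has_derivative_diff has_derivative_ident has_derivative_at_withinI[OF E'(2)])
      have "onorm (\<lambda>v. blinfun_apply (E' x) v - v) = norm (E' x - E' 0)"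
      proof -
        have "(\<lambda>v. blinfun_apply (E' x) v - v) = blinfun_apply (E' x - E' 0)"
          by (auto simp: fun_eq_iff blinfun.diff_left E'0)
        then show ?thesis by (simp add: norm_blinfun.rep_eq)
      qed
      also have "\<dots> \<le> \<epsilon>" using d(2)[of x] x by (auto simp: r_def dist_norm)
      finally show "onorm (\<lambda>v. blinfun_apply (E' x) v - v) \<le> \<epsilon>" .
    qed (use ab in auto)
    then show "norm (E a - E b - (a - b)) \<le> \<epsilon> * norm (a - b)" by (simp add: algebra_simps)
  qed
qed

text \<open>\<open>normal_nbhd\<close> includes smoothness of the inverse of the exponential map in
  charts. Its continuity at \<open>snd c p\<close> gives small preimages.\<close>

lemma E_local_inverse:
  assumes r: "r > 0"
  obtains s where "s > 0" "\<And>x. norm (x - snd c p) < s \<Longrightarrow>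
    \<exists>b. norm b < r \<and> b \<in> U \<and> E b = x \<and> e (T b) = chart_inv c x"
proof -
  define J where "J x = inv_into W e (chart_inv c x) c" for x
  define Y where "Y = snd c ` (fst c \<inter> e ` W)"
  have J: "smooth_on Y J" unfolding Y_def J_def[abs_def] using normal_smooth chart_at c_in by blast
  have "p \<in> e ` W" using imageI[OF zero_in_normal, of e] unfolding exp_zero .
  then have pY: "snd c p \<in> Y" using c_in unfolding Y_def by blast
  have oY: "open Y" using J by (simp add: smooth_on_def)
  have "inv_into W e p = 0" using inv_into_f_f[OF inj_on_exp zero_in_normal] exp_zero by simp
  then have J0: "J (snd c p) = 0" by (simp add: J_def chart_inv_chart[OF c_in])
  have "isCont J (snd c p)"
    using smooth_on_imp_continuous_on[OF J] pY unfolding continuous_on_eq_continuous_at[OF oY] by blast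
  then obtain d where d: "d > 0" "\<And>x. dist x (snd c p) < d \<Longrightarrow> dist (J x) 0 < r"
    using r J0 unfolding continuous_at_eps_delta by metis
  obtain s where s: "s > 0" "ball (snd c p) s \<subseteq> Y" using oY pY openE by blast
  show ?thesis
  proof (rule that[of "min d s"])
    show "min d s > 0" using d s by simp
    fix x assume x: "norm (x - snd c p) < min d s"
    then have "x \<in> Y" using s by (auto simp: dist_norm norm_minus_commute)
    then have xc: "x \<in> snd c ` fst c" and q: "chart_inv c x \<in> fst c" "chart_inv c x \<in> e ` W"
      unfolding Y_def using chart_inv_chart[OF c_in(1)] by auto
    define v where "v = inv_into W e (chart_inv c x)"
    have v: "v \<in> W" "e v = chart_inv c x"
      unfolding v_def using inv_into_into[OF q(2)] f_inv_into_f[OF q(2)] by auto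
    have Tv: "T (v c) = v" by (rule T_coord) (use v normal_subset in blast)
    show "\<exists>b. norm b < r \<and> b \<in> U \<and> E b = x \<and> e (T b) = chart_inv c x"
    proof (intro exI[of _ "v c"] conjI)
      have "v c = J x" by (simp add: v_def J_def)
      then show "norm (v c) < r" using d(2)[of x] x by (auto simp: dist_norm)
      show "v c \<in> U" using v q by (simp add: U_def Tv)
      show "E (v c) = x" using v chart_chart_inv[OF xc] by (simp add: E_def Tv)
      show "e (T (v c)) = chart_inv c x" using v by (simp add: Tv)
    qed
  qed
qed

text \<open>This turns Lipschitz continuity for the Riemannian distance into Lipschitz continuity on
  a ball of the Hilbert space. The segment between the two chart coordinates stays in a convex ball
  and serves as competing curve.\<close>

lemma exp_lipschitz:
  obtains r L where "r > 0" "L > 0" "ball 0 r \<subseteq> U"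
    "\<And>a b. norm a < r \<Longrightarrow> norm b < r \<Longrightarrow> riem_dist A g (e (T a)) (e (T b)) \<le> ereal (L * norm (a - b))"
proof -
  obtain R m M where R: "R > 0" "M > 0" "ball (snd c p) R \<subseteq> snd c ` fst c"
    "\<And>x a. x \<in> ball (snd c p) R \<Longrightarrow> sqrt (metric_coord A g c x a a) \<le> M * norm a"
  proof -
    have "0 < (1 / 2 :: real)" "(1 / 2 :: real) < 1" by auto
    then show ?thesis using metric_coord_near[OF chart_at, of "1 / 2"] that by metis
  qed
  obtain r1 where r1: "r1 > 0" "ball 0 r1 \<subseteq> U"
    "\<And>a b. norm a < r1 \<Longrightarrow> norm b < r1 \<Longrightarrow> norm (E a - E b - (a - b)) \<le> 1 * norm (a - b)"
    using E_strict_derivative[of 1] by auto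
  have E2: "norm (E a - E b) \<le> 2 * norm (a - b)" if "norm a < r1" "norm b < r1" for a b :: 'a
    using r1(3)[OF that] norm_triangle_ineq[of "E a - E b - (a - b)" "a - b"] by simp
  define r where "r = min r1 (R / 2)"
  show ?thesis
  proof (rule that[of r "M * 2"])
    show "r > 0" "M * 2 > 0" "ball 0 r \<subseteq> U" using r1 R by (auto simp: r_def)
    fix a b :: 'a assume ab: "norm a < r" "norm b < r"
    have "E x \<in> ball (snd c p) R" if "norm x < r" for x
      using E2[of x 0] that r1(1) E_zero by (auto simp: r_def dist_norm norm_minus_commute)
    then have seg: "closed_segment (E a) (E b) \<subseteq> ball (snd c p) R"
      using ab by (intro closed_segment_subset convex_ball) auto
    have aU: "a \<in> U" "b \<in> U" using ab r1(2) by (auto simp: r_def)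
    have "riem_dist A g (chart_inv c (E a)) (chart_inv c (E b)) \<le> ereal (M * norm (E b - E a))"
      by (rule riem_dist_le_segment[OF c_in(1)]) (use seg R in auto)
    also have "\<dots> \<le> ereal (M * 2 * norm (a - b))"
      using E2[of b a] ab R(2) by (simp add: r_def norm_minus_commute)
    finally show "riem_dist A g (e (T a)) (e (T b)) \<le> ereal (M * 2 * norm (a - b))"
      unfolding chart_inv_E[OF aU(1)] chart_inv_E[OF aU(2)] .
  qed
qed

text \<open>Long curves satisfy the estimate trivially, so that only curves of length \<open>O(norm a)\<close> matter.
  They stay in normal coordinates, which are isometric to first order at \<open>0\<close>.\<close>

lemma normal_functional_le_curve_length:
  assumes \<phi>: "bounded_linear \<phi>" and \<alpha>: "\<alpha> > 0"
    and le: "\<And>a. \<bar>\<phi> a\<bar> \<le> \<alpha> * sqrt (metric_coord A g c (snd c p) a a)"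
    and normal: "\<And>\<epsilon>. \<epsilon> > 0 \<Longrightarrow> \<exists>r>0. \<forall>b. norm b < r \<and> b \<in> U \<and> e (T b) \<in> \<Omega> \<longrightarrow> \<phi> b \<le> \<epsilon> * norm b"
    and \<epsilon>: "\<epsilon> > 0"
  obtains r where "r > 0" "\<And>a \<gamma>. norm a < r \<Longrightarrow> piecewise_C1_curve A \<gamma> \<Longrightarrow> \<gamma> 0 = e (T a) \<Longrightarrow>
    \<gamma> 1 \<in> \<Omega> \<Longrightarrow> \<phi> a - \<epsilon> * norm a \<le> \<alpha> * curve_length A g \<gamma>"
proof -
  interpret \<phi>: bounded_linear \<phi> by fact
  obtain B0 where B0: "B0 \<ge> 0" "\<And>h. \<bar>\<phi> h\<bar> \<le> B0 * norm h"
    using \<phi>.nonneg_bounded by (auto simp: mult.commute)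
  define B where "B = B0 + 1"
  have B: "B > 0" "\<And>h. \<bar>\<phi> h\<bar> \<le> B * norm h"
    using B0 by (auto simp: B_def distrib_right intro: add_increasing2)
  \<comment> \<open>\<open>K * norm a\<close> is the length beyond which the estimate is trivial,
    since then \<open>\<phi> a \<le> B * norm a \<le> \<alpha> * l\<close>.\<close>
  define K where "K = B / \<alpha>"
  have K: "K > 0" "\<alpha> * K = B" using B \<alpha> by (auto simp: K_def)
  \<comment> \<open>The error is split into three parts of \<open>\<epsilon> / 3 * norm a\<close>.
    The variation of the metric costs one part: passing from \<alpha> to
    \<open>\<alpha> / \<theta>\<close> adds \<open>\<epsilon> / (3 * B) * (\<alpha> * l)\<close>,
    and \<open>\<alpha> * l \<le> B * norm a\<close> for short curves.\<close>
  define \<theta> where "\<theta> = B / (B + \<epsilon> / 3)"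
  have \<theta>: "0 < \<theta>" "\<theta> < 1" using B \<epsilon> by (auto simp: \<theta>_def add_pos_pos)
  have \<alpha>\<theta>: "\<alpha> / \<theta> = \<alpha> + \<alpha> * (\<epsilon> / (3 * B))"
    using B \<epsilon> by (simp add: \<theta>_def field_simps)
  let ?x0 = "snd c p" and ?G = "metric_coord A g c"
  obtain R m M where R: "R > 0" "m > 0" "ball ?x0 R \<subseteq> snd c ` fst c"
    and low: "\<And>x a. x \<in> ball ?x0 R \<Longrightarrow> m * norm a \<le> sqrt (?G x a a)"
    and cmp: "\<And>x a. x \<in> ball ?x0 R \<Longrightarrow> \<theta> * sqrt (?G ?x0 a a) \<le> sqrt (?G x a a)"
    using metric_coord_near[OF chart_at \<theta>] by metis
  \<comment> \<open>\<open>2 * norm a\<close> bounds the distance of the initial coordinates from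
    \<open>?x0\<close>, and \<open>K / m * norm a\<close> the displacement along a short
    curve.\<close>
  define C1 where "C1 = 2 + K / m"
  have C1: "C1 > 0" using K R by (simp add: C1_def add_pos_pos)
  \<comment> \<open>The nonlinearity of \<open>E\<close> between \<open>a\<close> and the end point
    \<open>b\<close> costs the second part, as \<open>norm b \<le> 2 * C1 * norm a\<close>.\<close>
  define \<epsilon>1 where "\<epsilon>1 = min (1/2) (\<epsilon> / (3 * B * (1 + 2 * C1)))"
  have \<epsilon>1: "\<epsilon>1 > 0" "\<epsilon>1 \<le> 1/2" "B * \<epsilon>1 * (1 + 2 * C1) \<le> \<epsilon> / 3"
  proof -
    have p: "3 * B * (1 + 2 * C1) > 0" using B C1 by simp
    show "\<epsilon>1 > 0" using p \<epsilon> by (simp add: \<epsilon>1_def)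
    show "\<epsilon>1 \<le> 1/2" unfolding \<epsilon>1_def by (rule min.cobounded1)
    have "\<epsilon>1 \<le> \<epsilon> / (3 * B * (1 + 2 * C1))" unfolding \<epsilon>1_def by (rule min.cobounded2)
    then have "\<epsilon>1 * (3 * B * (1 + 2 * C1)) \<le> \<epsilon>" using p by (simp only: pos_le_divide_eq)
    then show "B * \<epsilon>1 * (1 + 2 * C1) \<le> \<epsilon> / 3" by (simp add: algebra_simps)
  qed
  \<comment> \<open>The third part is spent at the end point, where \<phi> is nonpositive only up to
    first order.\<close>
  define \<epsilon>2 where "\<epsilon>2 = \<epsilon> / (3 * (2 * C1))"
  have \<epsilon>2: "\<epsilon>2 > 0" "\<epsilon>2 * (2 * C1) = \<epsilon> / 3" using \<epsilon> C1 by (auto simp: \<epsilon>2_def)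
  obtain r1 where r1: "r1 > 0" "ball 0 r1 \<subseteq> U"
    "\<And>a b. norm a < r1 \<Longrightarrow> norm b < r1 \<Longrightarrow> norm (E a - E b - (a - b)) \<le> \<epsilon>1 * norm (a - b)"
    using E_strict_derivative[OF \<epsilon>1(1)] by blast
  have E_half: "norm (E a - ?x0 - a) \<le> norm a / 2" if "norm a < r1" for a
  proof -
    have "norm (E a - E 0 - (a - 0)) \<le> \<epsilon>1 * norm (a - 0)" using r1(1) that by (intro r1(3)) auto
    also have "\<dots> \<le> 1 / 2 * norm (a - 0)" by (intro mult_right_mono \<epsilon>1) auto
    finally show ?thesis by (simp add: E_zero)
  qed
  obtain r2 where r2: "r2 > 0" "\<And>b. norm b < r2 \<Longrightarrow> b \<in> U \<Longrightarrow> e (T b) \<in> \<Omega> \<Longrightarrow> \<phi> b \<le> \<epsilon>2 * norm b"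
    using normal[OF \<epsilon>2(1)] by blast
  obtain s where s: "s > 0" "\<And>x. norm (x - ?x0) < s \<Longrightarrow>
      \<exists>b. norm b < min r1 r2 \<and> b \<in> U \<and> E b = x \<and> e (T b) = chart_inv c x"
    using E_local_inverse[of "min r1 r2"] r1(1) r2(1) by (metis min_less_iff_conj)
  define r where "r = min r1 (min (R / C1) (s / C1))"
  have r: "r > 0" using r1 R s C1 by (simp add: r_def)
  show ?thesis
  proof (rule that[OF r])
    fix a \<gamma>
    assume a: "norm a < r" and \<gamma>: "piecewise_C1_curve A \<gamma>" "\<gamma> 0 = e (T a)" "\<gamma> 1 \<in> \<Omega>"
    define l where "l = curve_length A g \<gamma>"
    have l_I: "l = integral {0..1} (speed \<gamma>)" by (simp add: l_def curve_length_def)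
    have ar: "norm a < r1" "C1 * norm a < R" "C1 * norm a < s"
      using a C1 by (auto simp: r_def field_simps)
    have aU: "a \<in> U" using ar r1(2) by auto
    have "\<phi> a - \<epsilon> * norm a \<le> \<alpha> * l"
    proof (cases "K * norm a \<le> l")
      case True
      then have "B * norm a \<le> \<alpha> * l" using mult_left_mono[OF True, of \<alpha>] \<alpha> K by (simp add: mult.assoc[symmetric])
      moreover have "0 \<le> \<epsilon> * norm a" using \<epsilon> by simp
      ultimately show ?thesis using B(2)[of a] by (auto simp: abs_le_iff)
    next
      case False
      have Ea: "norm (E a - ?x0) \<le> 2 * norm a"
      proof -
        have "norm (E a - ?x0) \<le> norm (E a - ?x0 - a) + norm a"
          using norm_triangle_ineq[of "E a - ?x0 - a" a] by simp
        then show ?thesis using E_half[OF ar(1)] norm_ge_zero[of a] by linarith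
      qed
      have \<gamma>0: "snd c (\<gamma> 0) = E a" "\<gamma> 0 \<in> fst c" using aU by (simp_all add: \<gamma> E_def U_def)
      have lm: "l / m \<le> K / m * norm a" using False R by (simp add: divide_right_mono)
      have "norm (snd c (\<gamma> 0) - ?x0) + curve_length A g \<gamma> / m \<le> C1 * norm a"
        using Ea lm unfolding \<gamma>0 l_def C1_def by (simp add: algebra_simps)
      then have small: "norm (snd c (\<gamma> 0) - ?x0) + curve_length A g \<gamma> / m < R" using ar by linarith
      note stay = curve_stays_in_chart_ball[OF \<gamma>(1) c_in(1) \<gamma>0(2) R(2,3) low small]
      have sub: "\<gamma> ` {0..1} \<subseteq> fst c" using stay(1) by blast
      define y where "y = snd c (\<gamma> 1)"
      have "m * norm (y - E a) \<le> l"
        unfolding l_I y_def \<gamma>0(1)[symmetric]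
        by (rule norm_le_integral_speed[OF \<gamma>(1) _ _ _ c_in(1) sub R(2) low[OF stay(2)]]) auto
      then have "norm (y - E a) \<le> l / m" using R(2) by (simp add: field_simps)
      then have yx0: "norm (y - ?x0) \<le> C1 * norm a"
        using norm_triangle_ineq[of "y - E a" "E a - ?x0"] Ea lm by (simp add: C1_def algebra_simps)
      then obtain b where b: "norm b < min r1 r2" "b \<in> U" "E b = y" "e (T b) = chart_inv c y"
        using s(2)[of y] ar by auto
      have "e (T b) \<in> \<Omega>"
        using b(4) \<gamma>(3) chart_inv_chart[OF c_in(1), of "\<gamma> 1"] stay(1)[of 1] by (simp add: y_def)
      then have "\<phi> b \<le> \<epsilon>2 * norm b" using r2(2) b by simp
      moreover have nb: "norm b \<le> 2 * C1 * norm a"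
      proof -
        have "norm b - norm (y - ?x0) \<le> norm (y - ?x0 - b)"
          using norm_triangle_ineq2[of b "y - ?x0"] by (simp add: norm_minus_commute)
        then have "norm b \<le> 2 * norm (y - ?x0)" using E_half[of b] b by simp
        then show ?thesis using yx0 by simp
      qed
      then have "\<epsilon>2 * norm b \<le> \<epsilon> / 3 * norm a"
        using mult_left_mono[OF nb, of \<epsilon>2] \<epsilon>2 by (metis less_imp_le mult.assoc)
      ultimately have est1: "\<phi> b \<le> \<epsilon> / 3 * norm a" by linarith
      have est2: "- \<phi> (E a - E b - (a - b)) \<le> \<epsilon> / 3 * norm a"
      proof -
        have "- \<phi> (E a - E b - (a - b)) \<le> B * norm (E a - E b - (a - b))"
          using B(2)[of "E a - E b - (a - b)"] by (simp add: abs_le_iff)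
        also have "\<dots> \<le> B * (\<epsilon>1 * norm (a - b))" using r1(3)[of a b] ar b B by simp
        also have "\<dots> \<le> B * (\<epsilon>1 * ((1 + 2 * C1) * norm a))"
          using norm_triangle_ineq4[of a b] nb B \<epsilon>1 by (intro mult_left_mono) (auto simp: algebra_simps)
        also have "\<dots> = (B * \<epsilon>1 * (1 + 2 * C1)) * norm a" by simp
        also have "\<dots> \<le> \<epsilon> / 3 * norm a" by (intro mult_right_mono \<epsilon>1) auto
        finally show ?thesis .
      qed
      have est3: "\<phi> (E a - E b) \<le> \<alpha> * l + \<epsilon> / 3 * norm a"
      proof -
        have "- \<phi> (snd c (\<gamma> 1) - snd c (\<gamma> 0)) \<le> \<alpha> / \<theta> * integral {0..1} (speed \<gamma>)"
        proof (rule linear_le_integral_speed[OF \<gamma>(1) _ _ _ c_in(1) sub])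
          show "bounded_linear (\<lambda>x. - \<phi> x)" using \<phi> by (rule bounded_linear_minus)
          fix t h assume "t \<in> {0..1::real}"
          have "- \<phi> h \<le> \<alpha> * sqrt (?G ?x0 h h)" using le[of h] by (simp add: abs_le_iff)
          also have "\<dots> = \<alpha> / \<theta> * (\<theta> * sqrt (?G ?x0 h h))" using \<theta> by simp
          also have "\<dots> \<le> \<alpha> / \<theta> * sqrt (?G (snd c (\<gamma> t)) h h)"
            by (intro mult_left_mono cmp stay(2)) (use \<theta> \<alpha> \<open>t \<in> {0..1}\<close> in auto)
          finally show "- \<phi> h \<le> \<alpha> / \<theta> * sqrt (?G (snd c (\<gamma> t)) h h)" .
        qed auto
        then have "\<phi> (E a - E b) \<le> \<alpha> / \<theta> * l"
          unfolding l_I[symmetric] \<gamma>0 y_def[symmetric] b(3) by (simp add: \<phi>.diff)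
        also have "\<dots> = \<alpha> * l + (\<epsilon> / (3 * B)) * (\<alpha> * l)" unfolding \<alpha>\<theta> by (simp add: algebra_simps)
        also have "(\<epsilon> / (3 * B)) * (\<alpha> * l) \<le> (\<epsilon> / (3 * B)) * (B * norm a)"
        proof (intro mult_left_mono)
          have "\<alpha> * l \<le> \<alpha> * (K * norm a)" using False \<alpha> by simp
          then show "\<alpha> * l \<le> B * norm a" unfolding mult.assoc[symmetric] K(2) .
        qed (use \<epsilon> B in auto)
        also have "(\<epsilon> / (3 * B)) * (B * norm a) = \<epsilon> / 3 * norm a" using B by simp
        finally show ?thesis by simp
      qed
      have "\<phi> a = \<phi> (E a - E b) + - \<phi> (E a - E b - (a - b)) + \<phi> b" by (simp add: \<phi>.diff)
      also have "\<dots> \<le> \<alpha> * l + \<epsilon> / 3 * norm a + \<epsilon> / 3 * norm a + \<epsilon> / 3 * norm a"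
        using est1 est2 est3 by linarith
      finally show ?thesis by simp
    qed
    then show "\<phi> a - \<epsilon> * norm a \<le> \<alpha> * curve_length A g \<gamma>" by (simp add: l_def)
  qed
qed

end

section \<open>Subgradients and normals in normal coordinates\<close>

lemma eventually_nearby:
  "eventually P (nearby A N x) \<longleftrightarrow> (\<exists>r>0. \<forall>u\<in>A. u \<noteq> x \<and> N (u - x) < r \<longrightarrow> P u)"
proof -
  have "eventually P (nearby A N x) \<longleftrightarrow>
      (\<exists>r\<in>{0<..}. eventually P (principal {u\<in>A. u \<noteq> x \<and> N (u - x) < r}))"
    unfolding nearby_def
  proof (rule eventually_INF_base)
    fix a b :: real assume "a \<in> {0<..}" "b \<in> {0<..}"
    then show "\<exists>r\<in>{0<..}. principal {u\<in>A. u \<noteq> x \<and> N (u - x) < r} \<le>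
        inf (principal {u\<in>A. u \<noteq> x \<and> N (u - x) < a}) (principal {u\<in>A. u \<noteq> x \<and> N (u - x) < b})"
      by (intro bexI[of _ "min a b"]) auto
  qed auto
  then show ?thesis by (auto simp: eventually_principal)
qed

text \<open>The \<epsilon>-form avoids quotients of extended reals while \<open>h u\<close> may
  still be infinite.\<close>

lemma frechet_subdiffI:
  assumes \<phi>: "\<phi> \<in> dual V N" and hx: "\<bar>h x\<bar> \<noteq> \<infinity>"
    and N: "\<And>u. u \<in> W \<Longrightarrow> u \<noteq> x \<Longrightarrow> N (u - x) > 0"
    and le: "\<And>\<epsilon>. \<epsilon> > 0 \<Longrightarrow> \<exists>r>0. \<forall>u\<in>W. N (u - x) < r \<longrightarrow>
      h x + ereal (\<phi> (u - x) - \<epsilon> * N (u - x)) \<le> h u"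
  shows "\<phi> \<in> frechet_subdiff V N W h x"
proof -
  have "0 \<le> Liminf (nearby W N x) (\<lambda>u. (h u - h x - ereal (\<phi> (u - x))) / ereal (N (u - x)))"
    unfolding le_Liminf_iff
  proof (intro allI impI)
    fix y :: ereal assume "y < 0"
    \<comment> \<open>A real number between \<open>y\<close> and 0; \<open>- z\<close> takes the
      role of \<epsilon>.\<close>
    then obtain z where z: "y < ereal z" "ereal z < 0" using ereal_dense2 by blast
    then have z0: "- z > 0" by simp
    obtain r where r: "r > 0" "\<And>u. u \<in> W \<Longrightarrow> N (u - x) < r \<Longrightarrow>
        h x + ereal (\<phi> (u - x) - (- z) * N (u - x)) \<le> h u" using le[OF z0] by blast
    have "y < (h u - h x - ereal (\<phi> (u - x))) / ereal (N (u - x))"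
      if u: "u \<in> W" "u \<noteq> x" "N (u - x) < r" for u
    proof -
      obtain hx' where hx': "h x = ereal hx'" using hx by auto
      define n where "n = N (u - x)"
      have n: "n > 0" using N u by (simp add: n_def)
      have "ereal (hx' + (\<phi> (u - x) + z * n)) \<le> h u" using r(2)[OF u(1,3)] by (simp add: hx' n_def)
      then have "ereal z \<le> (h u - ereal hx' - ereal (\<phi> (u - x))) / ereal n"
        using n by (cases "h u") (auto simp: pos_le_divide_eq)
      then show ?thesis using z(1) unfolding hx' n_def[symmetric] by (rule order.strict_trans2[rotated])
    qed
    then show "eventually (\<lambda>u. y < (h u - h x - ereal (\<phi> (u - x))) / ereal (N (u - x))) (nearby W N x)"
      unfolding eventually_nearby using r(1) by blast
  qed
  then show ?thesis using \<phi> hx unfolding frechet_subdiff_def by blast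
qed

lemma frechet_normalI:
  assumes \<phi>: "\<phi> \<in> dual V N"
    and N: "\<And>u. u \<in> A \<Longrightarrow> u \<noteq> x \<Longrightarrow> N (u - x) > 0"
    and le: "\<And>\<epsilon>. \<epsilon> > 0 \<Longrightarrow> \<exists>r>0. \<forall>u\<in>A. N (u - x) < r \<longrightarrow> \<phi> (u - x) \<le> \<epsilon> * N (u - x)"
  shows "\<phi> \<in> frechet_normal V N A x"
proof -
  have "Limsup (nearby A N x) (\<lambda>u. ereal (\<phi> (u - x) / N (u - x))) \<le> 0"
    unfolding Limsup_le_iff
  proof (intro allI impI)
    fix y :: ereal assume "0 < y"
    then obtain z where z: "0 < ereal z" "ereal z < y" using ereal_dense2 by blast
    then obtain r where r: "r > 0" "\<And>u. u \<in> A \<Longrightarrow> N (u - x) < r \<Longrightarrow> \<phi> (u - x) \<le> z * N (u - x)"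
      using le[of z] by auto
    have "ereal (\<phi> (u - x) / N (u - x)) < y" if u: "u \<in> A" "u \<noteq> x" "N (u - x) < r" for u
    proof -
      have "ereal (\<phi> (u - x) / N (u - x)) \<le> ereal z" using r(2)[OF u(1,3)] N[OF u(1,2)] by (simp add: divide_le_eq)
      then show ?thesis using z(2) by (rule order.strict_trans1)
    qed
    then show "eventually (\<lambda>u. ereal (\<phi> (u - x) / N (u - x)) < y) (nearby A N x)"
      unfolding eventually_nearby using r(1) by blast
  qed
  then show ?thesis using \<phi> unfolding frechet_normal_def by blast
qed

lemma frechet_normalD:
  assumes \<phi>: "\<phi> \<in> frechet_normal V N A x"
    and N: "\<And>u. u \<in> A \<Longrightarrow> u \<noteq> x \<Longrightarrow> N (u - x) > 0" and \<epsilon>: "\<epsilon> > 0"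
  obtains r where "r > 0" "\<And>u. u \<in> A \<Longrightarrow> u \<noteq> x \<Longrightarrow> N (u - x) < r \<Longrightarrow> \<phi> (u - x) \<le> \<epsilon> * N (u - x)"
proof -
  have "Limsup (nearby A N x) (\<lambda>u. ereal (\<phi> (u - x) / N (u - x))) \<le> 0"
    using \<phi> unfolding frechet_normal_def by blast
  from this[unfolded Limsup_le_iff, rule_format, of "ereal \<epsilon>"] \<epsilon>
  have "eventually (\<lambda>u. ereal (\<phi> (u - x) / N (u - x)) < ereal \<epsilon>) (nearby A N x)"
    by simp
  then obtain r where "r > 0" and r: "\<forall>u\<in>A. u \<noteq> x \<and> N (u - x) < r \<longrightarrow> ereal (\<phi> (u - x) / N (u - x)) < ereal \<epsilon>"
    unfolding eventually_nearby by blast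
  show ?thesis
  proof (rule that[OF \<open>r > 0\<close>])
    fix u assume u: "u \<in> A" "u \<noteq> x" "N (u - x) < r"
    then have "\<phi> (u - x) / N (u - x) < \<epsilon>" using r by simp
    then show "\<phi> (u - x) \<le> \<epsilon> * N (u - x)" using N[OF u(1,2)] by (simp add: divide_less_eq)
  qed
qed

text \<open>\<open>dual_norm\<close> is a supremum of reals and dominates its members only once the
  set is bounded above, which the constant \<open>C\<close> from \<open>dual\<close> ensures. The
  rest is scaling \<open>v\<close> to norm 1.\<close>

lemma dual_ball_le:
  assumes \<phi>: "\<phi> \<in> dual_ball V N" and v: "v \<in> V" "N v > 0"
    and N: "\<And>t. N (t *\<^sub>R v) = \<bar>t\<bar> * N v" and V: "\<And>t. t *\<^sub>R v \<in> V"
  shows "\<bar>\<phi> v\<bar> \<le> N v"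
proof -
  have d: "\<phi> \<in> dual V N" "dual_norm V N \<phi> \<le> 1" using \<phi> by (auto simp: dual_ball_def)
  obtain C where C: "\<And>v. v \<in> V \<Longrightarrow> \<bar>\<phi> v\<bar> \<le> C * N v" using d(1) unfolding dual_def by blast
  have scale: "\<phi> (t *\<^sub>R v) = t * \<phi> v" for t using d(1) v(1) unfolding dual_def by blast
  have C0: "C \<ge> 0" using C[OF v(1)] v(2) by (smt (verit) mult_neg_pos)
  have bdd: "bdd_above ((\<lambda>v. \<bar>\<phi> v\<bar>) ` {v\<in>V. N v \<le> 1})"
  proof (rule bdd_aboveI2)
    fix u assume u: "u \<in> {v\<in>V. N v \<le> 1}"
    then have "\<bar>\<phi> u\<bar> \<le> C * N u" using C by blast
    also have "\<dots> \<le> C * 1" using u C0 by (intro mult_left_mono) auto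
    finally show "\<bar>\<phi> u\<bar> \<le> C" by simp
  qed
  define t where "t = 1 / N v"
  have t: "t > 0" using v by (simp add: t_def)
  have "t *\<^sub>R v \<in> {v\<in>V. N v \<le> 1}" using V N[of t] v t by (simp add: t_def)
  then have "\<bar>\<phi> (t *\<^sub>R v)\<bar> \<le> dual_norm V N \<phi>"
    unfolding dual_norm_def by (rule cSUP_upper[OF _ bdd])
  then have "\<bar>t * \<phi> v\<bar> \<le> 1" using d(2) scale by simp
  then show ?thesis using v t by (simp add: t_def abs_mult field_simps)
qed

text \<open>Converts the quadratic errors left by the variational principle into the errors
  \<open>\<epsilon> * t\<close> of Frechet subgradients and normals.\<close>

lemma quadratic_small:
  fixes K \<epsilon> :: real
  assumes "r > 0" "\<epsilon> > 0"
  obtains s where "s > 0" "s \<le> r" "\<And>t. 0 \<le> t \<Longrightarrow> t < s \<Longrightarrow> K * t\<^sup>2 \<le> \<epsilon> * t"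
proof (rule that[of "min r (\<epsilon> / (\<bar>K\<bar> + 1))"])
  show "min r (\<epsilon> / (\<bar>K\<bar> + 1)) > 0" using assms by (simp add: add_nonneg_pos)
  fix t :: real assume t: "0 \<le> t" "t < min r (\<epsilon> / (\<bar>K\<bar> + 1))"
  have "K * t \<le> (\<bar>K\<bar> + 1) * t" using t by (intro mult_right_mono) auto
  also have "\<dots> \<le> \<epsilon>" using t by (simp add: field_simps add_nonneg_pos)
  finally have "K * t * t \<le> \<epsilon> * t" using t by (intro mult_right_mono) auto
  then show "K * t\<^sup>2 \<le> \<epsilon> * t" by (simp add: power2_eq_square mult.assoc)
qed auto

section \<open>Functionals on the model space and on the tangent space\<close>

context normal_coordinates
begin

abbreviation V :: "('m, 'a) tvec set"
  where "V \<equiv> tangent_space A p"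

abbreviation N :: "('m, 'a) tvec \<Rightarrow> real"
  where "N \<equiv> tnorm g p"

text \<open>The value 0 off the tangent space is the normalization in \<open>dual\<close>;
  functionals that agree on the tangent space are then equal as functions.\<close>

definition covector :: "('a \<Rightarrow> real) \<Rightarrow> ('m, 'a) tvec \<Rightarrow> real"
  where "covector \<psi> v = (if v \<in> V then \<psi> (v c) else 0)"

lemma T_diff: "T (a - b) = T a - T b"
  by (rule tangent_vec_diff[OF chart_at])

lemma N_equivalent:
  obtains m M where "m > 0" "M > 0" "\<And>a. m * norm a \<le> N (T a)" "\<And>a. N (T a) \<le> M * norm a"
proof -
  obtain m M where mM: "m > 0" "M > 0" "\<And>v. v \<in> V \<Longrightarrow> m * norm (v c) \<le> N v"
    "\<And>v. v \<in> V \<Longrightarrow> N v \<le> M * norm (v c)"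
    using tnorm_equivalent[OF chart_at] by blast
  show ?thesis
    by (rule that[OF mM(1,2)]) (use mM(3,4)[OF T_in] in \<open>simp_all only: T_apply\<close>)
qed

lemma N_diff_pos:
  assumes "u \<in> V" "v \<in> V" "u \<noteq> v"
  shows "N (u - v) > 0"
proof -
  have "u - v \<in> V" using assms(1,2) by (rule tangent_space_diff)
  moreover have "u - v \<noteq> 0" using assms(3) unfolding right_minus_eq .
  ultimately have "g p (u - v) (u - v) > 0" using metric_pos by blast
  then show ?thesis unfolding tnorm_def by simp
qed

lemma covector_T: "covector \<psi> (T a) = \<psi> a"
  by (simp only: covector_def T_in if_True T_apply)

lemma covector_T_diff: "covector \<psi> (T a - T b) = \<psi> (a - b)"
  unfolding T_diff[symmetric] by (rule covector_T)

lemma covector_in_dual: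
  assumes \<psi>: "bounded_linear \<psi>"
  shows "covector \<psi> \<in> dual V N"
proof -
  interpret \<psi>: bounded_linear \<psi> by fact
  obtain m M where m: "m > 0" "\<And>a. m * norm a \<le> N (T a)" using N_equivalent by metis
  obtain B where B: "B \<ge> 0" "\<And>h. \<bar>\<psi> h\<bar> \<le> B * norm h"
    using \<psi>.nonneg_bounded by (auto simp: mult.commute)
  show ?thesis
    unfolding dual_def mem_Collect_eq
  proof (intro conjI ballI allI impI)
    fix u v r assume u: "u \<in> V"
    show "covector \<psi> (r *\<^sub>R u) = r * covector \<psi> u"
      using u tangent_space_scaleR[OF u u] by (simp add: covector_def scaleR_fun_def \<psi>.scaleR)
    assume v: "v \<in> V"
    show "covector \<psi> (u + v) = covector \<psi> u + covector \<psi> v"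
      using u v tangent_space_add[OF u v] by (simp add: covector_def \<psi>.add)
  next
    show "\<exists>C. \<forall>v\<in>V. \<bar>covector \<psi> v\<bar> \<le> C * N v"
    proof (intro exI[of _ "B / m"] ballI)
      fix v assume v: "v \<in> V"
      have "\<bar>covector \<psi> v\<bar> \<le> B * norm (v c)" using B v by (simp add: covector_def)
      also have "\<dots> = B / m * (m * norm (v c))" using m by simp
      also have "\<dots> \<le> B / m * N v"
        using m(2)[of "v c"] B m(1) unfolding T_coord[OF v] by (intro mult_left_mono) auto
      finally show "\<bar>covector \<psi> v\<bar> \<le> B / m * N v" .
    qed
  qed (simp add: covector_def)
qed

lemma
  assumes \<phi>: "\<phi> \<in> dual V N"
  shows dual_bounded_linear: "bounded_linear (\<lambda>a. \<phi> (T a))"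
    and covector_dual: "covector (\<lambda>a. \<phi> (T a)) = \<phi>"
proof -
  have d: "\<And>u v. u \<in> V \<Longrightarrow> v \<in> V \<Longrightarrow> \<phi> (u + v) = \<phi> u + \<phi> v"
    "\<And>r v. v \<in> V \<Longrightarrow> \<phi> (r *\<^sub>R v) = r * \<phi> v" "\<And>v. v \<notin> V \<Longrightarrow> \<phi> v = 0"
    using \<phi> unfolding dual_def by blast+
  obtain C where C: "\<And>v. v \<in> V \<Longrightarrow> \<bar>\<phi> v\<bar> \<le> C * N v" using \<phi> unfolding dual_def by blast
  obtain m M where M: "M > 0" "m > 0" "\<And>a. m * norm a \<le> N (T a)" "\<And>a. N (T a) \<le> M * norm a"
    using N_equivalent by metis
  show "bounded_linear (\<lambda>a. \<phi> (T a))"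
  proof (rule bounded_linear_intro[of _ "\<bar>C\<bar> * M"])
    fix a b :: 'a and r :: real
    show "\<phi> (T (a + b)) = \<phi> (T a) + \<phi> (T b)"
      unfolding tangent_vec_add[OF chart_at] by (rule d(1)[OF T_in T_in])
    show "\<phi> (T (r *\<^sub>R a)) = r *\<^sub>R \<phi> (T a)"
      unfolding tangent_vec_scaleR[OF chart_at] d(2)[OF T_in] by simp
    have "\<bar>\<phi> (T a)\<bar> \<le> C * N (T a)" by (rule C[OF T_in])
    also have "\<dots> \<le> \<bar>C\<bar> * N (T a)"
      using order_trans[OF _ M(3), of 0 a] M(2) by (intro mult_right_mono) auto
    also have "\<dots> \<le> \<bar>C\<bar> * (M * norm a)" by (intro mult_left_mono M) auto
    finally show "norm (\<phi> (T a)) \<le> norm a * (\<bar>C\<bar> * M)" by (simp add: mult_ac)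
  qed
  show "covector (\<lambda>a. \<phi> (T a)) = \<phi>"
  proof
    fix v show "covector (\<lambda>a. \<phi> (T a)) v = \<phi> v"
    proof (cases "v \<in> V")
      case True
      then show ?thesis unfolding covector_def T_coord[OF True] by simp
    next
      case False
      then show ?thesis unfolding covector_def using d(3) by simp
    qed
  qed
qed

text \<open>Frechet conditions survive the passage to an equivalent norm: since
  \<open>m * norm a \<le> N (T a)\<close>, the condition with \<open>\<epsilon> * m\<close> and
  radius \<open>r\<close> in the model norm yields the one with \<epsilon> and radius
  \<open>m * r\<close> in \<open>N\<close>.\<close>

lemma covector_in_frechet_subdiff:
  assumes \<psi>: "bounded_linear \<psi>" and hx: "\<bar>h (T x)\<bar> \<noteq> \<infinity>"
    and le: "\<And>\<epsilon>. \<epsilon> > 0 \<Longrightarrow> \<exists>r>0. \<forall>u. norm (u - x) < r \<longrightarrow> T u \<in> W \<longrightarrow>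
      h (T x) + ereal (\<psi> (u - x) - \<epsilon> * norm (u - x)) \<le> h (T u)"
  shows "covector \<psi> \<in> frechet_subdiff V N W h (T x)"
proof (rule frechet_subdiffI[where h = h and x = "T x", OF covector_in_dual[OF \<psi>] hx])
  show "N (u - T x) > 0" if "u \<in> W" "u \<noteq> T x" for u
    using N_diff_pos[OF _ T_in that(2)] that(1) normal_subset by blast
  obtain m M where m: "m > 0" "\<And>a. m * norm a \<le> N (T a)" using N_equivalent by metis
  fix \<epsilon> :: real assume "\<epsilon> > 0"
  then obtain r where r: "r > 0" "\<And>u. norm (u - x) < r \<Longrightarrow> T u \<in> W \<Longrightarrow>
      h (T x) + ereal (\<psi> (u - x) - (\<epsilon> * m) * norm (u - x)) \<le> h (T u)"
    using le[of "\<epsilon> * m"] m(1) by auto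
  show "\<exists>r>0. \<forall>u\<in>W. N (u - T x) < r \<longrightarrow>
      h (T x) + ereal (covector \<psi> (u - T x) - \<epsilon> * N (u - T x)) \<le> h u"
  proof (intro exI[of _ "m * r"] conjI ballI impI)
    show "m * r > 0" using m r by simp
    fix v assume v: "v \<in> W" "N (v - T x) < m * r"
    define u where "u = v c"
    have vu: "v = T u" unfolding u_def by (rule T_coord[symmetric]) (use v normal_subset in blast)
    have mN: "m * norm (u - x) \<le> N (T u - T x)" using m(2)[of "u - x"] unfolding T_diff .
    then have "m * norm (u - x) < m * r" using v(2) unfolding vu by linarith
    then have "norm (u - x) < r" using m by simp
    then have "h (T x) + ereal (\<psi> (u - x) - (\<epsilon> * m) * norm (u - x)) \<le> h (T u)"
      using r(2) v(1) unfolding vu by blast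
    moreover have "\<psi> (u - x) - \<epsilon> * N (T u - T x) \<le> \<psi> (u - x) - (\<epsilon> * m) * norm (u - x)"
      using mult_left_mono[OF mN, of \<epsilon>] \<open>\<epsilon> > 0\<close> by (simp add: mult.assoc)
    then have "h (T x) + ereal (\<psi> (u - x) - \<epsilon> * N (T u - T x))
        \<le> h (T x) + ereal (\<psi> (u - x) - (\<epsilon> * m) * norm (u - x))"
      by (intro add_left_mono) simp
    ultimately show "h (T x) + ereal (covector \<psi> (v - T x) - \<epsilon> * N (v - T x)) \<le> h v"
      unfolding vu covector_T_diff by (rule order_trans[rotated])
  qed
qed

lemma covector_in_frechet_normal:
  assumes \<psi>: "bounded_linear \<psi>" and Q: "Q \<subseteq> V"
    and le: "\<And>\<epsilon>. \<epsilon> > 0 \<Longrightarrow> \<exists>r>0. \<forall>u. norm (u - x) < r \<longrightarrow> T u \<in> Q \<longrightarrow> \<psi> (u - x) \<le> \<epsilon> * norm (u - x)"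
  shows "covector \<psi> \<in> frechet_normal V N Q (T x)"
proof (rule frechet_normalI[OF covector_in_dual[OF \<psi>]])
  show "N (u - T x) > 0" if "u \<in> Q" "u \<noteq> T x" for u
    using N_diff_pos[OF _ T_in that(2)] that(1) Q by blast
  obtain m M where m: "m > 0" "\<And>a. m * norm a \<le> N (T a)" using N_equivalent by metis
  fix \<epsilon> :: real assume "\<epsilon> > 0"
  then obtain r where r: "r > 0" "\<And>u. norm (u - x) < r \<Longrightarrow> T u \<in> Q \<Longrightarrow>
      \<psi> (u - x) \<le> (\<epsilon> * m) * norm (u - x)"
    using le[of "\<epsilon> * m"] m(1) by auto
  show "\<exists>r>0. \<forall>u\<in>Q. N (u - T x) < r \<longrightarrow> covector \<psi> (u - T x) \<le> \<epsilon> * N (u - T x)"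
  proof (intro exI[of _ "m * r"] conjI ballI impI)
    show "m * r > 0" using m r by simp
    fix v assume v: "v \<in> Q" "N (v - T x) < m * r"
    define u where "u = v c"
    have vu: "v = T u" unfolding u_def by (rule T_coord[symmetric]) (use v Q in blast)
    have mN: "m * norm (u - x) \<le> N (T u - T x)" using m(2)[of "u - x"] unfolding T_diff .
    then have "m * norm (u - x) < m * r" using v(2) unfolding vu by linarith
    then have "norm (u - x) < r" using m by simp
    then have "\<psi> (u - x) \<le> (\<epsilon> * m) * norm (u - x)"
      using r(2) v(1) unfolding vu by blast
    also have "\<dots> \<le> \<epsilon> * N (T u - T x)"
      using mult_left_mono[OF mN, of \<epsilon>] \<open>\<epsilon> > 0\<close> by (simp add: mult.assoc)
    finally show "covector \<psi> (v - T x) \<le> \<epsilon> * N (v - T x)" unfolding vu covector_T_diff .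
  qed
qed

text \<open>The passage back to the model norm uses the other half of the equivalence, with
  \<open>M\<close>. \<open>nearby\<close> omits the base point, so \<open>T b = 0\<close> is a
  separate case.\<close>

lemma frechet_normal_zeroD:
  assumes \<phi>: "\<phi> \<in> frechet_normal V N {v\<in>W. e v \<in> \<Omega>} 0" and \<epsilon>: "\<epsilon> > 0"
  shows "\<exists>r>0. \<forall>b. norm b < r \<and> b \<in> U \<and> e (T b) \<in> \<Omega> \<longrightarrow> \<phi> (T b) \<le> \<epsilon> * norm b"
proof -
  obtain m M where M: "M > 0" "\<And>a. N (T a) \<le> M * norm a" using N_equivalent by metis
  have pos: "N (u - 0) > 0" if "u \<in> {v\<in>W. e v \<in> \<Omega>}" "u \<noteq> 0" for u
    using N_diff_pos[of u 0] that normal_subset zero_in_normal by blast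
  obtain r where r: "r > 0" "\<And>u. u \<in> {v\<in>W. e v \<in> \<Omega>} \<Longrightarrow> u \<noteq> 0 \<Longrightarrow> N (u - 0) < r \<Longrightarrow>
      \<phi> (u - 0) \<le> (\<epsilon> / M) * N (u - 0)"
  proof (rule frechet_normalD[OF \<phi>, of "\<epsilon> / M"])
    show "N (u - 0) > 0" if "u \<in> {v\<in>W. e v \<in> \<Omega>}" "u \<noteq> 0" for u using that by (rule pos)
    show "\<epsilon> / M > 0" using \<epsilon> M by simp
  qed (rule that)
  have \<phi>0: "\<phi> 0 = 0"
  proof -
    have "\<phi> \<in> dual V N" using \<phi> unfolding frechet_normal_def by blast
    from linear_simps(3)[OF dual_bounded_linear[OF this]] show ?thesis unfolding T_zero .
  qed
  show ?thesis
  proof (intro exI[of _ "r / M"] conjI allI impI)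
    show "r / M > 0" using r M by simp
    fix b assume b: "norm b < r / M \<and> b \<in> U \<and> e (T b) \<in> \<Omega>"
    show "\<phi> (T b) \<le> \<epsilon> * norm b"
    proof (cases "T b = 0")
      case True
      show ?thesis unfolding True \<phi>0 using \<epsilon> by simp
    next
      case False
      have "M * norm b < r" using b M by (simp add: field_simps)
      then have "N (T b) < r" using M(2)[of b] by linarith
      moreover have "T b \<in> {v\<in>W. e v \<in> \<Omega>}" using b unfolding U_def by blast
      ultimately have "\<phi> (T b) \<le> (\<epsilon> / M) * N (T b)" using r(2)[of "T b"] False unfolding diff_0_right by blast
      also have "\<dots> \<le> (\<epsilon> / M) * (M * norm b)" using M \<epsilon> by (intro mult_left_mono) auto
      finally show ?thesis using M by simp
    qed
  qed
qed

lemma cotangent_ball_le: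
  assumes "\<phi> \<in> (*\<^sub>R) \<alpha> ` cotangent_ball A g p" "\<alpha> > 0"
  shows "\<bar>\<phi> (T a)\<bar> \<le> \<alpha> * N (T a)"
proof -
  obtain \<phi>0 where \<phi>0: "\<phi>0 \<in> dual_ball V N" "\<phi> = \<alpha> *\<^sub>R \<phi>0"
    using assms unfolding cotangent_ball_def by blast
  have "\<bar>\<phi>0 (T a)\<bar> \<le> N (T a)"
  proof (cases "T a = 0")
    case True
    have "\<phi>0 \<in> dual V N" using \<phi>0(1) unfolding dual_ball_def by blast
    from linear_simps(3)[OF dual_bounded_linear[OF this]] have "\<phi>0 0 = 0" unfolding T_zero .
    moreover have "N 0 \<ge> 0" unfolding tnorm_def using metric_nonneg[OF T_in[of 0]] unfolding T_zero by simp
    ultimately show ?thesis unfolding True by simp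
  next
    case False
    show ?thesis
    proof (rule dual_ball_le[OF \<phi>0(1) T_in])
      show "N (T a) > 0"
        using metric_pos[OF T_in T_in T_in False] unfolding tnorm_def by simp
      fix t
      show "t *\<^sub>R T a \<in> V" by (rule tangent_space_scaleR[OF T_in T_in])
      have tT: "t *\<^sub>R T a \<in> V" by fact
      have "g p (t *\<^sub>R T a) (t *\<^sub>R T a) = t * (t * g p (T a) (T a))"
        unfolding metric_scaleR[OF T_in tT tT] metric_sym[OF T_in tT tT] metric_scaleR[OF T_in T_in T_in] ..
      then show "N (t *\<^sub>R T a) = \<bar>t\<bar> * N (T a)"
        unfolding tnorm_def by (simp add: real_sqrt_mult mult.assoc[symmetric])
    qed
  qed
  then show ?thesis unfolding \<phi>0(2) scaleR_fun_def using assms(2) by (simp add: abs_mult)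
qed

section \<open>From weak sharpness to subgradients and their decomposition\<close>

text \<open>Every curve from \<open>e (T a)\<close> to \<Omega> has length at least
  \<open>k\<close>, hence so has the infimum over end points and curves; this includes the case of
  infinite distance. Weak sharpness turns the bound into growth of \<open>f\<close>.\<close>

lemma weak_sharp_normal_estimate:
  assumes ws: "weak_sharp_minima A g S f \<Omega> \<alpha>" and p: "p \<in> \<Omega>"
    and ball: "\<phi> \<in> (*\<^sub>R) \<alpha> ` cotangent_ball A g p"
    and normal: "\<phi> \<in> frechet_normal V N {v\<in>W. e v \<in> \<Omega>} 0" and \<epsilon>: "\<epsilon> > 0"
  shows "\<exists>r>0. \<forall>a. norm a < r \<longrightarrow> e (T a) \<in> S \<longrightarrow> f p + ereal (\<phi> (T a) - \<epsilon> * norm a) \<le> f (e (T a))"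
proof -
  have \<alpha>: "\<alpha> > 0" and sharp: "\<And>u. u \<in> S \<Longrightarrow> f p + ereal \<alpha> * set_dist A g u \<Omega> \<le> f u"
    using ws p unfolding weak_sharp_minima_def by blast+
  have "\<phi> \<in> dual V N" using normal unfolding frechet_normal_def by blast
  note bl = dual_bounded_linear[OF this]
  have le: "\<bar>\<phi> (T a)\<bar> \<le> \<alpha> * sqrt (metric_coord A g c (snd c p) a a)" for a
    using cotangent_ball_le[OF ball \<alpha>, of a] tnorm_coord[OF chart_at T_in, of a] by (simp add: T_apply)
  obtain r where r: "r > 0" "\<And>a \<gamma>. norm a < r \<Longrightarrow> piecewise_C1_curve A \<gamma> \<Longrightarrow> \<gamma> 0 = e (T a) \<Longrightarrow>
      \<gamma> 1 \<in> \<Omega> \<Longrightarrow> \<phi> (T a) - \<epsilon> * norm a \<le> \<alpha> * curve_length A g \<gamma>"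
    using normal_functional_le_curve_length[OF bl \<alpha> le frechet_normal_zeroD[OF normal] \<epsilon>] by blast
  have "f p + ereal (\<phi> (T a) - \<epsilon> * norm a) \<le> f (e (T a))" if a: "norm a < r" "e (T a) \<in> S" for a
  proof -
    define k where "k = (\<phi> (T a) - \<epsilon> * norm a) / \<alpha>"
    have k: "\<alpha> * k = \<phi> (T a) - \<epsilon> * norm a" using \<alpha> by (simp add: k_def)
    have "ereal k \<le> set_dist A g (e (T a)) \<Omega>"
      unfolding set_dist_def riem_dist_def
    proof (intro INF_greatest)
      fix q \<gamma> assume "q \<in> \<Omega>" "\<gamma> \<in> {\<gamma>. piecewise_C1_curve A \<gamma> \<and> \<gamma> 0 = e (T a) \<and> \<gamma> 1 = q}"
      then have "\<alpha> * k \<le> \<alpha> * curve_length A g \<gamma>" using r(2)[OF a(1), of \<gamma>] unfolding k by blast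
      then show "ereal k \<le> ereal (curve_length A g \<gamma>)" using \<alpha> by simp
    qed
    then have "ereal \<alpha> * ereal k \<le> ereal \<alpha> * set_dist A g (e (T a)) \<Omega>"
      using \<alpha> by (intro ereal_mult_left_mono) auto
    then have "f p + ereal (\<phi> (T a) - \<epsilon> * norm a) \<le> f p + ereal \<alpha> * set_dist A g (e (T a)) \<Omega>"
      unfolding times_ereal.simps k by (rule add_left_mono)
    also have "\<dots> \<le> f (e (T a))" by (rule sharp[OF a(2)])
    finally show ?thesis .
  qed
  with r(1) show ?thesis by blast
qed

text \<open>On \<open>S\<close> the indicator vanishes and the growth estimate applies; off
  \<open>S\<close> the value is \<infinity>.\<close>

lemma frechet_subdiff_indicator:
  assumes f: "proper_fun f" "\<bar>f p\<bar> \<noteq> \<infinity>" and ws: "weak_sharp_minima A g S f \<Omega> \<alpha>" and p: "p \<in> \<Omega>"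
    and ball: "\<phi> \<in> (*\<^sub>R) \<alpha> ` cotangent_ball A g p"
    and normal: "\<phi> \<in> frechet_normal V N {v\<in>W. e v \<in> \<Omega>} 0"
  shows "\<phi> \<in> mf_frechet_subdiff A g (\<lambda>u. f u + indicator_ext S u) p"
proof -
  define h where "h = (\<lambda>u. f u + indicator_ext S u) \<circ> e"
  have \<phi>d: "\<phi> \<in> dual V N" using normal unfolding frechet_normal_def by blast
  have pS: "p \<in> S" using ws p unfolding weak_sharp_minima_def argmin_set_def by blast
  have h0: "h (T 0) = f p" unfolding h_def o_def T_zero exp_zero using pS by (simp add: indicator_ext_def)
  have "covector (\<lambda>a. \<phi> (T a)) \<in> frechet_subdiff V N W h (T 0)"
  proof (rule covector_in_frechet_subdiff[OF dual_bounded_linear[OF \<phi>d]])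
    show "\<bar>h (T 0)\<bar> \<noteq> \<infinity>" unfolding h0 by fact
    fix \<epsilon> :: real assume "\<epsilon> > 0"
    from weak_sharp_normal_estimate[OF ws p ball normal this]
    obtain r where r: "r > 0" "\<And>a. norm a < r \<Longrightarrow> e (T a) \<in> S \<Longrightarrow>
        f p + ereal (\<phi> (T a) - \<epsilon> * norm a) \<le> f (e (T a))" by blast
    have "h (T 0) + ereal (\<phi> (T (u - 0)) - \<epsilon> * norm (u - 0)) \<le> h (T u)" if "norm (u - 0) < r" for u
    proof (cases "e (T u) \<in> S")
      case True
      then show ?thesis using r(2)[of u] that unfolding h0 by (simp add: h_def indicator_ext_def)
    next
      case False
      have "f (e (T u)) \<noteq> - \<infinity>" using f(1) unfolding proper_fun_def by blast
      then show ?thesis using False by (simp add: h_def indicator_ext_def)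
    qed
    with r(1) show "\<exists>r>0. \<forall>u. norm (u - 0) < r \<longrightarrow> T u \<in> W \<longrightarrow>
        h (T 0) + ereal (\<phi> (T (u - 0)) - \<epsilon> * norm (u - 0)) \<le> h (T u)" by blast
  qed
  then have "\<phi> \<in> frechet_subdiff V N W h 0" unfolding covector_dual[OF \<phi>d] T_zero .
  then show ?thesis unfolding mf_frechet_subdiff_def h_def using normal_nbhd by blast
qed

text \<open>The Hilbert space sum rule is applied at 0 to \<open>F\<close>, which is
  \<open>f\<close> in normal coordinates, and to the preimage \<open>C\<close> of \<open>S\<close>;
  the growth estimate says that \<phi> is a Frechet subgradient of \<open>F\<close> along
  \<open>C\<close>. The weak limit \<psi> splits \<phi> into \<open>\<phi> - \<psi>\<close> and
  \<psi>.\<close>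

lemma limiting_decomposition:
  assumes lip: "lipschitz_around A g f p" and S: "closed S"
    and ws: "weak_sharp_minima A g S f \<Omega> \<alpha>" and p: "p \<in> \<Omega>"
    and ball: "\<phi> \<in> (*\<^sub>R) \<alpha> ` cotangent_ball A g p"
    and normal: "\<phi> \<in> frechet_normal V N {v\<in>W. e v \<in> \<Omega>} 0"
  shows "\<phi> \<in> mf_limiting_subdiff A g f p + mf_limiting_normal A g S p"
proof -
  have \<phi>d: "\<phi> \<in> dual V N" using normal unfolding frechet_normal_def by blast
  note bl = dual_bounded_linear[OF \<phi>d]
  have pS: "p \<in> S" using ws p unfolding weak_sharp_minima_def argmin_set_def by blast
  obtain O' L where O': "open O'" "p \<in> O'" and L: "L > 0" and fin: "\<forall>x\<in>O'. \<bar>f x\<bar> \<noteq> \<infinity>"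
    and fL: "\<forall>x\<in>O'. \<forall>y\<in>O'. \<bar>f x - f y\<bar> \<le> ereal L * riem_dist A g x y"
    using lip unfolding lipschitz_around_def by (elim exE conjE) (rule that)
  obtain r1 L1 where r1: "r1 > 0" "L1 > 0" "ball 0 r1 \<subseteq> U" and dL:
    "\<And>a b. norm a < r1 \<Longrightarrow> norm b < r1 \<Longrightarrow> riem_dist A g (e (T a)) (e (T b)) \<le> ereal (L1 * norm (a - b))"
    using exp_lipschitz by blast
  have eT_cont: "continuous_on U (\<lambda>a. e (T a))"
  proof -
    have "continuous_on U (\<lambda>a. chart_inv c (E a))"
      by (rule continuous_on_compose2[OF continuous_on_chart_inv[OF c_in(1)] smooth_on_imp_continuous_on[OF smooth_E]])
        (use E_in in blast)
    then show ?thesis by (rule continuous_on_eq) (rule chart_inv_E)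
  qed
  have "open (U \<inter> (\<lambda>a. e (T a)) -` O')"
    by (rule continuous_open_preimage[OF eT_cont open_U O'(1)])
  moreover have "0 \<in> U \<inter> (\<lambda>a. e (T a)) -` O'"
    using zero_in_U O'(2) unfolding Int_iff vimage_eq T_zero exp_zero by (intro conjI)
  ultimately obtain r2 where r2: "r2 > 0" "ball 0 r2 \<subseteq> U \<inter> (\<lambda>a. e (T a)) -` O'" using openE by blast
  define \<rho> where "\<rho> = min r1 r2 / 2"
  have \<rho>: "\<rho> > 0" "\<rho> < r1" "\<rho> < r2" using r1 r2 by (auto simp: \<rho>_def)
  have inU: "a \<in> U" "e (T a) \<in> O'" if "norm a \<le> \<rho>" for a
    using subsetD[OF r2(2), of a] that \<rho> by auto
  \<comment> \<open>\<open>F\<close> represents \<open>f\<close> on the ball of radius \<rho>, where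
    \<open>f\<close> is finite. Outside, \<open>f\<close> may be infinite and
    \<open>real_of_ereal\<close> would return 0, so all inequalities are kept inside.\<close>
  define F where "F a = real_of_ereal (f (e (T a)))" for a
  have fF: "f (e (T a)) = ereal (F a)" if "norm a \<le> \<rho>" for a
    using bspec[OF fin inU(2)[OF that]] unfolding F_def by (simp add: ereal_real)
  have FL: "(L * L1)-lipschitz_on (cball 0 \<rho>) F"
  proof (rule lipschitz_onI)
    fix a b :: 'a assume "a \<in> cball 0 \<rho>" "b \<in> cball 0 \<rho>"
    then have ab: "norm a \<le> \<rho>" "norm b \<le> \<rho>" by auto
    have "\<bar>f (e (T a)) - f (e (T b))\<bar> \<le> ereal L * riem_dist A g (e (T a)) (e (T b))"
      using fL inU(2) ab by blast
    also have "\<dots> \<le> ereal L * ereal (L1 * norm (a - b))"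
      using ab \<rho> L by (intro ereal_mult_left_mono dL) auto
    finally show "dist (F a) (F b) \<le> L * L1 * dist a b"
      unfolding fF[OF ab(1)] fF[OF ab(2)] by (simp add: dist_norm dist_real_def)
  qed (use L r1 in simp)
  \<comment> \<open>Only the trace of \<open>C\<close> on the closed ball is shown to be closed: the
    ball lies in \<open>U\<close>, where the exponential map is continuous, while \<open>W\<close>
    need not be closed.\<close>
  define C where "C = {a. T a \<in> W \<and> e (T a) \<in> S}"
  have "C \<inter> cball 0 \<rho> = cball 0 \<rho> \<inter> (\<lambda>a. e (T a)) -` S"
    using inU(1) unfolding C_def U_def by auto
  moreover have "closed (cball 0 \<rho> \<inter> (\<lambda>a. e (T a)) -` S)"
    by (rule continuous_closed_preimage[OF continuous_on_subset[OF eT_cont] closed_cball S]) (use inU in auto)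
  ultimately have clC: "closed (C \<inter> cball 0 \<rho>)" by simp
  have C0: "0 \<in> C" unfolding C_def mem_Collect_eq T_zero exp_zero using zero_in_normal pS by (intro conjI)
  have fp: "f p = ereal (F 0)" using fF[of 0] \<rho> unfolding T_zero exp_zero by simp
  have fr: "\<exists>r>0. \<forall>y\<in>C. norm y < r \<longrightarrow> F 0 + \<phi> (T y) - \<epsilon> * norm y \<le> F y" if "\<epsilon> > 0" for \<epsilon>
  proof -
    obtain r where r: "r > 0" "\<And>a. norm a < r \<Longrightarrow> e (T a) \<in> S \<Longrightarrow>
        f p + ereal (\<phi> (T a) - \<epsilon> * norm a) \<le> f (e (T a))"
      using weak_sharp_normal_estimate[OF ws p ball normal \<open>\<epsilon> > 0\<close>] by blast
    show ?thesis
    proof (intro exI[of _ "min r \<rho>"] conjI ballI impI)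
      fix y assume y: "y \<in> C" "norm y < min r \<rho>"
      then show "F 0 + \<phi> (T y) - \<epsilon> * norm y \<le> F y"
        using r(2)[of y] fF[of y] fp by (simp add: C_def)
    qed (use r \<rho> in simp)
  qed
  obtain \<psi> xs ys vs ws where \<psi>: "bounded_linear \<psi>" and lim: "xs \<longlonglongrightarrow> 0" "ys \<longlonglongrightarrow> 0"
    "\<And>h. (\<lambda>n. vs n \<bullet> h) \<longlonglongrightarrow> \<psi> h" "\<And>h. (\<lambda>n. ws n \<bullet> h) \<longlonglongrightarrow> \<psi> h"
    and xy: "\<And>n. norm (xs n) < \<rho>" "\<And>n. ys n \<in> C" "\<And>n. norm (ys n) < \<rho>"
    and proxF: "\<And>n. \<exists>r>0. \<exists>K. \<forall>u. norm (u - xs n) < r \<longrightarrow>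
       F (xs n) + (\<phi> (T (u - xs n)) - vs n \<bullet> (u - xs n)) - K * (norm (u - xs n))\<^sup>2 \<le> F u"
    and proxC: "\<And>n. \<exists>r>0. \<exists>K. \<forall>u\<in>C. norm (u - ys n) < r \<longrightarrow> ws n \<bullet> (u - ys n) \<le> K * (norm (u - ys n))\<^sup>2"
    using limiting_sum_rule_indicator[OF bl \<rho>(1) FL clC C0 fr] by blast
  obtain m M where M: "M > 0" "m > 0" "\<And>a. m * norm a \<le> N (T a)" "\<And>a. N (T a) \<le> M * norm a"
    using N_equivalent by metis
  have N_lim: "(\<lambda>n. N (T (zs n) - 0)) \<longlonglongrightarrow> 0" if "zs \<longlonglongrightarrow> 0" for zs
  proof (rule tendsto_sandwich[OF _ _ tendsto_const])
    show "(\<lambda>n. M * norm (zs n)) \<longlonglongrightarrow> 0" using tendsto_mult_left[OF tendsto_norm[OF that], of M] by simp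
    have "0 \<le> N (T a)" for a using order_trans[OF _ M(3), of 0 a] M(2) by simp
    then show "\<forall>\<^sub>F n in sequentially. 0 \<le> N (T (zs n) - 0)" unfolding diff_0_right by simp
    show "\<forall>\<^sub>F n in sequentially. N (T (zs n) - 0) \<le> M * norm (zs n)" unfolding diff_0_right using M(4) by simp
  qed
  have inner_bl: "bounded_linear (\<lambda>h. v \<bullet> h)" for v :: 'a by (rule bounded_linear_inner_right)
  have cov_lim: "(\<lambda>n. covector (\<psi>s n) v) \<longlonglongrightarrow> covector \<psi>' v"
    if "\<And>h. (\<lambda>n. \<psi>s n h) \<longlonglongrightarrow> \<psi>' h" for \<psi>s \<psi>' v
    unfolding covector_def using that by (cases "v \<in> V") auto
  have 1: "covector (\<lambda>a. \<phi> (T a) - \<psi> a) \<in> limiting_subdiff V N W (f \<circ> e) 0"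
    unfolding limiting_subdiff_def mem_Collect_eq
  proof (intro conjI exI[of _ "\<lambda>n. T (xs n)"] exI[of _ "\<lambda>n. covector (\<lambda>a. \<phi> (T a) - vs n \<bullet> a)"] allI ballI)
    show "covector (\<lambda>a. \<phi> (T a) - \<psi> a) \<in> dual V N"
      by (intro covector_in_dual bounded_linear_sub bl \<psi>)
    show "\<bar>(f \<circ> e) 0\<bar> \<noteq> \<infinity>" unfolding o_def exp_zero fp by simp
    show "T (xs n) \<in> W" for n using inU(1)[of "xs n"] xy(1)[of n] by (simp add: U_def)
    show "(\<lambda>n. N (T (xs n) - 0)) \<longlonglongrightarrow> 0" by (rule N_lim[OF lim(1)])
    show "(\<lambda>n. covector (\<lambda>a. \<phi> (T a) - vs n \<bullet> a) v) \<longlonglongrightarrow> covector (\<lambda>a. \<phi> (T a) - \<psi> a) v" for v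
      by (intro cov_lim tendsto_diff tendsto_const lim)
    have "(\<lambda>n. F (xs n)) \<longlonglongrightarrow> F 0"
      by (rule continuous_on_tendsto_compose[OF lipschitz_on_continuous_on[OF FL] lim(1)])
        (use \<rho> less_imp_le[OF xy(1)] in auto)
    then show "(\<lambda>n. (f \<circ> e) (T (xs n))) \<longlonglongrightarrow> (f \<circ> e) 0"
      unfolding o_def exp_zero fp using fF[OF less_imp_le[OF xy(1)]] by simp
    fix n
    show "covector (\<lambda>a. \<phi> (T a) - vs n \<bullet> a) \<in> frechet_subdiff V N W (f \<circ> e) (T (xs n))"
    proof (rule covector_in_frechet_subdiff[OF bounded_linear_sub[OF bl inner_bl]])
      have fx: "(f \<circ> e) (T (xs n)) = ereal (F (xs n))" using fF xy(1)[of n] by simp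
      then show "\<bar>(f \<circ> e) (T (xs n))\<bar> \<noteq> \<infinity>" by simp
      fix \<epsilon> :: real assume \<epsilon>: "\<epsilon> > 0"
      obtain r K where r: "r > 0" and K: "\<And>u. norm (u - xs n) < r \<Longrightarrow>
         F (xs n) + (\<phi> (T (u - xs n)) - vs n \<bullet> (u - xs n)) - K * (norm (u - xs n))\<^sup>2 \<le> F u"
        using proxF[of n] by blast
      \<comment> \<open>Distances below \<open>\<rho> - norm (xs n)\<close> keep \<open>u\<close> in
        the ball where \<open>F\<close> represents \<open>f\<close>.\<close>
      have "min r (\<rho> - norm (xs n)) > 0" using r xy(1)[of n] by simp
      then obtain s where s: "s > 0" "s \<le> min r (\<rho> - norm (xs n))"
        "\<And>t. 0 \<le> t \<Longrightarrow> t < s \<Longrightarrow> K * t\<^sup>2 \<le> \<epsilon> * t"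
        using quadratic_small[OF _ \<epsilon>] by blast
      have "(f \<circ> e) (T (xs n)) + ereal (\<phi> (T (u - xs n)) - vs n \<bullet> (u - xs n) - \<epsilon> * norm (u - xs n))
          \<le> (f \<circ> e) (T u)" if u: "norm (u - xs n) < s" for u
      proof -
        have "norm u \<le> \<rho>" using norm_triangle_ineq[of "u - xs n" "xs n"] u s(2) by simp
        moreover have "F (xs n) + (\<phi> (T (u - xs n)) - vs n \<bullet> (u - xs n) - \<epsilon> * norm (u - xs n)) \<le> F u"
          using K[of u] s(3)[OF norm_ge_zero u] u s(2) by simp
        ultimately show ?thesis unfolding fx by (simp add: fF)
      qed
      with s(1) show "\<exists>r>0. \<forall>u. norm (u - xs n) < r \<longrightarrow> T u \<in> W \<longrightarrow>
        (f \<circ> e) (T (xs n)) + ereal (\<phi> (T (u - xs n)) - vs n \<bullet> (u - xs n) - \<epsilon> * norm (u - xs n))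
          \<le> (f \<circ> e) (T u)" by blast
    qed
  qed
  have 2: "covector \<psi> \<in> limiting_normal V N {v\<in>W. e v \<in> S} 0"
    unfolding limiting_normal_def mem_Collect_eq
  proof (intro conjI exI[of _ "\<lambda>n. T (ys n)"] exI[of _ "\<lambda>n. covector (\<lambda>a. ws n \<bullet> a)"] allI ballI)
    show "covector \<psi> \<in> dual V N" by (rule covector_in_dual[OF \<psi>])
    show "T (ys n) \<in> W" "e (T (ys n)) \<in> S" for n using xy(2)[of n] by (auto simp: C_def)
    show "(\<lambda>n. N (T (ys n) - 0)) \<longlonglongrightarrow> 0" by (rule N_lim[OF lim(2)])
    show "(\<lambda>n. covector (\<lambda>a. ws n \<bullet> a) v) \<longlonglongrightarrow> covector \<psi> v" for v
      by (intro cov_lim lim)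
    fix n
    show "covector (\<lambda>a. ws n \<bullet> a) \<in> frechet_normal V N {v\<in>W. e v \<in> S} (T (ys n))"
    proof (rule covector_in_frechet_normal[OF inner_bl])
      show "{v\<in>W. e v \<in> S} \<subseteq> V" using normal_subset by blast
      fix \<epsilon> :: real assume \<epsilon>: "\<epsilon> > 0"
      obtain r K where r: "r > 0" and K: "\<And>u. u \<in> C \<Longrightarrow> norm (u - ys n) < r \<Longrightarrow>
         ws n \<bullet> (u - ys n) \<le> K * (norm (u - ys n))\<^sup>2"
        using proxC[of n] by blast
      obtain s where s: "s > 0" "s \<le> r" "\<And>t. 0 \<le> t \<Longrightarrow> t < s \<Longrightarrow> K * t\<^sup>2 \<le> \<epsilon> * t"
        using quadratic_small[OF r \<epsilon>] by blast
      have "ws n \<bullet> (u - ys n) \<le> \<epsilon> * norm (u - ys n)"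
        if u: "norm (u - ys n) < s" "T u \<in> {v\<in>W. e v \<in> S}" for u
        using K[of u] s(3)[OF norm_ge_zero u(1)] u s(2) by (simp add: C_def)
      with s(1) show "\<exists>r>0. \<forall>u. norm (u - ys n) < r \<longrightarrow> T u \<in> {v\<in>W. e v \<in> S} \<longrightarrow>
          ws n \<bullet> (u - ys n) \<le> \<epsilon> * norm (u - ys n)" by blast
    qed
  qed
  have eq: "\<phi> = covector (\<lambda>a. \<phi> (T a) - \<psi> a) + covector \<psi>"
  proof
    fix v
    have "\<phi> v = covector (\<lambda>a. \<phi> (T a)) v" unfolding covector_dual[OF \<phi>d] ..
    then show "\<phi> v = (covector (\<lambda>a. \<phi> (T a) - \<psi> a) + covector \<psi>) v" by (simp add: covector_def)
  qed
  have "covector (\<lambda>a. \<phi> (T a) - \<psi> a) \<in> mf_limiting_subdiff A g f p"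
    unfolding mf_limiting_subdiff_def using normal_nbhd 1 by blast
  moreover have "covector \<psi> \<in> mf_limiting_normal A g S p"
    unfolding mf_limiting_normal_def using normal_nbhd 2 by blast
  ultimately have "covector (\<lambda>a. \<phi> (T a) - \<psi> a) + covector \<psi>
      \<in> mf_limiting_subdiff A g f p + mf_limiting_normal A g S p"
    by (rule set_plus_intro)
  then show ?thesis unfolding eq[symmetric] .
qed

end

theorem corollary5p2:
  fixes A :: "('m::t2_space, 'a::{real_inner, banach}) chart set"
    and g :: "('m, 'a) metric"
    and S \<Omega> :: "'m set"
    and f :: "'m \<Rightarrow> ereal"
    and \<alpha> :: real
  assumes "riemannian_manifold A g"
    and "proper_fun f"
    and "weak_sharp_minima A g S f \<Omega> \<alpha>"
  shows "(\<forall>p\<in>\<Omega>. frechet_decomposable A g S f p \<longrightarrow>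
            (*\<^sub>R) \<alpha> ` cotangent_ball A g p \<inter> mf_frechet_normal A g \<Omega> p
              \<subseteq> mf_frechet_subdiff A g f p + mf_frechet_normal A g S p) \<and>
         (\<forall>p\<in>\<Omega>. lipschitz_around A g f p \<and> closed S \<longrightarrow>
            (*\<^sub>R) \<alpha> ` cotangent_ball A g p \<inter> mf_frechet_normal A g \<Omega> p
              \<subseteq> mf_limiting_subdiff A g f p + mf_limiting_normal A g S p)"
proof -
  interpret riemannian_manifold A g by fact
  \<comment> \<open>Normal neighborhoods are not constructed: a functional in the normal cone to
    \<Omega> brings one along, and the same \<open>W\<close> then serves as witness in the
    subdifferentials and in the limiting normal cone to \<open>S\<close>.\<close>
  have *: "\<exists>W c. normal_coordinates A g p W c \<and>
      \<phi> \<in> frechet_normal (tangent_space A p) (tnorm g p) {v\<in>W. exp_map A g p v \<in> \<Omega>} 0"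
    if \<phi>: "\<phi> \<in> mf_frechet_normal A g \<Omega> p" for \<phi> p
  proof -
    obtain W where W: "normal_nbhd A g p W"
      "\<phi> \<in> frechet_normal (tangent_space A p) (tnorm g p) {v\<in>W. exp_map A g p v \<in> \<Omega>} 0"
      using \<phi> unfolding mf_frechet_normal_def by blast
    obtain c where "c \<in> charts_at A p" by (rule charts_cover)
    then have "normal_coordinates A g p W c"
      using W(1) riemannian_manifold_axioms
      by (simp add: normal_coordinates_def normal_coordinates_axioms_def)
    with W(2) show ?thesis by blast
  qed
  show ?thesis
  proof (intro conjI ballI impI subsetI)
    fix p \<phi> assume p: "p \<in> \<Omega>" and dec: "frechet_decomposable A g S f p"
      and \<phi>: "\<phi> \<in> (*\<^sub>R) \<alpha> ` cotangent_ball A g p \<inter> mf_frechet_normal A g \<Omega> p"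
    obtain W c where nc: "normal_coordinates A g p W c"
      and n: "\<phi> \<in> frechet_normal (tangent_space A p) (tnorm g p) {v\<in>W. exp_map A g p v \<in> \<Omega>} 0"
      using * \<phi> by blast
    have fin: "\<bar>f p\<bar> \<noteq> \<infinity>"
      using dec unfolding frechet_decomposable_def by (elim conjE)
    have sub: "mf_frechet_subdiff A g (\<lambda>u. f u + indicator_ext S u) p
        \<subseteq> mf_frechet_subdiff A g f p + mf_frechet_normal A g S p"
      using dec unfolding frechet_decomposable_def by (elim conjE)
    from normal_coordinates.frechet_subdiff_indicator[OF nc assms(2) fin assms(3) p _ n]
    have "\<phi> \<in> mf_frechet_subdiff A g (\<lambda>u. f u + indicator_ext S u) p" using \<phi> by blast
    then show "\<phi> \<in> mf_frechet_subdiff A g f p + mf_frechet_normal A g S p" by (rule subsetD[OF sub])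
  next
    fix p \<phi> assume p: "p \<in> \<Omega>" and lip: "lipschitz_around A g f p \<and> closed S"
      and \<phi>: "\<phi> \<in> (*\<^sub>R) \<alpha> ` cotangent_ball A g p \<inter> mf_frechet_normal A g \<Omega> p"
    obtain W c where nc: "normal_coordinates A g p W c"
      and n: "\<phi> \<in> frechet_normal (tangent_space A p) (tnorm g p) {v\<in>W. exp_map A g p v \<in> \<Omega>} 0"
      using * \<phi> by blast
    show "\<phi> \<in> mf_limiting_subdiff A g f p + mf_limiting_normal A g S p"
      using normal_coordinates.limiting_decomposition[OF nc _ _ assms(3) p _ n] lip \<phi> by blast
  qed
qed

end
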